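(* Let $L$ be an even integral lattice containing at least two (mutually orthogonal) integral hyperbolic planes, such that $\operatorname{rank}_2(L)\ge 6$ and $\operatorname{rank}_3(L)\ge 5$. Then the abelianisation of $\widetilde{\mathrm{SO}}^+(L)$ is trivial, and the abelianisation of $\widetilde{\mathrm{O}}^+(L)$ is isomorphic to $\mathbb Z/2\mathbb Z$.
   Context: An even integral lattice is a free $\mathbb Z$-module $L$ of finite rank with a non-degenerate symmetric bilinear form $(\cdot,\cdot)\colon L\times L\to\mathbb Z$ such that $(u,u)\in 2\mathbb Z$ for all $u\in L$. The integral hyperbolic plane is $U=\mathbb Z e\oplus\mathbb Z f$ with $(e,e)=(f,f)=0$, $(e,f)=1$; the hypothesis means $L\cong U\oplus U\oplus L_0$ (orthogonal sum) for some lattice $L_0$. For a prime $p$, $\operatorname{rank}_p(L)$ is the maximal rank of a sublattice $M\subseteq L$ with $\det(M)$ coprime to $p$. Let $L^\vee=\{v\in L\otimes\mathbb Q\mid (v,l)\in\mathbb Z\ \forall l\in L\}$ and $D(L)=L^\vee/L$, with the induced $\mathbb Q/2\mathbb Z$-valued quadratic form. Put $\widetilde{\mathrm O}(L)=\ker(\mathrm O(L)\to\mathrm O(D(L)))$. Any $g\in \mathrm O(L\otimes\mathbb R)$ is a product of reflections $g=\sigma_{v_1}\cdots\sigma_{v_m}$, where $\sigma_v(x)=x-\frac{2(x,v)}{(v,v)}v$; its real spinor norm is $\mathrm{sn}_{\mathbb R}(g)=\prod_i\bigl(-\frac{(v_i,v_i)}2\bigr)\cdot(\mathbb R^\times)^2\in\mathbb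 R^\times/(\mathbb R^\times)^2$. Put $\mathrm O^+(L)=\mathrm O(L)\cap\ker \mathrm{sn}_{\mathbb R}$, $\widetilde{\mathrm O}^+(L)=\widetilde{\mathrm O}(L)\cap\mathrm O^+(L)$ and $\widetilde{\mathrm{SO}}^+(L)=\widetilde{\mathrm O}^+(L)\cap \mathrm{SO}(L)$. The abelianisation of a group $G$ is $G/[G,G]$. *)

theory Defs
  imports
    "HOL-Analysis.Determinants"
    "HOL-Algebra.Elementary_Groups"
    "HOL-Algebra.Bij"
    "HOL-Algebra.Generated_Groups"
    "Jordan_Normal_Form.Determinant"
begin

section \<open>Lattices and their determinants\<close>

text \<open>
  A lattice is given by its image in a real vector space, together with a real bilinear form
  \<open>b\<close> on that space; a lattice \<open>L\<close> whose real span is the whole space \<open>V\<close> realises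
  \<open>V\<close> as \<open>L \<otimes> \<real>\<close>, with \<open>b\<close> the extended form. Sublattices of \<open>L\<close> and orthogonal
  summands of \<open>L\<close> are lattices in the same space that need not span it.
\<close>

definition zspan :: "'a::real_vector set \<Rightarrow> 'a set" where
  "zspan B = {\<Sum>v\<in>B. of_int (c v) *\<^sub>R v | c :: 'a \<Rightarrow> int. True}"

definition lattice_basis :: "'a::real_vector list \<Rightarrow> 'a set \<Rightarrow> bool" where
  "lattice_basis vs M \<longleftrightarrow> distinct vs \<and> independent (set vs) \<and> M = zspan (set vs)"

definition integral_lattice :: "('a::real_vector \<Rightarrow> 'a \<Rightarrow> real) \<Rightarrow> 'a set \<Rightarrow> bool" where
  "integral_lattice b M \<longleftrightarrow>
     (\<exists>vs. lattice_basis vs M) \<and>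
     (\<forall>x\<in>M. \<forall>y\<in>M. b x y \<in> \<int>) \<and>
     (\<forall>x\<in>M. (\<forall>y\<in>M. b x y = 0) \<longrightarrow> x = 0)"

definition even_integral_lattice :: "('a::real_vector \<Rightarrow> 'a \<Rightarrow> real) \<Rightarrow> 'a set \<Rightarrow> bool" where
  "even_integral_lattice b M \<longleftrightarrow>
     integral_lattice b M \<and> (\<forall>x\<in>M. \<exists>k::int. b x x = of_int (2 * k))"

definition hyperbolic_plane :: "('a::real_vector \<Rightarrow> 'a \<Rightarrow> real) \<Rightarrow> 'a set \<Rightarrow> bool" where
  "hyperbolic_plane b P \<longleftrightarrow>
     (\<exists>e f. lattice_basis [e, f] P \<and> b e e = 0 \<and> b f f = 0 \<and> b e f = 1)"

definition orthogonal_sets :: "('a \<Rightarrow> 'a \<Rightarrow> real) \<Rightarrow> 'a set \<Rightarrow> 'a set \<Rightarrow> bool" where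
  "orthogonal_sets b M N \<longleftrightarrow> (\<forall>x\<in>M. \<forall>y\<in>N. b x y = 0)"

text \<open>
  An orthogonal decomposition \<open>L = P\<^sub>1 \<oplus> P\<^sub>2 \<oplus> L\<^sub>0\<close>. The sum is direct because the summands are
  pairwise orthogonal and the form is nondegenerate on each of them.
\<close>

definition two_hyperbolic_planes :: "('a::real_vector \<Rightarrow> 'a \<Rightarrow> real) \<Rightarrow> 'a set \<Rightarrow> bool" where
  "two_hyperbolic_planes b L \<longleftrightarrow>
     (\<exists>P\<^sub>1 P\<^sub>2 L\<^sub>0. hyperbolic_plane b P\<^sub>1 \<and> hyperbolic_plane b P\<^sub>2 \<and> integral_lattice b L\<^sub>0 \<and>
        orthogonal_sets b P\<^sub>1 P\<^sub>2 \<and> orthogonal_sets b P\<^sub>1 L\<^sub>0 \<and> orthogonal_sets b P\<^sub>2 L\<^sub>0 \<and>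
        L = {x + y + z | x y z. x \<in> P\<^sub>1 \<and> y \<in> P\<^sub>2 \<and> z \<in> L\<^sub>0})"

definition gram_det :: "('a \<Rightarrow> 'a \<Rightarrow> real) \<Rightarrow> 'a list \<Rightarrow> real" where
  "gram_det b vs =
     Determinant.det (Matrix.mat (length vs) (length vs) (\<lambda>(i, j). b (vs ! i) (vs ! j)))"

text \<open>
  The maximum is taken over a set that contains \<open>0\<close> (the zero sublattice has determinant \<open>1\<close>)
  and is bounded by the rank of \<open>L\<close>.
\<close>

definition p_rank :: "nat \<Rightarrow> ('a::real_vector \<Rightarrow> 'a \<Rightarrow> real) \<Rightarrow> 'a set \<Rightarrow> nat" where
  "p_rank p b L =
     Max {r. \<exists>M vs. M \<subseteq> L \<and> lattice_basis vs M \<and> length vs = r \<and>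
                (\<exists>d::int. gram_det b vs = of_int d \<and> coprime d (int p))}"

section \<open>Orthogonal groups\<close>

definition maps_group :: "('a \<Rightarrow> 'a) set \<Rightarrow> ('a \<Rightarrow> 'a) monoid" where
  "maps_group S = \<lparr>carrier = S, mult = (\<circ>), one = id\<rparr>"

definition orth_real :: "('a::real_vector \<Rightarrow> 'a \<Rightarrow> real) \<Rightarrow> ('a \<Rightarrow> 'a) set" where
  "orth_real b = {g. linear g \<and> bij g \<and> (\<forall>x y. b (g x) (g y) = b x y)}"

text \<open>An isometry of \<open>L\<close> is identified with its linear extension to \<open>L \<otimes> \<real>\<close>.\<close>

definition orth :: "('a::real_vector \<Rightarrow> 'a \<Rightarrow> real) \<Rightarrow> 'a set \<Rightarrow> ('a \<Rightarrow> 'a) set" where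
  "orth b L = {g \<in> orth_real b. g ` L = L}"

definition special_orth ::
  "(real^'n \<Rightarrow> real^'n \<Rightarrow> real) \<Rightarrow> (real^'n) set \<Rightarrow> (real^'n \<Rightarrow> real^'n) set" where
  "special_orth b L = {g \<in> orth b L. Determinants.det (matrix g) = 1}"

section \<open>The discriminant group\<close>

definition rational_span :: "'a::real_vector set \<Rightarrow> 'a set" where
  "rational_span L = {of_rat q *\<^sub>R l | q l. l \<in> L}"

definition dual_lattice :: "('a::real_vector \<Rightarrow> 'a \<Rightarrow> real) \<Rightarrow> 'a set \<Rightarrow> 'a set" where
  "dual_lattice b L = {v \<in> rational_span L. \<forall>l\<in>L. b v l \<in> \<int>}"

definition add_group :: "'a::ab_group_add set \<Rightarrow> 'a monoid" where
  "add_group A = \<lparr>carrier = A, mult = (+), one = 0\<rparr>"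

definition disc_group :: "('a::real_vector \<Rightarrow> 'a \<Rightarrow> real) \<Rightarrow> 'a set \<Rightarrow> 'a set monoid" where
  "disc_group b L = add_group (dual_lattice b L) Mod L"

text \<open>
  The value of the discriminant form at a coset \<open>X\<close> is the class of \<open>b x x\<close> modulo \<open>2\<int>\<close>, for
  \<open>x \<in> X\<close>, as a set of reals; for even \<open>L\<close> all representatives \<open>x\<close> contribute the same class.
\<close>

definition disc_form :: "('a \<Rightarrow> 'a \<Rightarrow> real) \<Rightarrow> 'a set \<Rightarrow> real set" where
  "disc_form b X = {b x x + of_int (2 * k) | x k. x \<in> X}"

definition disc_orth_group ::
  "('a::real_vector \<Rightarrow> 'a \<Rightarrow> real) \<Rightarrow> 'a set \<Rightarrow> ('a set \<Rightarrow> 'a set) monoid" where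
  "disc_orth_group b L =
     AutoGroup (disc_group b L)
       \<lparr>carrier := {\<phi> \<in> auto (disc_group b L).
          \<forall>X\<in>carrier (disc_group b L). disc_form b (\<phi> X) = disc_form b X}\<rparr>"

text \<open>\<open>g\<close> sends the coset \<open>x + L\<close> to its image \<open>g ` (x + L) = g x + L\<close>.\<close>

definition disc_action ::
  "('a::real_vector \<Rightarrow> 'a \<Rightarrow> real) \<Rightarrow> 'a set \<Rightarrow> ('a \<Rightarrow> 'a) \<Rightarrow> 'a set \<Rightarrow> 'a set" where
  "disc_action b L g = (\<lambda>X\<in>carrier (disc_group b L). g ` X)"

definition stable_orth :: "('a::real_vector \<Rightarrow> 'a \<Rightarrow> real) \<Rightarrow> 'a set \<Rightarrow> ('a \<Rightarrow> 'a) set" where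
  "stable_orth b L = kernel (maps_group (orth b L)) (disc_orth_group b L) (disc_action b L)"

section \<open>The real spinor norm\<close>

definition reflection ::
  "('a::real_vector \<Rightarrow> 'a \<Rightarrow> real) \<Rightarrow> 'a \<Rightarrow> 'a \<Rightarrow> 'a" where
  "reflection b v x = x - (2 * b x v / b v v) *\<^sub>R v"

definition real_units :: "real monoid" where
  "real_units = \<lparr>carrier = - {0}, mult = (*), one = 1\<rparr>"

definition real_squares :: "real set" where
  "real_squares = {t\<^sup>2 | t. t \<noteq> 0}"

text \<open>
  On the orthogonal group of a nondegenerate form the class below exists and is unique:
  every isometry is a product of reflections, and the class does not depend on the factorisation.
\<close>

definition real_spinor_norm ::
  "('a::real_vector \<Rightarrow> 'a \<Rightarrow> real) \<Rightarrow> ('a \<Rightarrow> 'a) \<Rightarrow> real set" where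
  "real_spinor_norm b g =
     (THE c. \<exists>vs. (\<forall>v\<in>set vs. b v v \<noteq> 0) \<and>
        g = foldr (\<circ>) (map (reflection b) vs) id \<and>
        c = real_squares #>\<^bsub>real_units\<^esub> (\<Prod>v\<leftarrow>vs. - (b v v / 2)))"

definition orth_plus :: "('a::real_vector \<Rightarrow> 'a \<Rightarrow> real) \<Rightarrow> 'a set \<Rightarrow> ('a \<Rightarrow> 'a) set" where
  "orth_plus b L =
     orth b L \<inter>
     kernel (maps_group (orth_real b)) (real_units Mod real_squares) (real_spinor_norm b)"

definition stable_orth_plus :: "('a::real_vector \<Rightarrow> 'a \<Rightarrow> real) \<Rightarrow> 'a set \<Rightarrow> ('a \<Rightarrow> 'a) set" where
  "stable_orth_plus b L = stable_orth b L \<inter> orth_plus b L"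

definition stable_special_orth_plus ::
  "(real^'n \<Rightarrow> real^'n \<Rightarrow> real) \<Rightarrow> (real^'n) set \<Rightarrow> (real^'n \<Rightarrow> real^'n) set" where
  "stable_special_orth_plus b L = stable_orth_plus b L \<inter> special_orth b L"

section \<open>Abelianisation\<close>

definition abelianisation :: "('g, 'm) monoid_scheme \<Rightarrow> 'g set monoid" where
  "abelianisation G = G Mod derived G (carrier G)"

end

theory Submission
  imports Defs "HOL-Number_Theory.Cong"
begin

text \<open>
  Write \<open>L = U \<oplus> U' \<oplus> L\<^sub>0\<close> with \<open>U = \<langle>e, f\<rangle>\<close>, \<open>U' = \<langle>e', f'\<rangle>\<close>, and let \<open>E\<close> be the group
  generated by the Eichler transvections along \<open>e, f, e', f'\<close>. Eichler's criterion moves a vector of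
  the dual lattice to \<open>x + e\<close> inside the subgroup of \<open>E\<close> that fixes any given vectors of
  \<open>(U \<oplus> U')\<close>-perp; applied successively to the dual basis of \<open>L\<^sub>0\<close> and to \<open>e\<close>, it reduces an isometry
  acting trivially on the discriminant group to one of the four isometries of \<open>U'\<close>. Determinant and
  spinor norm then identify the stable special orthogonal group with \<open>E\<close>, and \<open>E\<close> has index 2 in the
  stable orthogonal group, the other coset being that of the reflection in \<open>e' - f'\<close>.

  A homomorphism from \<open>E\<close> to an abelian group kills the transvections along \<open>c\<close> by \<open>g a - a\<close> for
  \<open>g \<in> E\<close> fixing \<open>c\<close>. Among these are the transvections by \<open>b m n\<close> times \<open>e'\<close>, for \<open>m, n \<in> L\<^sub>0\<close>, and the
  braid relation in \<open>SL\<^sub>2(\<int>)\<close> shows that the transvection by \<open>12 e'\<close> is killed too. The rank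
  conditions provide values of \<open>b\<close> on \<open>L\<^sub>0\<close> prime to 2 and to 3, so all transvections are killed and
  \<open>E\<close> is perfect.
\<close>

section \<open>Isometries and transvections\<close>

text \<open>A vector \<open>x\<close> orthogonal to both planes cannot itself be the target of
  Eichler's criterion: the last transvection needs an isotropic vector on which the moved vector
  takes the value 1. So \<open>x\<close> and its image are both carried to \<open>x + e\<close>, and
  one move is composed with the inverse of the other. The dual basis is fixed, rather than a basis
  of \<open>L\<^sub>0\<close>, because each of its members pairs to 1 with a lattice vector, which
  is what makes Euclid's algorithm end at 1.

  The spinor norm is a definite description over all factorisations, so its independence of the
  factorisation must be proved before it can be evaluated. The elements that occur are explicit
  words in reflections.

  The 12 is the order of the abelianisation of SL_2(Z): the two elementary matrices are conjugate,
  so the fourth power of a word in three of them gives 4 * 3. Its prime factors are 2 and 3, hence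
  rank conditions at these primes: the planes account for rank 4 only, so rank 5 modulo
  \<open>p\<close> forces a value on \<open>L\<^sub>0\<close> prime to \<open>p\<close>.\<close>

definition isometry :: "('a::real_vector \<Rightarrow> 'a \<Rightarrow> real) \<Rightarrow> ('a \<Rightarrow> 'a) \<Rightarrow> bool" where
  "isometry b g \<longleftrightarrow> linear g \<and> (\<forall>x y. b (g x) (g y) = b x y)"

text \<open>For \<open>c\<close> isotropic and orthogonal to \<open>a\<close>, the skew map N x =
  (c,x) a - (a,x) c satisfies N^3 = 0, and this is its exponential 1 + N + N^2 / 2.\<close>

definition transvection ::
  "('a::real_vector \<Rightarrow> 'a \<Rightarrow> real) \<Rightarrow> 'a \<Rightarrow> 'a \<Rightarrow> 'a \<Rightarrow> 'a" where
  "transvection b c a x = x - b a x *\<^sub>R c + b c x *\<^sub>R a - (b a a / 2 * b c x) *\<^sub>R c"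

definition reflection_word :: "('a::real_vector \<Rightarrow> 'a \<Rightarrow> real) \<Rightarrow> 'a list \<Rightarrow> 'a \<Rightarrow> 'a" where
  "reflection_word b vs = foldr (\<circ>) (map (reflection b) vs) id"

lemma isometry_id: "isometry b id"
  by (simp add: isometry_def linear_iff)

lemma isometry_comp: "isometry b g \<Longrightarrow> isometry b h \<Longrightarrow> isometry b (g \<circ> h)"
  by (simp add: isometry_def linear_compose)

lemma reflection_word_simps [simp]:
  "reflection_word b [] = id"
  "reflection_word b (v # vs) = reflection b v \<circ> reflection_word b vs"
  by (simp_all add: reflection_word_def)

lemma reflection_word_append:
  "reflection_word b (vs @ ws) = reflection_word b vs \<circ> reflection_word b ws"
  by (induction vs) (simp_all add: comp_assoc)

locale symmetric_form =
  fixes b :: "'a::real_vector \<Rightarrow> 'a \<Rightarrow> real"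
  assumes bil: "bilinear b" and sym: "\<And>x y. b x y = b y x"
begin

lemma form_simps [simp]:
  "b (x + y) z = b x z + b y z" "b z (x + y) = b z x + b z y"
  "b (x - y) z = b x z - b y z" "b z (x - y) = b z x - b z y"
  "b (r *\<^sub>R x) z = r * b x z" "b z (r *\<^sub>R x) = r * b z x"
  "b (- x) z = - b x z" "b z (- x) = - b z x" "b 0 z = 0" "b z 0 = 0"
  using bil by (simp_all add: bilinear_ladd bilinear_radd bilinear_lsub bilinear_rsub
      bilinear_lmul bilinear_rmul bilinear_lneg bilinear_rneg bilinear_lzero bilinear_rzero)

lemma form_sum:
  "b (sum f A) z = (\<Sum>i\<in>A. b (f i) z)" "b z (sum f A) = (\<Sum>i\<in>A. b z (f i))"
proof -
  have 1: "linear (\<lambda>x. b x z)" "linear (b z)"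
    using bil by (auto simp: bilinear_def)
  show "b (sum f A) z = (\<Sum>i\<in>A. b (f i) z)" "b z (sum f A) = (\<Sum>i\<in>A. b z (f i))"
    using linear_sum[OF 1(1)] linear_sum[OF 1(2)] by auto
qed

lemma linear_reflection: "linear (reflection b v)"
  by (auto simp: linear_iff reflection_def algebra_simps add_divide_distrib)

lemma isometry_reflection:
  assumes "b v v \<noteq> 0"
  shows "isometry b (reflection b v)"
  using assms by (auto simp: isometry_def linear_reflection reflection_def sym field_simps)

lemma reflection_involution:
  assumes "b v v \<noteq> 0"
  shows "reflection b v (reflection b v x) = x"
  using assms by (simp add: reflection_def)

lemma isometry_reflection_word:
  "(\<forall>v\<in>set vs. b v v \<noteq> 0) \<Longrightarrow> isometry b (reflection_word b vs)"
  by (induction vs) (auto simp del: o_apply intro: isometry_comp isometry_reflection isometry_id)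

lemma linear_transvection: "linear (transvection b c a)"
  by (auto simp: linear_iff transvection_def algebra_simps add_divide_distrib)

lemma isometry_transvection:
  assumes "b c c = 0" "b c a = 0"
  shows "isometry b (transvection b c a)"
  using assms assms(2)[unfolded sym[of c]]
  by (auto simp: isometry_def linear_transvection transvection_def sym algebra_simps)

lemma transvection_add:
  assumes "b c c = 0" "b c a = 0" "b c a' = 0"
  shows "transvection b c a (transvection b c a' x) = transvection b c (a + a') x"
  using assms assms(2,3)[unfolded sym[of c]]
  by (simp add: transvection_def sym algebra_simps add_divide_distrib)

lemma transvection_0: "transvection b c 0 = id"
  by (auto simp: transvection_def)

lemma transvection_multiple_self: "b c c = 0 \<Longrightarrow> transvection b c (k *\<^sub>R c) = id"
  by (auto simp: transvection_def)

lemma transvection_neg: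
  assumes "b c c = 0" "b c a = 0"
  shows "transvection b c a \<circ> transvection b c (- a) = id"
  using assms by (auto simp: transvection_add transvection_0)

lemma transvection_conjugate:
  assumes "isometry b g"
  shows "g (transvection b c a x) = transvection b (g c) (g a) (g x)"
proof -
  have g: "linear g" "\<And>x y. b (g x) (g y) = b x y"
    using assms by (auto simp: isometry_def)
  show ?thesis
    by (simp add: transvection_def g(2) linear_add[OF g(1)] linear_diff[OF g(1)] linear_cmul[OF g(1)])
qed

text \<open>The two mirror vectors have equal norm since \<open>c\<close> is isotropic and
  orthogonal to \<open>a\<close>. Hence the determinant is 1 and the two spinor factors multiply to
  a square.\<close>

lemma transvection_eq_reflections:
  assumes "b c c = 0" "b c a = 0" "b a a \<noteq> 0"
  shows "transvection b c a = reflection_word b [a, a + (b a a / 2) *\<^sub>R c]"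
    and "b (a + (b a a / 2) *\<^sub>R c) (a + (b a a / 2) *\<^sub>R c) = b a a"
proof -
  show n: "b (a + (b a a / 2) *\<^sub>R c) (a + (b a a / 2) *\<^sub>R c) = b a a"
    using assms assms(2)[unfolded sym[of c]] by simp
  show "transvection b c a = reflection_word b [a, a + (b a a / 2) *\<^sub>R c]"
  proof
    fix x
    define n where "n = b a a"
    have n0: "n \<noteq> 0" and ac: "b a c = 0" using assms sym by (auto simp: n_def)
    let ?p = "2 * b a x / n + b c x"
    have 1: "reflection b (a + (b a a / 2) *\<^sub>R c) x = x - ?p *\<^sub>R (a + (n / 2) *\<^sub>R c)"
    proof -
      have "2 * b x (a + (b a a / 2) *\<^sub>R c) / b a a = ?p"
        using n0 by (simp add: n_def sym[of x] add_divide_distrib)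
      then show ?thesis unfolding reflection_def n by (simp add: n_def)
    qed
    have 2: "2 * b (x - ?p *\<^sub>R (a + (n / 2) *\<^sub>R c)) a / b a a = - ?p - b c x"
      using n0 ac by (simp add: n_def[symmetric] sym[of x] sym[of c a] field_simps)
    have "reflection_word b [a, a + (b a a / 2) *\<^sub>R c] x
        = x - ?p *\<^sub>R (a + (n / 2) *\<^sub>R c) - (- ?p - b c x) *\<^sub>R a"
      unfolding reflection_word_simps o_def id_def 1 unfolding reflection_def[of b a] 2 ..
    also have "\<dots> = x + b c x *\<^sub>R a - (?p * (n / 2)) *\<^sub>R c"
    proof -
      have "x - p *\<^sub>R (a + m *\<^sub>R c) - (- p - q) *\<^sub>R a = x + q *\<^sub>R a - (p * m) *\<^sub>R c" for p q m
        by (simp add: algebra_simps)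
      then show ?thesis .
    qed
    also have "?p * (n / 2) = b a x + n / 2 * b c x"
      using n0 by (simp add: field_simps)
    also have "x + b c x *\<^sub>R a - (b a x + n / 2 * b c x) *\<^sub>R c = transvection b c a x"
      by (simp add: transvection_def n_def scaleR_add_left)
    finally show "transvection b c a x = reflection_word b [a, a + (b a a / 2) *\<^sub>R c] x" ..
  qed
qed

text \<open>When \<open>a\<close> is isotropic it has to be split as \<open>(a + w) - w\<close> with both parts anisotropic.\<close>

lemma transvection_reflection_word:
  assumes "b c c = 0" "b c a = 0" and w: "b c w = 0" "b w w \<noteq> 0"
  obtains vs where "\<forall>v\<in>set vs. b v v \<noteq> 0" "transvection b c a = reflection_word b vs"
    "even (length vs)" "(\<Prod>v\<leftarrow>vs. - (b v v / 2)) > 0"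
proof (cases "b a a = 0")
  case False
  show ?thesis
    by (rule that[of "[a, a + (b a a / 2) *\<^sub>R c]"])
      (use transvection_eq_reflections[OF assms(1,2) False] False in \<open>auto simp del: form_simps reflection_word_simps simp: zero_less_mult_iff linorder_neq_iff\<close>)
next
  case True
  \<comment> \<open>The norm of \<open>a + r w\<close> is r (2 (a,w) + r (w,w)). If this vanishes
    for r = 1, then for r = 2 it equals 2 (w,w), which is nonzero.\<close>
  define r where "r = (if 2 * b a w + b w w = 0 then 2 else 1::real)"
  define u where "u = r *\<^sub>R w"
  define u' where "u' = a + u"
  have u: "b c u = 0" "b u u \<noteq> 0" and u': "b c u' = 0" "b u' u' \<noteq> 0"
    using assms True by (auto simp: u_def u'_def r_def sym algebra_simps split: if_splits)
  let ?vs = "[u', u' + (b u' u' / 2) *\<^sub>R c]"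
  let ?ws = "[- u, - u + (b u u / 2) *\<^sub>R c]"
  have n: "b c (- u) = 0" "b (- u) (- u) = b u u" "b (- u) (- u) \<noteq> 0" using u by auto
  have "transvection b c a = transvection b c u' \<circ> transvection b c (- u)"
    using assms u u' by (auto simp: transvection_add n u'_def simp del: form_simps)
  also have "\<dots> = reflection_word b (?vs @ ?ws)"
    unfolding transvection_eq_reflections(1)[OF assms(1) u']
      transvection_eq_reflections(1)[OF assms(1) n(1,3)] n(2) reflection_word_append ..
  finally have "transvection b c a = reflection_word b (?vs @ ?ws)" .
  moreover have "(- (b u' u' / 2)) * ((- (b u' u' / 2)) * ((- (b u u / 2)) * (- (b u u / 2)))) > 0"
  proof -
    have "(b u' u' / 2)\<^sup>2 * (b u u / 2)\<^sup>2 > 0" using u u' by simp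
    then show ?thesis by (simp add: power2_eq_square)
  qed
  ultimately show ?thesis
    using u u' transvection_eq_reflections(2)[OF assms(1) u']
      transvection_eq_reflections(2)[OF assms(1) n(1,3)] n
    by (intro that[of "?vs @ ?ws"]) (auto simp del: form_simps reflection_word_simps)
qed

end

section \<open>Determinants of rank-one perturbations\<close>

lemma det_comp:
  fixes f g :: "real^'n \<Rightarrow> real^'n"
  assumes "linear f" "linear g"
  shows "Determinants.det (matrix (f \<circ> g)) = Determinants.det (matrix f) * Determinants.det (matrix g)"
  by (simp add: matrix_compose[OF assms(2,1)] det_mul)

text \<open>Write \<open>\<phi>\<close> as the inner product with a vector \<open>w\<close> and
  rotate \<open>w\<close> onto a coordinate axis: the perturbation then changes a single column of
  the identity matrix.\<close>

lemma det_rank_one_perturbation: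
  fixes \<phi> :: "real^'n \<Rightarrow> real"
  assumes "linear \<phi>"
  shows "Determinants.det (matrix (\<lambda>x. x - \<phi> x *\<^sub>R u)) = 1 - \<phi> u"
proof -
  define w where "w = adjoint \<phi> 1"
  have w: "\<phi> x = inner w x" for x
    using adjoint_works[OF assms, of x 1] by (simp add: w_def inner_commute)
  have f: "linear (\<lambda>x. x - \<phi> x *\<^sub>R u)"
    by (auto simp: linear_iff w inner_add_right algebra_simps)
  fix k :: 'n
  obtain T :: "real^'n \<Rightarrow> real^'n"
    where T: "orthogonal_transformation T" "T w = norm w *\<^sub>R axis k 1"
    using orthogonal_transformation_exists[of w "norm w *\<^sub>R axis k 1"] by auto
  have lT: "linear T" using T(1) by (simp add: orthogonal_transformation_def)
  let ?S = "\<lambda>y. y - (norm w * vec_nth y k) *\<^sub>R T u"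
  have S: "linear ?S"
    by (auto simp: linear_iff algebra_simps)
  have \<phi>T: "\<phi> x = norm w * vec_nth (T x) k" for x
  proof -
    have "\<phi> x = inner (T w) (T x)"
      using T(1) by (simp add: w orthogonal_transformation_def)
    then show ?thesis by (simp add: T(2) inner_axis')
  qed
  have "T \<circ> (\<lambda>x. x - \<phi> x *\<^sub>R u) = ?S \<circ> T"
    by (auto simp: linear_diff[OF lT] linear_cmul[OF lT] \<phi>T)
  then have "Determinants.det (matrix T) * Determinants.det (matrix (\<lambda>x. x - \<phi> x *\<^sub>R u))
      = Determinants.det (matrix ?S) * Determinants.det (matrix T)"
    using det_comp[OF lT f] det_comp[OF S lT] by metis
  moreover have "Determinants.det (matrix T) \<noteq> 0"
    using T(1) det_orthogonal_matrix orthogonal_transformation_matrix by fastforce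
  moreover have "Determinants.det (matrix ?S) = 1 - \<phi> u"
  proof -
    \<comment> \<open>\<open>?z\<close> is the changed column; by Cramer's lemma over the identity
      matrix the determinant is its \<open>k\<close>-th entry.\<close>
    let ?z = "axis k 1 - norm w *\<^sub>R T u"
    have "matrix ?S = (\<chi> i j. if j = k then vec_nth (Finite_Cartesian_Product.mat 1 *v ?z) i else vec_nth (vec_nth (Finite_Cartesian_Product.mat 1) i) j)"
      unfolding matrix_vector_mul_lid
      by (auto simp: Finite_Cartesian_Product.vec_eq_iff matrix_def axis_def Finite_Cartesian_Product.mat_def)
    then show ?thesis
      using cramer_lemma[where A = "Finite_Cartesian_Product.mat 1 :: real^'n^'n" and x = ?z and k = k]
      by (simp add: \<phi>T)
  qed
  ultimately show ?thesis by simp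
qed


section \<open>The real spinor norm\<close>

text \<open>There are only two square classes, told apart by sign, so every statement on spinor
  norms becomes one on signs.\<close>

lemma real_squares_coset:
  assumes "s \<noteq> 0"
  shows "real_squares #>\<^bsub>real_units\<^esub> s = {r. r * s > 0}"
proof -
  have "real_squares #>\<^bsub>real_units\<^esub> s = {t\<^sup>2 * s | t. t \<noteq> 0}"
    by (auto simp: r_coset_def real_squares_def real_units_def)
  also have "\<dots> = {r. r * s > 0}"
  proof (intro equalityI subsetI; clarify)
    fix t :: real
    assume "t \<noteq> 0"
    then have "(t * s)\<^sup>2 > 0" using assms by simp
    also have "(t * s)\<^sup>2 = t\<^sup>2 * s * s" by (simp add: power2_eq_square)
    finally show "t\<^sup>2 * s * s > 0" .
  next
    fix r
    assume "r * s > 0"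
    then have "r / s > 0" by (simp add: zero_less_mult_iff zero_less_divide_iff)
    then have "sqrt (r / s) \<noteq> 0" "(sqrt (r / s))\<^sup>2 = r / s" by auto
    moreover have "r = r / s * s" using assms by simp
    ultimately show "\<exists>t. r = t\<^sup>2 * s \<and> t \<noteq> 0" by metis
  qed
  finally show ?thesis .
qed

lemma sgn_eq_if_mult_neg:
  fixes x y z :: real
  assumes "x * y * z < 0"
  shows "sgn x = - sgn y * sgn z"
proof -
  have "sgn x * sgn y * sgn z = - 1"
    using sgn_neg[OF assms] by (simp only: sgn_mult)
  moreover have "sgn x \<in> {-1, 0, 1}" "sgn y \<in> {-1, 0, 1}" "sgn z \<in> {-1, 0, 1}"
    by (simp_all only: sgn_if insert_iff split: if_split) simp_all
  ultimately show ?thesis by (auto simp del: sgn_zero_iff)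
qed

locale nondegenerate_form = symmetric_form b for b :: "real^'n \<Rightarrow> real^'n \<Rightarrow> real" +
  assumes nondegenerate: "(\<And>y. b x y = 0) \<Longrightarrow> x = 0"
begin

section \<open>Isometries and reflection words of a nondegenerate form\<close>

lemma isometry_inj:
  assumes "isometry b g"
  shows "inj g"
proof -
  have g: "linear g" "\<And>x y. b (g x) (g y) = b x y"
    using assms by (auto simp: isometry_def)
  have "x = 0" if "g x = 0" for x
    using nondegenerate[of x] g(2)[of x] that by simp
  then show ?thesis
    using linear_injective_0[OF g(1)] by auto
qed

lemma orth_real_iff: "g \<in> orth_real b \<longleftrightarrow> isometry b g"
  using isometry_inj linear_injective_imp_surjective
  by (auto simp: orth_real_def isometry_def bij_def)

lemma det_reflection:
  assumes "b v v \<noteq> 0"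
  shows "Determinants.det (matrix (reflection b v)) = - 1"
proof -
  have "linear (\<lambda>x. 2 * b x v / b v v)"
    by (auto simp: linear_iff distrib_left add_divide_distrib)
  from det_rank_one_perturbation[OF this, of v] show ?thesis
    using assms by (simp add: reflection_def[abs_def])
qed

lemma det_reflection_word:
  "\<forall>v\<in>set vs. b v v \<noteq> 0 \<Longrightarrow>
    Determinants.det (matrix (reflection_word b vs)) = (- 1) ^ length vs"
proof (induction vs)
  case (Cons v vs)
  then have "linear (reflection_word b vs)" 
    using isometry_reflection_word by (auto simp: isometry_def)
  with Cons show ?case
    by (simp add: det_comp linear_reflection det_reflection del: o_apply)
qed (simp add: matrix_id)

text \<open>Sylvester's decomposition in terms of projections: take a self-adjoint idempotent with
  positive definite range of the largest possible dimension. Maximality makes the form at most 0 on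
  the kernel, and nondegeneracy then makes it negative definite there.\<close>

lemma positive_projection:
  "\<exists>P. linear P \<and> (\<forall>x. P (P x) = P x) \<and> (\<forall>x. b (P x) (P x) \<ge> 0) \<and>
    (\<forall>x. b (P x) (P x) = 0 \<longrightarrow> P x = 0) \<and> (\<forall>x. P x = 0 \<longrightarrow> b x x \<le> 0) \<and>
    (\<forall>x. P x = 0 \<longrightarrow> b x x = 0 \<longrightarrow> x = 0)"
proof -
  define Q where "Q P \<longleftrightarrow> linear P \<and> (\<forall>x. P (P x) = P x) \<and> (\<forall>x y. b (P x) y = b x (P y)) \<and>
    (\<forall>x. b (P x) (P x) \<ge> 0) \<and> (\<forall>x. b (P x) (P x) = 0 \<longrightarrow> P x = 0)" for P
  have "Q (\<lambda>x. 0)" by (simp add: Q_def linear_iff)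
  moreover have "\<forall>P. Q P \<longrightarrow> dim (range P) < Suc DIM(real^'n)"
    using dim_subset_UNIV less_Suc_eq_le by blast
  ultimately have "\<exists>P. Q P \<and> (\<forall>P'. Q P' \<longrightarrow> dim (range P') \<le> dim (range P))"
    by (rule ex_has_greatest_nat)
  then obtain P where P: "Q P" "\<And>P'. Q P' \<Longrightarrow> dim (range P') \<le> dim (range P)"
    by auto
  have lin: "linear P" and idem: "P (P x) = P x" and adj: "b (P x) y = b x (P y)"
    and pos: "b (P x) (P x) \<ge> 0" "b (P x) (P x) = 0 \<Longrightarrow> P x = 0" for x y
    using P(1) by (auto simp: Q_def)
  note lin_simps = linear_add[OF lin] linear_diff[OF lin] linear_cmul[OF lin] linear_0[OF lin]
  have neg: "b z z \<le> 0" if z: "P z = 0" for z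
  proof (rule ccontr)
    assume "\<not> b z z \<le> 0"
    then have n: "b z z > 0" by simp
    \<comment> \<open>Adding the projection onto the line of \<open>z\<close> keeps all properties
      in \<open>Q\<close>, and the range grows because \<open>z\<close> is in the kernel of
      \<open>P\<close>.\<close>
    define P' where "P' y = P y + (b y z / b z z) *\<^sub>R z" for y
    have Pz: "b (P y) z = 0" "b z (P y) = 0" for y
    proof -
      show "b (P y) z = 0" using adj[of y z] z by simp
      then show "b z (P y) = 0" by (subst sym)
    qed
    have norm: "b (P' y) (P' y) = b (P y) (P y) + (b y z)\<^sup>2 / b z z" for y
      using n by (simp add: P'_def Pz power2_eq_square)
    have "Q P'"
      unfolding Q_def
    proof (intro conjI allI impI)
      show "linear P'"
        by (auto simp: linear_iff P'_def lin_simps algebra_simps add_divide_distrib)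
      show "P' (P' x) = P' x" for x
        using n by (simp add: P'_def lin_simps idem z Pz)
      show "b (P' x) y = b x (P' y)" for x y
        by (simp add: P'_def adj sym[of z y])
      show "b (P' x) (P' x) \<ge> 0" for x
        using n pos(1)[of x] by (simp add: norm)
      show "P' x = 0" if "b (P' x) (P' x) = 0" for x
      proof -
        have "(b x z)\<^sup>2 / b z z \<ge> 0" using n by simp
        with that pos(1)[of x] have "b (P x) (P x) = 0" "(b x z)\<^sup>2 / b z z = 0"
          unfolding norm by linarith+
        then show ?thesis using pos(2)[of x] n by (simp add: P'_def)
      qed
    qed
    moreover have "dim (range P) < dim (range P')"
    proof (rule dim_psubset)
      have "P' (P y) = P y" for y by (simp add: P'_def idem Pz)
      then have "P y \<in> range P'" for y using rangeI[of P' "P y"] by simp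
      then have "range P \<subseteq> range P'" by auto
      moreover have "P' z = z" using n by (simp add: P'_def z)
      then have "z \<in> range P'" using rangeI[of P' z] by simp
      moreover have "z \<notin> range P" using z idem n by (auto simp: image_def)
      moreover have "subspace (range P)" "subspace (range P')"
        using \<open>Q P'\<close> lin by (auto simp: Q_def intro: linear_subspace_image)
      ultimately show "span (range P) \<subset> span (range P')"
        unfolding span_eq_iff[THEN iffD2, OF \<open>subspace (range P)\<close>]
          span_eq_iff[THEN iffD2, OF \<open>subspace (range P')\<close>] by blast
    qed
    ultimately show False using P(2)[of P'] by simp
  qed
  have strict: "x = 0" if x: "P x = 0" "b x x = 0" for x
  proof (rule nondegenerate)
    fix y
    define u where "u = y - P y"
    have u: "P u = 0" by (simp add: u_def lin_simps idem)
    \<comment> \<open>Perturbing the isotropic \<open>x\<close> by (b x u / s) u gives the norm (b x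
      u)^2 (2 s + b u u) / s^2. For this \<open>s\<close> it is positive unless
      \<open>b x u = 0\<close>, whereas \<open>neg\<close> bounds it by 0.\<close>
    obtain s where s: "s > 0" "2 * s + b u u > 0"
      by (rule that[of "1 + \<bar>b u u\<bar>"]) auto
    have xu: "b x y = b x u" using adj[of x y] x by (simp add: u_def)
    have "b (x + (b x u / s) *\<^sub>R u) (x + (b x u / s) *\<^sub>R u) \<le> 0"
      by (rule neg) (simp add: lin_simps x u)
    also have "b (x + (b x u / s) *\<^sub>R u) (x + (b x u / s) *\<^sub>R u)
        = (b x u)\<^sup>2 * (2 * s + b u u) / s\<^sup>2"
      using s(1) by (simp add: x sym[of u x] power2_eq_square field_simps)
    finally have "b x u = 0" using s by (simp add: divide_le_0_iff mult_le_0_iff)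
    then show "b x y = 0" by (simp add: xu)
  qed
  show ?thesis
    using lin idem pos neg strict by (intro exI[of _ P] conjI allI impI)
qed

text \<open>
  The spinor norm is the effect on the orientation of a maximal positive definite subspace: with
  \<open>P\<close> the orthogonal projection onto it, it is the sign of the determinant of \<open>P g + (1 - P)\<close>.
\<close>

lemma sgn_reflection_word_unique:
  assumes "\<forall>v\<in>set vs. b v v \<noteq> 0" "\<forall>v\<in>set ws. b v v \<noteq> 0"
    and "reflection_word b vs = reflection_word b ws"
  shows "sgn (\<Prod>v\<leftarrow>vs. - (b v v / 2)) = sgn (\<Prod>v\<leftarrow>ws. - (b v v / 2))"
proof -
  obtain P where P: "linear P \<and> (\<forall>x. P (P x) = P x) \<and> (\<forall>x. b (P x) (P x) \<ge> 0) \<and>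
    (\<forall>x. b (P x) (P x) = 0 \<longrightarrow> P x = 0) \<and> (\<forall>x. P x = 0 \<longrightarrow> b x x \<le> 0) \<and>
    (\<forall>x. P x = 0 \<longrightarrow> b x x = 0 \<longrightarrow> x = 0)"
    using positive_projection ..
  have lin: "linear P" and idem: "P (P x) = P x"
    and pos: "b (P x) (P x) \<ge> 0" "b (P x) (P x) = 0 \<Longrightarrow> P x = 0"
    and neg: "P x = 0 \<Longrightarrow> b x x \<le> 0" "P x = 0 \<Longrightarrow> b x x = 0 \<Longrightarrow> x = 0" for x
    using P by simp_all
  note lin_simps = linear_add[OF lin] linear_diff[OF lin] linear_cmul[OF lin] linear_0[OF lin]
  define M where "M g x = P (g x) + (x - P x)" for g :: "real^'n \<Rightarrow> real^'n" and x
  have linM: "linear (M g)" if "isometry b g" for g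
    using that by (auto simp: M_def linear_iff lin_simps isometry_def algebra_simps)
  have bijM: "bij (M g)" if g: "isometry b g" for g
  proof -
    \<comment> \<open>A kernel vector \<open>x\<close> lies in the positive space while
      \<open>g x\<close> lies in the negative one; equality of their norms leaves only 0.\<close>
    have "x = 0" if x: "M g x = 0" for x
    proof -
      have "P (M g x) = 0" by (simp add: x lin_simps)
      then have gx: "P (g x) = 0" by (simp add: M_def lin_simps idem)
      with x have Px: "P x = x" by (simp add: M_def)
      have "b (g x) (g x) = b x x" using g by (simp add: isometry_def)
      with neg(1)[OF gx] pos[of x] Px show ?thesis by auto
    qed
    then have "inj (M g)" using linear_injective_0[OF linM[OF g]] by auto
    then show ?thesis using linear_injective_imp_surjective[OF linM[OF g]] by (auto simp: bij_def)
  qed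
  have step: "Determinants.det (matrix (M (g \<circ> reflection b v))) * b v v * Determinants.det (matrix (M g)) < 0"
    if g: "isometry b g" and v: "b v v \<noteq> 0" for g v
  proof -
    have lg: "linear g" using g by (simp add: isometry_def)
    \<comment> \<open>With this \<open>w\<close>, composing \<open>g\<close> with the reflection in
      \<open>v\<close> changes \<open>M g\<close> by a rank-one perturbation in direction
      \<open>w\<close>, so the determinant gains the factor 1 - 2 b w v / b v v. Moreover
      \<open>w\<close> is in the positive space and \<open>g (w - v)\<close> in the negative
      one.\<close>
    obtain w where w: "M g w = P (g v)"
      using bijM[OF g] by (metis bij_pointE)
    have "P (M g w) = P (g v)" by (simp add: w idem)
    then have gw: "P (g w) = P (g v)" by (simp add: M_def lin_simps idem)
    with w have Pw: "P w = w" by (simp add: M_def)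
    have "P (g (w - v)) = 0" using gw by (simp add: linear_diff[OF lg] lin_simps)
    then have n: "b (g (w - v)) (g (w - v)) = b (w - v) (w - v)"
      using g by (simp only: isometry_def)
    have 1: "b (w - v) (w - v) \<le> 0" "w = v" if "b (w - v) (w - v) \<ge> 0"
    proof -
      show "b (w - v) (w - v) \<le> 0" using neg(1) \<open>P (g (w - v)) = 0\<close> n by metis
      with that have "g (w - v) = 0" using neg(2) \<open>P (g (w - v)) = 0\<close> n by simp
      then show "w = v" using injD[OF isometry_inj[OF g], of "w - v" 0] linear_0[OF lg] by simp
    qed
    have 2: "b w w \<ge> 0" "b w w = 0 \<Longrightarrow> w = 0"
      using pos[of w] Pw by auto
    \<comment> \<open>The right-hand side is a norm that is at most 0 minus one that is at least 0.
      It vanishes only for \<open>w = v\<close> and \<open>w = 0\<close>, that is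
      \<open>v = 0\<close>; hence the sign changes by exactly - sgn (b v v).\<close>
    have eq: "b v v - 2 * b w v = b (w - v) (w - v) - b w w"
      by (simp add: sym)
    have lt: "b v v - 2 * b w v < 0"
    proof (rule ccontr)
      assume "\<not> ?thesis"
      then have ge: "b (w - v) (w - v) \<ge> b w w" using eq by linarith
      then have "b (w - v) (w - v) \<ge> 0" using 2(1) by linarith
      from 1[OF this] ge 2 have "v = 0" by fastforce
      then show False using v by simp
    qed
    have lin\<phi>: "linear (\<lambda>x. 2 * b x v / b v v)"
      by (auto simp: linear_iff distrib_left add_divide_distrib)
    have lin': "linear (\<lambda>x. x - (2 * b x v / b v v) *\<^sub>R w)"
      by (auto simp: linear_iff algebra_simps add_divide_distrib)
    have "M (g \<circ> reflection b v) = M g \<circ> (\<lambda>x. x - (2 * b x v / b v v) *\<^sub>R w)"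
    proof
      fix x
      have "M (g \<circ> reflection b v) x = M g x - (2 * b x v / b v v) *\<^sub>R M g w"
        unfolding w by (simp add: M_def reflection_def lin_simps linear_diff[OF lg] linear_cmul[OF lg])
      then show "M (g \<circ> reflection b v) x = (M g \<circ> (\<lambda>x. x - (2 * b x v / b v v) *\<^sub>R w)) x"
        by (simp only: o_apply linear_diff[OF linM[OF g]] linear_cmul[OF linM[OF g]])
    qed
    then have "Determinants.det (matrix (M (g \<circ> reflection b v)))
        = Determinants.det (matrix (M g)) * (1 - 2 * b w v / b v v)"
      using det_comp[OF linM[OF g] lin'] det_rank_one_perturbation[OF lin\<phi>] by simp
    then have "Determinants.det (matrix (M (g \<circ> reflection b v))) * b v v
        = Determinants.det (matrix (M g)) * (b v v - 2 * b w v)"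
      using v by (simp add: field_simps)
    then have "Determinants.det (matrix (M (g \<circ> reflection b v))) * b v v * Determinants.det (matrix (M g))
        = (Determinants.det (matrix (M g)))\<^sup>2 * (b v v - 2 * b w v)"
      by (simp only: power2_eq_square mult_ac)
    moreover have "Determinants.det (matrix (M g)) \<noteq> 0"
      using bijM[OF g] linM[OF g] det_nz_iff_inj bij_is_inj by blast
    ultimately show ?thesis using lt by (simp add: mult_less_0_iff)
  qed
  define s where "s g = sgn (Determinants.det (matrix (M g)))" for g
  have "s (reflection_word b vs) = sgn (\<Prod>v\<leftarrow>vs. - (b v v / 2))" if "\<forall>v\<in>set vs. b v v \<noteq> 0" for vs
    using that
  proof (induction vs rule: rev_induct)
    case Nil
    have "M id = id" by (auto simp: M_def)
    then show ?case by (simp only: s_def matrix_id reflection_word_simps) simp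
  next
    case (snoc v vs)
    have "s (reflection_word b vs \<circ> reflection b v) = - sgn (b v v) * s (reflection_word b vs)"
    proof -
      have "isometry b (reflection_word b vs)" "b v v \<noteq> 0"
        using snoc.prems isometry_reflection_word[of vs] by auto
      from sgn_eq_if_mult_neg[OF step[OF this]] show ?thesis unfolding s_def .
    qed
    also have "s (reflection_word b vs) = sgn (\<Prod>v\<leftarrow>vs. - (b v v / 2))"
      using snoc.prems by (intro snoc.IH) simp
    finally show ?case
      by (simp only: reflection_word_append reflection_word_simps comp_id map_append prod_list.append
          list.map prod_list.Cons prod_list.Nil mult_1_right sgn_mult sgn_minus sgn_divide) simp
  qed
  from this[OF assms(1)] this[OF assms(2)] show ?thesis using assms(3) by simp
qed

lemma prod_list_norm_nonzero:
  "\<forall>v\<in>set vs. b v v \<noteq> 0 \<Longrightarrow> (\<Prod>v\<leftarrow>vs. - (b v v / 2)) \<noteq> 0"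
  by (induction vs) auto

lemma real_spinor_norm_reflection_word:
  assumes "\<forall>v\<in>set vs. b v v \<noteq> 0"
  shows "real_spinor_norm b (reflection_word b vs)
    = real_squares #>\<^bsub>real_units\<^esub> (\<Prod>v\<leftarrow>vs. - (b v v / 2))"
  unfolding real_spinor_norm_def reflection_word_def[symmetric]
proof (rule the_equality, intro exI conjI)
  fix c
  assume "\<exists>ws. (\<forall>v\<in>set ws. b v v \<noteq> 0) \<and> reflection_word b vs = reflection_word b ws \<and>
    c = real_squares #>\<^bsub>real_units\<^esub> (\<Prod>v\<leftarrow>ws. - (b v v / 2))"
  then obtain ws where ws: "\<forall>v\<in>set ws. b v v \<noteq> 0" "reflection_word b vs = reflection_word b ws"
    "c = real_squares #>\<^bsub>real_units\<^esub> (\<Prod>v\<leftarrow>ws. - (b v v / 2))"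
    by blast
  note sg = sgn_reflection_word_unique[OF assms ws(1,2)]
  have "0 < r * (\<Prod>v\<leftarrow>vs. - (b v v / 2)) \<longleftrightarrow> 0 < r * (\<Prod>v\<leftarrow>ws. - (b v v / 2))" for r
    by (simp only: sgn_1_pos[symmetric] sgn_mult sg)
  then show "c = real_squares #>\<^bsub>real_units\<^esub> (\<Prod>v\<leftarrow>vs. - (b v v / 2))"
    unfolding ws(3) real_squares_coset[OF prod_list_norm_nonzero[OF assms]]
      real_squares_coset[OF prod_list_norm_nonzero[OF ws(1)]] by simp
qed (rule assms refl)+

text \<open>This is the form in which the spinor norm is applied: each isometry comes with a word,
  and only the sign of the product over that word is tested.\<close>

lemma reflection_word_in_orth_plus_iff:
  assumes "\<forall>v\<in>set vs. b v v \<noteq> 0"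
  shows "reflection_word b vs \<in> orth_plus b L \<longleftrightarrow>
    reflection_word b vs \<in> orth b L \<and> (\<Prod>v\<leftarrow>vs. - (b v v / 2)) > 0"
proof -
  let ?p = "\<Prod>v\<leftarrow>vs. - (b v v / 2)"
  have "real_squares = real_squares #>\<^bsub>real_units\<^esub> 1"
    by (auto simp: r_coset_def real_units_def)
  also have "\<dots> = {r. r > 0}"
    by (subst real_squares_coset) auto
  finally have 1: "real_squares = {r. r > 0}" .
  have "{r. r * ?p > 0} = {r. r > 0} \<longleftrightarrow> ?p > 0"
  proof
    assume "{r. r * ?p > 0} = {r. r > 0}"
    then have "1 \<in> {r. r * ?p > 0}" by simp
    then show "?p > 0" by simp
  qed (auto simp: zero_less_mult_iff)
  moreover have "real_spinor_norm b (reflection_word b vs) = {r. r * ?p > 0}"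
    using real_spinor_norm_reflection_word[OF assms] real_squares_coset[OF prod_list_norm_nonzero[OF assms]]
    by (rule trans)
  moreover have "\<one>\<^bsub>real_units Mod real_squares\<^esub> = {r. r > 0}"
    by (simp add: FactGroup_def 1)
  ultimately show ?thesis
    using isometry_reflection_word[OF assms]
    by (simp add: orth_plus_def kernel_def maps_group_def orth_real_iff)
qed

end

section \<open>Integral lattices\<close>

lemma zspanI: "(\<Sum>v\<in>B. of_int (c v) *\<^sub>R v) \<in> zspan B"
  by (auto simp: zspan_def)

lemma zspanE:
  assumes "x \<in> zspan B"
  obtains c :: "'a::real_vector \<Rightarrow> int" where "x = (\<Sum>v\<in>B. of_int (c v) *\<^sub>R v)"
  using assms by (auto simp: zspan_def)

lemma zspan_superset: "finite B \<Longrightarrow> v \<in> B \<Longrightarrow> v \<in> zspan B"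
proof -
  assume B: "finite B" "v \<in> B"
  have "v = (\<Sum>u\<in>B. of_int (if u = v then 1 else 0) *\<^sub>R u)"
    using B by (simp add: if_distrib[of "\<lambda>i. of_int i *\<^sub>R _"] if_distrib[of "\<lambda>r. r *\<^sub>R _"] cong: if_cong)
  then show "v \<in> zspan B" using zspanI[of "\<lambda>u. if u = v then 1 else 0" B] by simp
qed

lemma zspan_diff: "x \<in> zspan B \<Longrightarrow> y \<in> zspan B \<Longrightarrow> x - y \<in> zspan B"
proof -
  assume "x \<in> zspan B" "y \<in> zspan B"
  then obtain c d where "x = (\<Sum>v\<in>B. of_int (c v) *\<^sub>R v)" "y = (\<Sum>v\<in>B. of_int (d v) *\<^sub>R v)"
    by (elim zspanE)
  then have "x - y = (\<Sum>v\<in>B. of_int (c v - d v) *\<^sub>R v)"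
    by (simp add: sum_subtractf[symmetric] scaleR_diff_left)
  then show "x - y \<in> zspan B" using zspanI[of "\<lambda>v. c v - d v" B] by simp
qed

lemma zspan_subset_span: "zspan B \<subseteq> span B"
  by (auto simp: zspan_def intro: span_sum span_scale span_base)

lemma int_scale_closed:
  fixes A :: "'a::real_vector set"
  assumes "0 \<in> A" "\<And>x y. x \<in> A \<Longrightarrow> y \<in> A \<Longrightarrow> x - y \<in> A" "x \<in> A"
  shows "of_int k *\<^sub>R x \<in> A"
proof -
  have minus: "- y \<in> A" if "y \<in> A" for y using assms(2)[OF assms(1) that] by simp
  have nat: "real n *\<^sub>R x \<in> A" for n
  proof (induction n)
    case (Suc n)
    have "real n *\<^sub>R x - - x \<in> A" by (rule assms(2)[OF Suc minus[OF assms(3)]])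
    then show ?case by (simp add: scaleR_add_left add.commute)
  qed (simp add: assms(1))
  show ?thesis
  proof (cases "k \<ge> 0")
    case True
    then show ?thesis using nat[of "nat k"] by simp
  next
    case False
    then show ?thesis using minus[OF nat[of "nat (- k)"]] by simp
  qed
qed

context symmetric_form
begin

text \<open>The dual basis cleared of its denominators, so that it stays in the lattice. Dividing by
  \<open>N\<close> will give \<open>\<xi>\<close>; unscaled it also reads off real
  coordinates.\<close>

lemma integral_lattice_scaled_dual_basis:
  assumes L: "integral_lattice b L" and ws: "lattice_basis ws L"
  shows "\<exists>N::int. N \<noteq> 0 \<and>
    (\<forall>w\<in>set ws. \<exists>d\<in>L. \<forall>w'\<in>set ws. b d w' = (if w' = w then of_int N else 0))"
proof -
  define n where "n = length ws"
  have dist: "distinct ws" and ind: "independent (set ws)" and L_eq: "L = zspan (set ws)"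
    using ws by (auto simp: lattice_basis_def)
  have ws_L: "w \<in> L" if "w \<in> set ws" for w
    unfolding L_eq using that by (simp add: zspan_superset)
  define pos where "pos = inv_into {..<n} ((!) ws)"
  have bij: "bij_betw ((!) ws) {..<n} (set ws)"
    using dist by (simp add: bij_betw_nth n_def)
  have pos: "pos (ws ! i) = i" if "i < n" for i
    using that bij by (simp add: pos_def bij_betw_def)
  have pos_lt: "pos w < n" "ws ! pos w = w" if "w \<in> set ws" for w
    using that bij f_inv_into_f[of w "(!) ws" "{..<n}"] inv_into_into[of w "(!) ws" "{..<n}"]
    by (auto simp: pos_def bij_betw_def)
  have sum_ws: "(\<Sum>v\<in>set ws. f v) = (\<Sum>i<n. f (ws ! i))" for f :: "'a \<Rightarrow> 'a"
    by (rule sum.reindex_bij_betw[OF bij, symmetric])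
  have comb: "(\<Sum>i<n. of_int (c i) *\<^sub>R ws ! i) \<in> L" for c :: "nat \<Rightarrow> int"
  proof -
    have "(\<Sum>i<n. of_int (c i) *\<^sub>R ws ! i) = (\<Sum>v\<in>set ws. of_int (c (pos v)) *\<^sub>R v)"
      unfolding sum_ws by (simp add: pos)
    then show ?thesis unfolding L_eq using zspanI[of "\<lambda>v. c (pos v)"] by simp
  qed
  define A where "A = Matrix.mat n n (\<lambda>(i, j). \<lfloor>b (ws ! i) (ws ! j)\<rfloor>)"
  have A: "A \<in> carrier_mat n n" by (simp add: A_def)
  have A_entry: "of_int (A $$ (i, j)) = b (ws ! i) (ws ! j)" if "i < n" "j < n" for i j
  proof -
    have "b (ws ! i) (ws ! j) \<in> \<int>"
      using L ws_L that by (auto simp: integral_lattice_def n_def)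
    then show ?thesis using that by (auto simp: A_def elim: Ints_cases)
  qed
  have pair: "b (\<Sum>i<n. of_int (c i) *\<^sub>R ws ! i) (ws ! j) = of_int (\<Sum>i<n. c i * A $$ (i, j))"
    if "j < n" for c j
    using that by (simp add: form_sum A_entry)
  have A_sym: "A $$ (i, j) = A $$ (j, i)" if "i < n" "j < n" for i j
    using that sym by (simp add: A_def)
  \<comment> \<open>A singular integer matrix kills a nonzero integral vector, and the combination
    of \<open>ws\<close> with these coefficients would be a nonzero lattice vector orthogonal to
    \<open>L\<close>.\<close>
  have det: "Determinant.det A \<noteq> 0"
  proof
    assume "Determinant.det A = 0"
    then obtain v where v: "v \<in> carrier_vec n" "v \<noteq> 0\<^sub>v n" "A *\<^sub>v v = 0\<^sub>v n"
      using det_0_iff_vec_prod_zero[OF A] by auto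
    define x where "x = (\<Sum>i<n. of_int (vec_index v i) *\<^sub>R ws ! i)"
    have xL: "x \<in> L" unfolding x_def by (rule comb)
    have x_ws: "b x (ws ! j) = 0" if j: "j < n" for j
    proof -
      have "(\<Sum>i<n. vec_index v i * A $$ (i, j)) = vec_index (A *\<^sub>v v) j"
        using j A v(1) by (auto simp: scalar_prod_def lessThan_atLeast0 A_sym intro!: sum.cong)
      then show ?thesis
        unfolding x_def pair[OF j] using v(3) j by simp
    qed
    have "b x y = 0" if "y \<in> L" for y
    proof -
      obtain c :: "'a \<Rightarrow> int" where "y = (\<Sum>v\<in>set ws. of_int (c v) *\<^sub>R v)"
        using \<open>y \<in> L\<close> unfolding L_eq by (rule zspanE)
      then show ?thesis unfolding sum_ws by (simp add: form_sum x_ws)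
    qed
    then have "x = 0" using L xL by (auto simp: integral_lattice_def)
    then have "(\<Sum>w\<in>set ws. of_int (vec_index v (pos w)) *\<^sub>R w) = 0"
      unfolding sum_ws by (simp add: x_def pos)
    then have "vec_index v (pos w) = 0" if "w \<in> set ws" for w
      using independentD[OF ind finite_set subset_refl, of "\<lambda>w. of_int (vec_index v (pos w))"] that by simp
    then have "vec_index v i = 0" if "i < n" for i
      using that pos[of i] by (metis n_def nth_mem)
    then have "v = 0\<^sub>v n" using v(1) by (intro eq_vecI) auto
    then show False using v(2) by simp
  qed
  \<comment> \<open>The coordinates are a row of the adjugate of the Gram matrix, which is the
    inverse multiplied by the determinant and hence integral.\<close>
  define d where "d w = (\<Sum>j<n. of_int (adj_mat A $$ (pos w, j)) *\<^sub>R ws ! j)" for w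
  show ?thesis
  proof (intro exI[of _ "Determinant.det A"] conjI ballI bexI[of _ "d _"])
    show "Determinant.det A \<noteq> 0" by (rule det)
    show "d w \<in> L" if "w \<in> set ws" for w
      unfolding d_def by (rule comb)
    show "b (d w) w' = (if w' = w then of_int (Determinant.det A) else 0)"
      if w: "w \<in> set ws" "w' \<in> set ws" for w w'
    proof -
      have "(\<Sum>j<n. adj_mat A $$ (pos w, j) * A $$ (j, pos w')) = (adj_mat A * A) $$ (pos w, pos w')"
        using A adj_mat(1)[OF A] pos_lt(1)[OF w(1)] pos_lt(1)[OF w(2)]
        by (auto simp: scalar_prod_def lessThan_atLeast0 intro!: sum.cong)
      also have "\<dots> = (if w' = w then Determinant.det A else 0)"
        unfolding adj_mat(3)[OF A]
        using pos_lt(1)[OF w(1)] pos_lt(1)[OF w(2)] pos_lt(2)[OF w(1)] pos_lt(2)[OF w(2)] by auto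
      finally show ?thesis
        unfolding d_def using pair[OF pos_lt(1)[OF w(2)], of "\<lambda>j. adj_mat A $$ (pos w, j)"] pos_lt(2)[OF w(2)]
        by (simp del: of_int_sum of_int_mult)
    qed
  qed
qed

text \<open>Nondegeneracy is assumed for lattice vectors only. It passes to real \<open>x\<close>
  because pairing with the scaled dual basis returns \<open>N\<close> times each coordinate of
  \<open>x\<close>.\<close>

lemma integral_lattice_perp_eq_0:
  assumes L: "integral_lattice b L" and span: "span L = UNIV" and x: "\<And>y. y \<in> L \<Longrightarrow> b x y = 0"
  shows "x = 0"
proof -
  obtain ws where ws: "lattice_basis ws L" using L by (auto simp: integral_lattice_def)
  obtain N :: int where N: "N \<noteq> 0"
    and dual: "\<And>w. w \<in> set ws \<Longrightarrow>
      \<exists>d\<in>L. \<forall>w'\<in>set ws. b d w' = (if w' = w then of_int N else 0)"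
    using integral_lattice_scaled_dual_basis[OF L ws] by blast
  have "L \<subseteq> span (set ws)" using ws zspan_subset_span by (auto simp: lattice_basis_def)
  then have "span (set ws) = UNIV" using span span_minimal[OF _ subspace_span] by blast
  then obtain c where c: "x = (\<Sum>w\<in>set ws. c w *\<^sub>R w)"
    using span_finite[of "set ws"] by auto
  have "c w = 0" if w: "w \<in> set ws" for w
  proof -
    obtain d where d: "d \<in> L" "\<forall>w'\<in>set ws. b d w' = (if w' = w then of_int N else 0)"
      using dual[OF w] by blast
    have "b x d = (\<Sum>w'\<in>set ws. c w' * b d w')"
      unfolding c form_sum by (simp add: sym)
    also have "\<dots> = c w * of_int N"
      using w by (simp add: d(2) if_distrib[of "\<lambda>r. _ * r"] cong: if_cong)
    finally show ?thesis using x[OF d(1)] N by simp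
  qed
  then show ?thesis unfolding c by simp
qed

end

section \<open>Groups generated by transvections\<close>

text \<open>\<open>C\<close> holds the admissible isotropic directions. \<open>X\<close> is the set
  to be kept fixed: if \<open>C\<close> is orthogonal to \<open>X\<close>, the condition on
  \<open>a\<close> makes every element fix \<open>X\<close> pointwise. Since \<open>- a\<close> is
  admissible along with \<open>a\<close>, inverses stay inside for isotropic directions.\<close>

inductive_set transvection_group ::
  "('a::real_vector \<Rightarrow> 'a \<Rightarrow> real) \<Rightarrow> 'a set \<Rightarrow> 'a set \<Rightarrow> 'a set \<Rightarrow> ('a \<Rightarrow> 'a) set"
  for b L C X where
  id: "id \<in> transvection_group b L C X"
| step: "g \<in> transvection_group b L C X \<Longrightarrow> c \<in> C \<Longrightarrow> a \<in> L \<Longrightarrow> b c a = 0 \<Longrightarrow>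
    \<forall>x\<in>X. b a x = 0 \<Longrightarrow> transvection b c a \<circ> g \<in> transvection_group b L C X"

text \<open>Triviality on the discriminant group, stated on representatives instead of
  cosets.\<close>

definition stable_isometries :: "('a::real_vector \<Rightarrow> 'a \<Rightarrow> real) \<Rightarrow> 'a set \<Rightarrow> ('a \<Rightarrow> 'a) set" where
  "stable_isometries b L =
     {g. isometry b g \<and> g ` L = L \<and> (\<forall>v\<in>dual_lattice b L. g v - v \<in> L)}"

lemma transvection_group_comp:
  assumes "g \<in> transvection_group b L C X" "h \<in> transvection_group b L C X"
  shows "g \<circ> h \<in> transvection_group b L C X"
  using assms(1)
proof induction
  case (step g c a)
  then show ?case unfolding comp_assoc by (intro transvection_group.step)
qed (simp add: assms(2))

lemma transvection_in_group:
  assumes "c \<in> C" "a \<in> L" "b c a = 0" "\<forall>x\<in>X. b a x = 0"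
  shows "transvection b c a \<in> transvection_group b L C X"
  using transvection_group.step[OF transvection_group.id assms] by simp

lemma transvection_group_mono:
  assumes "X \<subseteq> Y"
  shows "transvection_group b L C Y \<subseteq> transvection_group b L C X"
proof
  fix g assume "g \<in> transvection_group b L C Y"
  then show "g \<in> transvection_group b L C X"
  proof induction
    case (step g c a)
    then show ?case using assms by (intro transvection_group.step) auto
  qed (rule transvection_group.id)
qed

text \<open>\<open>\<xi>\<close> is the basis dual to \<open>B\<^sub>0\<close>, inside the dual
  lattice and orthogonal to both planes. The basis vector \<open>l\<close> is the lattice vector
  that pairs to 1 with \<open>\<xi> l\<close>, as the orbit argument requires.\<close>

locale two_hyperbolic_pairs = nondegenerate_form b for b :: "real^'n \<Rightarrow> real^'n \<Rightarrow> real" +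
  fixes L L\<^sub>0 B\<^sub>0 :: "(real^'n) set" and \<xi> :: "real^'n \<Rightarrow> real^'n" and e f e' f' :: "real^'n"
  assumes pairs: "b e e = 0" "b f f = 0" "b e f = 1" "b e' e' = 0" "b f' f' = 0" "b e' f' = 1"
      "b e e' = 0" "b e f' = 0" "b f e' = 0" "b f f' = 0"
    and pairs_L0: "z \<in> L\<^sub>0 \<Longrightarrow> b e z = 0" "z \<in> L\<^sub>0 \<Longrightarrow> b f z = 0" "z \<in> L\<^sub>0 \<Longrightarrow> b e' z = 0" "z \<in> L\<^sub>0 \<Longrightarrow> b f' z = 0"
    and L_eq: "L = {of_int i *\<^sub>R e + of_int j *\<^sub>R f + of_int k *\<^sub>R e' + of_int l *\<^sub>R f' + z | i j k l z. z \<in> L\<^sub>0}"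
    and L_integral: "x \<in> L \<Longrightarrow> y \<in> L \<Longrightarrow> b x y \<in> \<int>"
    and L_even: "x \<in> L \<Longrightarrow> b x x / 2 \<in> \<int>"
    and L_perp: "(\<And>y. y \<in> L \<Longrightarrow> b x y = 0) \<Longrightarrow> x = 0"
    and B0: "finite B\<^sub>0" "L\<^sub>0 = zspan B\<^sub>0"
    and \<xi>_dual: "l \<in> B\<^sub>0 \<Longrightarrow> \<xi> l \<in> dual_lattice b L"
    and \<xi>_pairs: "l \<in> B\<^sub>0 \<Longrightarrow> b e (\<xi> l) = 0" "l \<in> B\<^sub>0 \<Longrightarrow> b f (\<xi> l) = 0" "l \<in> B\<^sub>0 \<Longrightarrow> b e' (\<xi> l) = 0" "l \<in> B\<^sub>0 \<Longrightarrow> b f' (\<xi> l) = 0"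
    and \<xi>: "l \<in> B\<^sub>0 \<Longrightarrow> l' \<in> B\<^sub>0 \<Longrightarrow> b (\<xi> l) l' = (if l' = l then 1 else 0)"
begin

abbreviation C :: "(real^'n) set" where "C \<equiv> {e, f, e', f'}"
abbreviation E :: "(real^'n) set \<Rightarrow> (real^'n \<Rightarrow> real^'n) set" where "E X \<equiv> transvection_group b L C X"

section \<open>The lattice in coordinates and the elements of its transvection group\<close>

lemma pairs_sym: "b f e = 1" "b f' e' = 1" "b e' e = 0" "b f' e = 0" "b e' f = 0" "b f' f = 0"
  using pairs by (simp_all add: sym)

lemma L0_diff: "x \<in> L\<^sub>0 \<Longrightarrow> y \<in> L\<^sub>0 \<Longrightarrow> x - y \<in> L\<^sub>0"
  using zspan_diff by (simp add: B0)

lemma L0_0: "0 \<in> L\<^sub>0"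
  by (auto simp: B0(2) zspan_def intro!: exI[of _ "\<lambda>_. 0"])

lemma L_memI:
  "z \<in> L\<^sub>0 \<Longrightarrow> of_int i *\<^sub>R e + of_int j *\<^sub>R f + of_int k *\<^sub>R e' + of_int l *\<^sub>R f' + z \<in> L"
  unfolding L_eq by blast

lemma L_diff: "x \<in> L \<Longrightarrow> y \<in> L \<Longrightarrow> x - y \<in> L"
proof -
  assume "x \<in> L" "y \<in> L"
  then obtain i j k l z i' j' k' l' z' where
    x: "x = of_int i *\<^sub>R e + of_int j *\<^sub>R f + of_int k *\<^sub>R e' + of_int l *\<^sub>R f' + z" "z \<in> L\<^sub>0" and
    y: "y = of_int i' *\<^sub>R e + of_int j' *\<^sub>R f + of_int k' *\<^sub>R e' + of_int l' *\<^sub>R f' + z'" "z' \<in> L\<^sub>0"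
    unfolding L_eq by blast
  have "x - y = of_int (i - i') *\<^sub>R e + of_int (j - j') *\<^sub>R f + of_int (k - k') *\<^sub>R e' + of_int (l - l') *\<^sub>R f' + (z - z')"
    unfolding x y by (simp add: algebra_simps)
  show "x - y \<in> L" unfolding \<open>x - y = _\<close> by (rule L_memI[OF L0_diff[OF x(2) y(2)]])
qed

lemma L0_L: "z \<in> L\<^sub>0 \<Longrightarrow> z \<in> L"
  using L_memI[of z 0 0 0 0] by simp

lemma L_0: "0 \<in> L"
  by (rule L0_L[OF L0_0])

lemma L_minus: "x \<in> L \<Longrightarrow> - x \<in> L"
  using L_diff[OF L_0] by simp

lemma L_add: "x \<in> L \<Longrightarrow> y \<in> L \<Longrightarrow> x + y \<in> L"
  using L_diff[of x "- y"] L_minus[of y] by simp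

lemma L_scale: "k \<in> \<int> \<Longrightarrow> x \<in> L \<Longrightarrow> k *\<^sub>R x \<in> L"
  using int_scale_closed[OF L_0 L_diff] by (auto elim!: Ints_cases)

lemma C_L: "c \<in> C \<Longrightarrow> c \<in> L"
  using L_memI[OF L0_0, of 1 0 0 0] L_memI[OF L0_0, of 0 1 0 0] L_memI[OF L0_0, of 0 0 1 0]
    L_memI[OF L0_0, of 0 0 0 1] by auto

lemma C_isotropic: "c \<in> C \<Longrightarrow> b c c = 0"
  using pairs by auto

text \<open>The hyperbolic plane not containing \<open>c\<close> supplies the auxiliary vector by
  which a transvection with isotropic \<open>a\<close> is split into reflections.\<close>

lemma C_perp_anisotropic:
  assumes "c \<in> C"
  obtains w where "b c w = 0" "b w w \<noteq> 0"
proof (cases "c \<in> {e, f}")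
  case True
  then show ?thesis using pairs pairs_sym by (intro that[of "e' + f'"]) auto
next
  case False
  then show ?thesis using assms pairs pairs_sym by (intro that[of "e + f"]) auto
qed

text \<open>Evenness enters here: the coefficient \<open>b a a / 2\<close> is integral, so even on a
  dual vector the displacement is an integral combination of \<open>a\<close> and
  \<open>c\<close>.\<close>

lemma transvection_stable:
  assumes "c \<in> L" "b c c = 0" "a \<in> L" "b c a = 0"
  shows "transvection b c a \<in> stable_isometries b L"
proof -
  have maps: "transvection b c a v \<in> L" if "a \<in> L" "b c a = 0" "v \<in> L" for a v
    unfolding transvection_def
    using that assms L_integral[of a v] L_integral[of c v] L_even[of a]
    by (intro L_diff L_add L_scale Ints_mult)
  have "v \<in> transvection b c a ` L" if "v \<in> L" for v
  proof
    show "v = transvection b c a (transvection b c (- a) v)"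
      using transvection_neg[OF assms(2,4)] by (metis comp_apply id_apply)
    show "transvection b c (- a) v \<in> L" using assms that by (intro maps) (auto intro: L_minus)
  qed
  then have im: "transvection b c a ` L = L" using maps assms by auto
  have "transvection b c a v - v \<in> L" if "v \<in> dual_lattice b L" for v
  proof -
    have "b v l \<in> \<int>" if "l \<in> L" for l
      using that \<open>v \<in> _\<close> by (auto simp: dual_lattice_def)
    then have i: "b a v \<in> \<int>" "b c v \<in> \<int>" using assms sym by metis+
    have "transvection b c a v - v = b c v *\<^sub>R a - (b a v + b a a / 2 * b c v) *\<^sub>R c"
      by (simp add: transvection_def algebra_simps)
    also have "\<dots> \<in> L" using i L_even[of a] assms by (intro L_diff L_scale Ints_add Ints_mult)
    finally show ?thesis .
  qed
  then show ?thesis using isometry_transvection assms im by (auto simp: stable_isometries_def)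
qed

lemma stable_comp:
  assumes "g \<in> stable_isometries b L" "h \<in> stable_isometries b L"
  shows "g \<circ> h \<in> stable_isometries b L"
proof -
  have "(g \<circ> h) v - v \<in> L" if v: "v \<in> dual_lattice b L" for v
  proof -
    have "g v - v \<in> L" "h v - v \<in> L" using assms v by (auto simp: stable_isometries_def)
    moreover have "g (h v - v) \<in> L" using assms(1) calculation(2) by (auto simp: stable_isometries_def)
    moreover have "(g \<circ> h) v - v = g (h v - v) + (g v - v)"
      using assms(1) by (simp add: stable_isometries_def isometry_def linear_diff)
    ultimately show ?thesis using L_add by metis
  qed
  then show ?thesis
    using assms by (auto simp: stable_isometries_def image_comp[symmetric] intro: isometry_comp simp del: o_apply)
qed

lemma stable_id: "id \<in> stable_isometries b L"
  by (auto simp: stable_isometries_def isometry_id L_0)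

lemma E_stable: "g \<in> E X \<Longrightarrow> g \<in> stable_isometries b L"
proof (induction rule: transvection_group.induct)
  case (step g c a)
  then show ?case
    using stable_comp[OF transvection_stable[OF C_L C_isotropic]] by metis
qed (rule stable_id)

lemma E_isometry: "g \<in> E X \<Longrightarrow> isometry b g"
  using E_stable by (auto simp: stable_isometries_def)

lemma E_inverse: 
  assumes "g \<in> E X"
  obtains h where "h \<in> E X" "h \<circ> g = id" "g \<circ> h = id"
proof -
  from assms have "\<exists>h\<in>E X. h \<circ> g = id \<and> g \<circ> h = id"
  proof induction
    case id
    show ?case using transvection_group.id by (rule bexI[rotated]) simp
  next
    case (step g c a)
    then obtain h where h: "h \<in> E X" "h \<circ> g = id" "g \<circ> h = id" by blast
    have "transvection b c (- a) \<in> E X"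
      using step by (intro transvection_in_group) (auto intro: L_minus)
    then have "h \<circ> transvection b c (- a) \<in> E X"
      using h(1) by (intro transvection_group_comp)
    moreover have t: "transvection b c a \<circ> transvection b c (- a) = id"
      "transvection b c (- a) \<circ> transvection b c a = id"
      using transvection_neg[of c a] transvection_neg[of c "- a"] C_isotropic step by auto
    have "h \<circ> transvection b c (- a) \<circ> (transvection b c a \<circ> g) = id"
      using t(2) h(2) by (metis comp_assoc comp_id)
    moreover have "(transvection b c a \<circ> g) \<circ> (h \<circ> transvection b c (- a)) = id"
      using t(1) h(3) by (metis comp_assoc comp_id)
    ultimately show ?case by blast
  qed
  then show ?thesis using that by blast
qed

lemma E_fixes:
  assumes "g \<in> E X" "x \<in> X" "\<And>c. c \<in> C \<Longrightarrow> b c x = 0"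
  shows "g x = x"
  using assms(1)
proof induction
  case (step g c a)
  then show ?case using assms(2,3) by (simp add: transvection_def)
qed simp

lemma E_reflection_word:
  assumes "g \<in> E X"
  obtains vs where "\<forall>v\<in>set vs. b v v \<noteq> 0" "g = reflection_word b vs"
    "even (length vs)" "(\<Prod>v\<leftarrow>vs. - (b v v / 2)) > 0"
proof -
  from assms have "\<exists>vs. (\<forall>v\<in>set vs. b v v \<noteq> 0) \<and> g = reflection_word b vs \<and>
    even (length vs) \<and> (\<Prod>v\<leftarrow>vs. - (b v v / 2)) > 0"
  proof induction
    case id
    show ?case by (rule exI[of _ "[]"]) simp
  next
    case (step g c a)
    then obtain vs where vs: "\<forall>v\<in>set vs. b v v \<noteq> 0" "g = reflection_word b vs"
      "even (length vs)" "(\<Prod>v\<leftarrow>vs. - (b v v / 2)) > 0" by auto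
    obtain w where w: "b c w = 0" "b w w \<noteq> 0" by (rule C_perp_anisotropic[OF step(2)])
    obtain us where us: "\<forall>v\<in>set us. b v v \<noteq> 0" "transvection b c a = reflection_word b us"
      "even (length us)" "(\<Prod>v\<leftarrow>us. - (b v v / 2)) > 0"
      by (rule transvection_reflection_word[OF C_isotropic[OF step(2)] step(4) w])
    have "transvection b c a \<circ> g = reflection_word b (us @ vs)"
      by (simp only: us vs reflection_word_append)
    moreover have "(\<Prod>v\<leftarrow>us @ vs. - (b v v / 2)) > 0"
      using us(4) vs(4) by (simp only: map_append prod_list.append mult_pos_pos)
    moreover have "even (length (us @ vs))" using us(3) vs(3) by simp
    moreover have "\<forall>v\<in>set (us @ vs). b v v \<noteq> 0" using us(1) vs(1) by auto
    ultimately show ?case by blast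
  qed
  then show ?thesis using that by blast
qed

end

section \<open>Orbits of transvection groups\<close>

text \<open>
  \<open>R\<close> is the set of coordinate vectors \<open>(b f y, b e y, b f' y, b e' y)\<close> for \<open>y\<close> in an orbit, and the
  assumptions are the effect of transvections on them; the first coordinate is minimised by
  Euclid's algorithm.
\<close>

lemma transvection_moves_reach_1:
  fixes R :: "int \<Rightarrow> int \<Rightarrow> int \<Rightarrow> int \<Rightarrow> bool"
  assumes m1: "\<And>p q r s k. R p q r s \<Longrightarrow> R (p - k * s) q (r + k * q) s"
    and m2: "\<And>p q r s k. R p q r s \<Longrightarrow> R (p - k * r) q r (s + k * q)"
    and m3: "\<And>p q r s k. R p q r s \<Longrightarrow> R p (q - k * s) (r + k * p) s"
    and m4: "\<And>p q r s k. R p q r s \<Longrightarrow> R p (q - k * r) r (s + k * p)"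
    and m5: "\<And>p q r. R p q r 0 \<Longrightarrow> \<exists>i j l n. i * q + j * p + l * r + n = 1 \<and> R p q (r - n) 0"
    and start: "R p\<^sub>0 q\<^sub>0 r\<^sub>0 s\<^sub>0"
  shows "\<exists>q r s. R 1 q r s"
proof -
  have nonzero: "\<exists>p' q r s. p' > 0 \<and> R p' q r s" if R: "R p q r s" and p: "p \<noteq> 0" for p q r s
  proof (cases "p > 0")
    case False
    then have "p \<le> - 1" using p by simp
    \<comment> \<open>This \<open>k\<close> makes the third coordinate at most -1. Subtracting 1 - p
      times it then raises the first coordinate to at least p + (1 - p) = 1.\<close>
    define k where "k = 1 + \<bar>r\<bar>"
    define r' where "r' = r + k * p"
    have "k * p \<le> k * (- 1)" using \<open>p \<le> - 1\<close> by (intro mult_left_mono) (auto simp: k_def)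
    then have r': "r' \<le> - 1" by (simp add: r'_def k_def)
    have "R p (q - k * s) r' s" unfolding r'_def by (rule m3[OF R])
    from m2[OF this, of "1 - p"] obtain s' where "R (p - (1 - p) * r') (q - k * s) r' s'" by blast
    moreover have "(1 - p) * r' \<le> (1 - p) * (- 1)"
      using r' \<open>p \<le> - 1\<close> by (intro mult_left_mono) auto
    then have "p - (1 - p) * r' > 0" by simp
    ultimately show ?thesis by blast
  qed (use R in blast)
  have third: "\<exists>p' q r s. p' > 0 \<and> R p' q r s" if "R 0 q r s" "r \<noteq> 0" for q r s
    using nonzero[OF m2[OF that(1), of 1]] that(2) by simp
  have "\<exists>p q r s. p > 0 \<and> R p q r s"
  proof -
    consider "p\<^sub>0 \<noteq> 0" | "p\<^sub>0 = 0" "r\<^sub>0 \<noteq> 0" | "p\<^sub>0 = 0" "s\<^sub>0 \<noteq> 0" | "p\<^sub>0 = 0" "r\<^sub>0 = 0" "s\<^sub>0 = 0" "q\<^sub>0 \<noteq> 0"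
      | "p\<^sub>0 = 0" "r\<^sub>0 = 0" "s\<^sub>0 = 0" "q\<^sub>0 = 0" by blast
    then show ?thesis
    proof cases
      case 1
      then show ?thesis using nonzero[OF start] by blast
    next
      case 2
      then show ?thesis using third start by blast
    next
      case 3
      then show ?thesis using nonzero[OF m1[OF start, of 1]] by simp
    next
      case 4
      then show ?thesis using m1[OF start, of 1] third[of q\<^sub>0 q\<^sub>0 0] by simp
    next
      case 5
      \<comment> \<open>With all four coordinates 0 the linear relation in \<open>m5\<close> forces
        n = 1, so the zero orbit point is left.\<close>
      then have "R 0 0 (- 1) 0" using m5[of 0 0 0] start by auto
      then show ?thesis using third by force
    qed
  qed
  then obtain p q r s where "p > 0" "R p q r s" by blast
  then have "nat p > 0 \<and> (\<exists>q r s. R (int (nat p)) q r s)" by auto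
  then have "\<exists>m::nat. m > 0 \<and> (\<exists>q r s. R (int m) q r s)" by (rule exI)
  then obtain m where m: "m > 0" "\<exists>q r s. R (int m) q r s"
    and least: "\<And>k. k < m \<Longrightarrow> \<not> (k > 0 \<and> (\<exists>q r s. R (int k) q r s))"
    unfolding exists_least_iff[of "\<lambda>m. m > 0 \<and> (\<exists>q r s. R (int m) q r s)"] by blast
  have minimal: "\<not> R p q r s" if "0 < p" "p < int m" for p q r s
    using least[of "nat p"] that by auto
  \<comment> \<open>The remainder is taken in the range 1..t instead of 0..t-1, because the first
    coordinate must stay positive to contradict minimality.\<close>
  have remainder: "0 < int m - (int m - 1) div t * t" "int m - (int m - 1) div t * t \<le> t"
    if "0 < t" for t
  proof -
    have "int m - (int m - 1) div t * t = 1 + (int m - 1) mod t"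
      by (simp add: minus_div_mult_eq_mod[symmetric])
    then show "0 < int m - (int m - 1) div t * t" "int m - (int m - 1) div t * t \<le> t"
      using pos_mod_bound[OF that, of "int m - 1"] pos_mod_sign[OF that, of "int m - 1"] by simp_all
  qed
  have dvd3: "int m dvd r" if R: "R (int m) q r s" for q r s
  proof (rule ccontr)
    assume "\<not> int m dvd r"
    \<comment> \<open>Once the third coordinate is reduced to a nonzero remainder below
      \<open>m\<close>, it can in turn reduce the first coordinate below \<open>m\<close>.\<close>
    define t where "t = r mod int m"
    have t: "0 < t" "t < int m"
    proof -
      have "t \<noteq> 0" using \<open>\<not> int m dvd r\<close> by (simp add: t_def dvd_eq_mod_eq_0)
      moreover have "0 \<le> t" using m(1) by (simp add: t_def)
      ultimately show "0 < t" by linarith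
      show "t < int m" using m(1) by (simp add: t_def)
    qed
    have "r + - (r div int m) * int m = t"
      by (simp add: t_def minus_div_mult_eq_mod[symmetric])
    then have "R (int m) (q - - (r div int m) * s) t s"
      using m3[OF R, of "- (r div int m)"] by simp
    from m2[OF this, of "(int m - 1) div t"] show False
      using minimal[OF remainder(1)[OF t(1)] order_le_less_trans[OF remainder(2)[OF t(1)] t(2)]] by blast
  qed
  have dvd4: "int m dvd s" if R: "R (int m) q r s" for q r s
  proof (rule ccontr)
    assume "\<not> int m dvd s"
    define t where "t = s mod int m"
    have t: "0 < t" "t < int m"
    proof -
      have "t \<noteq> 0" using \<open>\<not> int m dvd s\<close> by (simp add: t_def dvd_eq_mod_eq_0)
      moreover have "0 \<le> t" using m(1) by (simp add: t_def)
      ultimately show "0 < t" by linarith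
      show "t < int m" using m(1) by (simp add: t_def)
    qed
    have "s + - (s div int m) * int m = t"
      by (simp add: t_def minus_div_mult_eq_mod[symmetric])
    then have "R (int m) (q - - (s div int m) * r) r t"
      using m4[OF R, of "- (s div int m)"] by simp
    from m1[OF this, of "(int m - 1) div t"] show False
      using minimal[OF remainder(1)[OF t(1)] order_le_less_trans[OF remainder(2)[OF t(1)] t(2)]] by blast
  qed
  obtain q r s where R: "R (int m) q r s" using m(2) by blast
  obtain i where i: "r = int m * i" using dvd3[OF R] by (rule dvdE)
  obtain j where j: "s = int m * j" using dvd4[OF R] by (rule dvdE)
  note ij = i j
  have "R (int m) (q - - i * s) 0 s" using m3[OF R, of "- i"] ij by (simp add: mult.commute)
  from m4[OF this, of "- j"] have R': "R (int m) (q - - i * s) 0 0"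
    using ij by (simp add: mult.commute)
  define q' where "q' = q - - i * s"
  note R' = R'[folded q'_def]
  \<comment> \<open>With the last two coordinates cleared, this move copies the second into the
    third, where \<open>dvd3\<close> applies to it. Then \<open>m\<close> divides every term of the
    relation in \<open>m5\<close>, hence 1.\<close>
  have "R (int m) q' q' 0" using m1[OF R', of 1] by simp
  then have q': "int m dvd q'" by (rule dvd3)
  from m5[OF R'] obtain i j l n where n: "i * q' + j * int m + l * 0 + n = 1" "R (int m) q' (0 - n) 0"
    by blast
  have "int m dvd n" using dvd3[OF n(2)] by simp
  then have "int m dvd i * q' + j * int m + l * 0 + n" using q' by simp
  then have "int m dvd 1" by (simp only: n(1))
  then have "m = 1" by simp
  then show ?thesis using m(2) by simp
qed

context two_hyperbolic_pairs
begin

section \<open>Eichler's criterion on the dual lattice\<close>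

lemma dual_lattice_stable:
  assumes "g \<in> stable_isometries b L" "v \<in> dual_lattice b L"
  shows "g v \<in> dual_lattice b L"
proof -
  have g: "linear g" "\<And>x y. b (g x) (g y) = b x y" "g ` L = L"
    using assms(1) by (auto simp: stable_isometries_def isometry_def)
  obtain q l where "v = of_rat q *\<^sub>R l" "l \<in> L"
    using assms(2) by (auto simp: dual_lattice_def rational_span_def)
  then have "g v = of_rat q *\<^sub>R g l" "g l \<in> L" using g by (auto simp: linear_cmul)
  then have "g v \<in> rational_span L" by (auto simp: rational_span_def)
  moreover have "b (g v) l \<in> \<int>" if "l \<in> L" for l
  proof -
    obtain l' where "l' \<in> L" "l = g l'" using \<open>l \<in> L\<close> g(3) by blast
    then show ?thesis using assms(2) by (simp add: g(2) dual_lattice_def)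
  qed
  ultimately show ?thesis by (simp add: dual_lattice_def)
qed

lemma L_dual_lattice: "x \<in> L \<Longrightarrow> x \<in> dual_lattice b L"
  using L_integral by (auto simp: dual_lattice_def rational_span_def intro: exI[of _ 1])

text \<open>The planes alone would give only the gcd of four coordinates of \<open>z\<close>. The
  vector \<open>w\<close> brings in the part of \<open>L\<^sub>0\<close>, so that the coordinates
  and one pairing with \<open>L\<^sub>0\<close> are jointly coprime.\<close>

lemma orbit_attains_1:
  assumes z: "z \<in> dual_lattice b L"
    and X: "\<And>y c. y \<in> X \<Longrightarrow> c \<in> C \<Longrightarrow> b c y = 0"
    and w: "w \<in> L" "\<And>y. y \<in> X \<Longrightarrow> b w y = 0" "b w z = 1"
  shows "\<exists>g\<in>E X. b f (g z) = 1"
proof -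
  define R where "R p q r s \<longleftrightarrow> (\<exists>g\<in>E X. b f (g z) = of_int p \<and> b e (g z) = of_int q \<and>
    b f' (g z) = of_int r \<and> b e' (g z) = of_int s)" for p q r s
  have int: "\<exists>k::int. b l (g z) = of_int k" if "g \<in> E X" "l \<in> L" for g l
  proof -
    have "b (g z) l \<in> \<int>"
      using dual_lattice_stable[OF E_stable[OF that(1)] z] that(2) by (simp add: dual_lattice_def)
    then show ?thesis unfolding sym[of l "g z"] by (auto elim: Ints_cases)
  qed
  have move: "transvection b c (of_int k *\<^sub>R d) \<circ> g \<in> E X"
    "b u ((transvection b c (of_int k *\<^sub>R d) \<circ> g) z) =
      b u (g z) - of_int k * b d (g z) * b u c + of_int k * b c (g z) * b u d"
    if "g \<in> E X" "c \<in> C" "d \<in> C" "b c d = 0" for g c d k u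
  proof -
    show "transvection b c (of_int k *\<^sub>R d) \<circ> g \<in> E X"
      using that X[OF _ that(3)] C_L[OF that(3)]
      by (intro transvection_group.step) (auto intro: L_scale)
    show "b u ((transvection b c (of_int k *\<^sub>R d) \<circ> g) z) =
      b u (g z) - of_int k * b d (g z) * b u c + of_int k * b c (g z) * b u d"
      using C_isotropic[OF that(3)] by (simp add: transvection_def)
  qed
  have "\<exists>q r s. R 1 q r s"
  proof (rule transvection_moves_reach_1[of R])
    show "R (p - k * s) q (r + k * q) s" if pqrs: "R p q r s" for p q r s k
    proof -
      obtain g where g: "g \<in> E X" "b f (g z) = of_int p" "b e (g z) = of_int q"
        "b f' (g z) = of_int r" "b e' (g z) = of_int s" using pqrs by (auto simp: R_def)
      show ?thesis unfolding R_def
        by (rule bexI[OF _ move(1)[of g e e' k]]) (use g pairs pairs_sym in \<open>simp_all add: move(2) del: o_apply\<close>)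
    qed
    show "R (p - k * r) q r (s + k * q)" if pqrs: "R p q r s" for p q r s k
    proof -
      obtain g where g: "g \<in> E X" "b f (g z) = of_int p" "b e (g z) = of_int q"
        "b f' (g z) = of_int r" "b e' (g z) = of_int s" using pqrs by (auto simp: R_def)
      show ?thesis unfolding R_def
        by (rule bexI[OF _ move(1)[of g e f' k]]) (use g pairs pairs_sym in \<open>simp_all add: move(2) del: o_apply\<close>)
    qed
    show "R p (q - k * s) (r + k * p) s" if pqrs: "R p q r s" for p q r s k
    proof -
      obtain g where g: "g \<in> E X" "b f (g z) = of_int p" "b e (g z) = of_int q"
        "b f' (g z) = of_int r" "b e' (g z) = of_int s" using pqrs by (auto simp: R_def)
      show ?thesis unfolding R_def
        by (rule bexI[OF _ move(1)[of g f e' k]]) (use g pairs pairs_sym in \<open>simp_all add: move(2) del: o_apply\<close>)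
    qed
    show "R p (q - k * r) r (s + k * p)" if pqrs: "R p q r s" for p q r s k
    proof -
      obtain g where g: "g \<in> E X" "b f (g z) = of_int p" "b e (g z) = of_int q"
        "b f' (g z) = of_int r" "b e' (g z) = of_int s" using pqrs by (auto simp: R_def)
      show ?thesis unfolding R_def
        by (rule bexI[OF _ move(1)[of g f f' k]]) (use g pairs pairs_sym in \<open>simp_all add: move(2) del: o_apply\<close>)
    qed
    show "\<exists>i j l n. i * q + j * p + l * r + n = 1 \<and> R p q (r - n) 0" if pqr: "R p q r 0" for p q r
    proof -
      obtain g where g: "g \<in> E X" "b f (g z) = of_int p" "b e (g z) = of_int q"
        "b f' (g z) = of_int r" "b e' (g z) = 0" using pqr by (auto simp: R_def)
      have iso: "b (g u) (g v) = b u v" for u v using E_isometry[OF g(1)] by (simp add: isometry_def)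
      have "g w \<in> L" using E_stable[OF g(1)] w(1) by (auto simp: stable_isometries_def)
      \<comment> \<open>The expansion of \<open>g w\<close> turns b (g w) (g z) = 1 into the
        relation of \<open>m5\<close>, with \<open>n\<close> the contribution of
        \<open>w\<^sub>0\<close>. As \<open>b e' (g z) = 0\<close>, the transvection along
        \<open>e'\<close> by \<open>w\<^sub>0\<close> merely subtracts \<open>n\<close> times
        \<open>e'\<close>; it belongs to \<open>E X\<close> because \<open>w\<^sub>0\<close>
        inherits orthogonality to \<open>X\<close> from \<open>w\<close>.\<close>
      then obtain i j k l w\<^sub>0 where gw:
        "g w = of_int i *\<^sub>R e + of_int j *\<^sub>R f + of_int k *\<^sub>R e' + of_int l *\<^sub>R f' + w\<^sub>0"
        and w0: "w\<^sub>0 \<in> L\<^sub>0" unfolding L_eq by blast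
      have perp: "b w\<^sub>0 y = 0" if y: "y \<in> X" for y
      proof -
        have "b (g w) y = 0" using iso[of w y] E_fixes[OF g(1) y X[OF y]] w(2)[OF y] by simp
        then show ?thesis using X[OF y] by (simp add: gw)
      qed
      obtain n where n: "b w\<^sub>0 (g z) = of_int n" using int[OF g(1) L0_L[OF w0]] by blast
      have "b (g w) (g z) = 1" using w(3) by (simp add: iso)
      then have "real_of_int (i * q + j * p + l * r + n) = 1"
        using g by (simp add: gw n)
      then have "i * q + j * p + l * r + n = 1" by linarith
      moreover have t: "transvection b e' w\<^sub>0 \<circ> g \<in> E X"
        using g(1) perp L0_L[OF w0] pairs_L0(3)[OF w0] by (intro transvection_group.step) auto
      have "b u ((transvection b e' w\<^sub>0 \<circ> g) z) = b u (g z) - of_int n * b u e'" for u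
        by (simp add: transvection_def g n)
      then have "R p q (r - n) 0"
        unfolding R_def by (intro bexI[OF _ t]) (use g pairs pairs_sym in \<open>simp_all del: o_apply\<close>)
      ultimately show ?thesis by blast
    qed
    have "id \<in> E X" by (rule transvection_group.id)
    have "b c z = of_int \<lfloor>b c z\<rfloor>" if "c \<in> C" for c
      using int[OF \<open>id \<in> E X\<close> C_L[OF that]] by auto
    then show "R \<lfloor>b f z\<rfloor> \<lfloor>b e z\<rfloor> \<lfloor>b f' z\<rfloor> \<lfloor>b e' z\<rfloor>"
      unfolding R_def by (intro bexI[OF _ \<open>id \<in> E X\<close>]) simp_all
  qed
  then show ?thesis by (auto simp: R_def)
qed

text \<open>\<open>x\<close> represents the discriminant class of \<open>z\<close>. When
  \<open>f\<close> takes the value 1 on \<open>z\<close>, a transvection along \<open>f\<close> can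
  add any prescribed lattice vector orthogonal to \<open>f\<close>, up to a multiple of
  \<open>f\<close>, and the norm determines that multiple.\<close>

lemma orbit_normal_form:
  assumes z: "z \<in> dual_lattice b L" and zx: "z - x \<in> L" "\<And>y. y \<in> X \<Longrightarrow> b (z - x) y = 0"
    and X: "\<And>y c. y \<in> X \<Longrightarrow> c \<in> C \<Longrightarrow> b c y = 0"
    and x: "\<And>c. c \<in> C \<Longrightarrow> b c x = 0"
    and w: "w \<in> L" "\<And>y. y \<in> X \<Longrightarrow> b w y = 0" "b w z = 1"
    and norm: "b z z = b x x"
  shows "\<exists>g\<in>E X. g z = x + e"
proof -
  obtain g where g: "g \<in> E X" "b f (g z) = 1"
    using orbit_attains_1[OF z X w] by blast
  have g_stable: "g \<in> stable_isometries b L" by (rule E_stable[OF g(1)])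
  have g_iso: "isometry b g" by (rule E_isometry[OF g(1)])
  have "g z - z \<in> L" using g_stable z by (auto simp: stable_isometries_def)
  from L_add[OF this zx(1)] have gzx: "g z - x \<in> L" by simp
  have "b (g z) y = b x y" if y: "y \<in> X" for y
  proof -
    have "b (g z) (g y) = b z y" using g_iso by (simp add: isometry_def)
    then show ?thesis using E_fixes[OF g(1) y X[OF y]] zx(2)[OF y] by simp
  qed
  then have perp: "b (g z - x) y = 0" if "y \<in> X" for y using that by simp
  have i: "b e (g z) \<in> \<int>" using L_integral[OF C_L[of e] gzx] x[of e] by simp
  \<comment> \<open>The displacement from \<open>g z\<close> to \<open>x + e\<close>, corrected by a
    multiple of \<open>f\<close>. It is orthogonal to \<open>f\<close> because both vectors pair to
    1 with \<open>f\<close>.\<close>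
  define a where "a = - (g z - x - e - b e (g z) *\<^sub>R f)"
  have a: "a \<in> L"
    unfolding a_def by (intro L_minus L_diff[OF L_diff[OF gzx]] L_scale i C_L) simp_all
  have fa: "b f a = 0" using g(2) x[of f] pairs pairs_sym by (simp add: a_def)
  have aX: "b a y = 0" if y: "y \<in> X" for y
    using perp[OF y] X[OF y] by (simp add: a_def)
  have t: "transvection b f a \<circ> g \<in> E X"
    using g(1) a fa aX by (intro transvection_group.step) auto
  obtain r where r: "transvection b f a (g z) = x + e + r *\<^sub>R f"
  proof
    show "transvection b f a (g z) = x + e + (b e (g z) - b a (g z) - b a a / 2) *\<^sub>R f"
      by (simp add: transvection_def g(2)) (simp add: a_def algebra_simps)
  qed
  \<comment> \<open>The norm of \<open>x + e + r f\<close> exceeds that of \<open>x\<close> by 2 r,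
    hence r = 0.\<close>
  have "b ((transvection b f a \<circ> g) z) ((transvection b f a \<circ> g) z) = b z z"
    using E_isometry[OF t] by (simp only: isometry_def)
  then have "b (x + e + r *\<^sub>R f) (x + e + r *\<^sub>R f) = b x x"
    by (simp only: o_apply r norm)
  then have "r = 0"
    using x[of e] x[of f] pairs pairs_sym sym[of x e] sym[of x f] by simp
  then show ?thesis using r by (intro bexI[OF _ t]) simp
qed

text \<open>Both \<open>x\<close> and \<open>h x\<close> have the normal form \<open>x + e\<close>
  under \<open>E X\<close>: stability of \<open>h\<close> puts them in one class modulo
  \<open>L\<close>, and \<open>h w\<close> serves \<open>h x\<close> as \<open>w\<close> serves
  \<open>x\<close>.\<close>

lemma stable_fix_vector:
  assumes h: "h \<in> stable_isometries b L" "\<And>y. y \<in> X \<Longrightarrow> h y = y"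
    and X: "\<And>y c. y \<in> X \<Longrightarrow> c \<in> C \<Longrightarrow> b c y = 0"
    and x: "x \<in> dual_lattice b L" "\<And>c. c \<in> C \<Longrightarrow> b c x = 0"
    and w: "w \<in> L" "\<And>y. y \<in> X \<Longrightarrow> b w y = 0" "b w x = 1"
  shows "\<exists>g\<in>E X. g (h x) = x"
proof -
  have iso: "b (h u) (h v) = b u v" for u v
    using h(1) by (simp add: stable_isometries_def isometry_def)
  obtain g\<^sub>1 where g1: "g\<^sub>1 \<in> E X" "g\<^sub>1 x = x + e"
  proof -
    have "\<exists>g\<in>E X. g x = x + e"
      by (rule orbit_normal_form[OF x(1) _ _ X x(2) w refl]) (simp_all add: L_0)
    then show ?thesis using that by blast
  qed
  have "\<exists>g\<in>E X. g (h x) = x + e"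
  proof (rule orbit_normal_form[where w = "h w"])
    show "h x \<in> dual_lattice b L" by (rule dual_lattice_stable[OF h(1) x(1)])
    show "h x - x \<in> L" using h(1) x(1) by (auto simp: stable_isometries_def)
    show "b (h x - x) y = 0" if "y \<in> X" for y using iso[of x y] h(2)[OF that] by simp
    show "h w \<in> L" using h(1) w(1) by (auto simp: stable_isometries_def)
    show "b (h w) y = 0" if "y \<in> X" for y using iso[of w y] h(2)[OF that] w(2)[OF that] by simp
    show "b (h w) (h x) = 1" "b (h x) (h x) = b x x" using w(3) by (simp_all add: iso)
    show "b c y = 0" if "y \<in> X" "c \<in> C" for y c using that by (rule X)
    show "b c x = 0" if "c \<in> C" for c using that by (rule x(2))
  qed
  then obtain g\<^sub>2 where g2: "g\<^sub>2 \<in> E X" "g\<^sub>2 (h x) = x + e" by blast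
  obtain k where k: "k \<in> E X" "k \<circ> g\<^sub>1 = id" by (rule E_inverse[OF g1(1)])
  have "(k \<circ> g\<^sub>2) (h x) = k (g\<^sub>1 x)" by (simp add: g1(2) g2(2))
  also have "\<dots> = x" using k(2) by (metis comp_apply id_apply)
  finally show ?thesis using transvection_group_comp[OF k(1) g2(1)] by blast
qed

text \<open>In the inductive step the witness for \<open>\<xi> k\<close> is the basis vector
  \<open>k\<close>: it pairs to 1 with \<open>\<xi> k\<close> and is orthogonal to the dual vectors
  already fixed, so the correction does not disturb them.\<close>

lemma stable_fix_dual_basis:
  assumes h: "h \<in> stable_isometries b L" and K: "finite K" "K \<subseteq> B\<^sub>0"
  shows "\<exists>g\<in>E {}. \<forall>l\<in>K. g (h (\<xi> l)) = \<xi> l"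
  using K
proof (induction K)
  case empty
  show ?case using transvection_group.id by blast
next
  case (insert k K)
  then have kB: "k \<in> B\<^sub>0" and kK: "k \<notin> K" and KB: "K \<subseteq> B\<^sub>0" by auto
  obtain g where g: "g \<in> E {}" "\<forall>l\<in>K. g (h (\<xi> l)) = \<xi> l"
    using insert.IH[OF KB] by blast
  have perp: "b c y = 0" if "y \<in> \<xi> ` K" "c \<in> C" for y c
    using that KB \<xi>_pairs by auto
  have "\<exists>g'\<in>E (\<xi> ` K). g' ((g \<circ> h) (\<xi> k)) = \<xi> k"
  proof (rule stable_fix_vector[where w = k])
    show "g \<circ> h \<in> stable_isometries b L" by (rule stable_comp[OF E_stable[OF g(1)] h])
    show "(g \<circ> h) y = y" if "y \<in> \<xi> ` K" for y using that g(2) by auto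
    show "b c (\<xi> k) = 0" if "c \<in> C" for c using that \<xi>_pairs kB by auto
    show "\<xi> k \<in> dual_lattice b L" by (rule \<xi>_dual[OF kB])
    show "b c y = 0" if "y \<in> \<xi> ` K" "c \<in> C" for y c using that by (rule perp)
    show "k \<in> L" by (rule L0_L) (simp add: B0 kB zspan_superset)
    show "b k y = 0" if "y \<in> \<xi> ` K" for y
    proof -
      obtain l where l: "l \<in> K" "y = \<xi> l" using \<open>y \<in> \<xi> ` K\<close> by blast
      have "b k y = b (\<xi> l) k" unfolding l(2) by (rule sym)
      also have "\<dots> = 0" using \<xi>[of l k] l(1) kB kK KB by auto
      finally show ?thesis .
    qed
    have "b k (\<xi> k) = b (\<xi> k) k" by (rule sym)
    then show "b k (\<xi> k) = 1" using \<xi>[OF kB kB] by simp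
  qed
  then obtain g' where g': "g' \<in> E (\<xi> ` K)" "g' (g (h (\<xi> k))) = \<xi> k" by auto
  have "g' (g (h (\<xi> l))) = \<xi> l" if l: "l \<in> K" for l
    using g(2) l E_fixes[OF g'(1) imageI[OF l] perp[OF imageI[OF l]]] by simp
  moreover have "g' \<circ> g \<in> E {}"
    by (rule transvection_group_comp[OF subsetD[OF transvection_group_mono[OF empty_subsetI] g'(1)] g(1)])
  ultimately show ?case using g'(2) by (intro bexI[of _ "g' \<circ> g"]) auto
qed

text \<open>The vectors \<open>\<xi> l\<close> and \<open>C\<close> span the whole space:
  \<open>u\<close> is the expansion of \<open>v\<close> in the basis dual to that of
  \<open>L\<close>, so \<open>v - u\<close> is orthogonal to \<open>L\<close> and therefore
  0.\<close>

lemma linear_eqI: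
  assumes "linear g" "linear h" "\<And>l. l \<in> B\<^sub>0 \<Longrightarrow> g (\<xi> l) = h (\<xi> l)" "\<And>c. c \<in> C \<Longrightarrow> g c = h c"
  shows "g = h"
proof
  fix v
  define u where "u = b f v *\<^sub>R e + b e v *\<^sub>R f + b f' v *\<^sub>R e' + b e' v *\<^sub>R f' + (\<Sum>l\<in>B\<^sub>0. b v l *\<^sub>R \<xi> l)"
  have B0_L0: "l \<in> L\<^sub>0" if "l \<in> B\<^sub>0" for l using that B0 by (simp add: zspan_superset)
  have C: "b c (v - u) = 0" if "c \<in> C" for c
  proof -
    have "(\<Sum>l\<in>B\<^sub>0. b v l * b c (\<xi> l)) = 0"
      using that \<xi>_pairs by (intro sum.neutral) auto
    then show ?thesis
      using that by (auto simp: u_def form_sum pairs pairs_sym)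
  qed
  have B: "b l (v - u) = 0" if l: "l \<in> B\<^sub>0" for l
  proof -
    have "(\<Sum>l'\<in>B\<^sub>0. b v l' * b l (\<xi> l')) = (\<Sum>l'\<in>B\<^sub>0. if l' = l then b v l else 0)"
    proof (rule sum.cong)
      fix l' assume "l' \<in> B\<^sub>0"
      then have "b l (\<xi> l') = (if l' = l then 1 else 0)"
        unfolding sym[of l "\<xi> l'"] using \<xi>[of l' l] l by auto
      then show "b v l' * b l (\<xi> l') = (if l' = l then b v l else 0)" by simp
    qed simp
    also have "\<dots> = b v l" using l B0 by simp
    finally have sum: "(\<Sum>l'\<in>B\<^sub>0. b v l' * b l (\<xi> l')) = b v l" .
    have "b l e = 0" "b l f = 0" "b l e' = 0" "b l f' = 0"
      using pairs_L0[OF B0_L0[OF l]] by (simp_all only: sym[of l e] sym[of l f] sym[of l e'] sym[of l f'])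
    then show ?thesis
      by (simp add: u_def form_sum sum sym[of l v])
  qed
  have "v - u = 0"
  proof (rule L_perp)
    fix y assume "y \<in> L"
    then obtain i j k l z where
      y: "y = of_int i *\<^sub>R e + of_int j *\<^sub>R f + of_int k *\<^sub>R e' + of_int l *\<^sub>R f' + z" "z \<in> L\<^sub>0"
      unfolding L_eq by blast
    obtain c where z: "z = (\<Sum>w\<in>B\<^sub>0. of_int (c w) *\<^sub>R w)"
      using y(2) unfolding B0(2) by (rule zspanE)
    have "b y (v - u) = 0"
      unfolding y z form_simps(1,5) form_sum using C B by simp
    then show "b (v - u) y = 0" by (subst sym)
  qed
  then have v: "v = u" by simp
  have "g u = h u"
    unfolding u_def
    by (simp add: linear_add[OF assms(1)] linear_add[OF assms(2)] linear_cmul[OF assms(1)]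
        linear_cmul[OF assms(2)] linear_sum[OF assms(1)] linear_sum[OF assms(2)] assms(3,4))
  then show "g v = h v" by (simp only: v[symmetric])
qed

section \<open>Reduction to the isometries of one hyperbolic plane\<close>

lemma L_coordinates:
  assumes y: "y \<in> L" "b e y = 0" "b f y = 0" "\<And>l. l \<in> B\<^sub>0 \<Longrightarrow> b y (\<xi> l) = 0"
  shows "\<exists>k l :: int. y = of_int k *\<^sub>R e' + of_int l *\<^sub>R f'"
proof -
  obtain i j k l z where
    y_eq: "y = of_int i *\<^sub>R e + of_int j *\<^sub>R f + of_int k *\<^sub>R e' + of_int l *\<^sub>R f' + z" and z: "z \<in> L\<^sub>0"
    using y(1) unfolding L_eq by blast
  obtain c where z_eq: "z = (\<Sum>w\<in>B\<^sub>0. of_int (c w) *\<^sub>R w)"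
    using z unfolding B0(2) by (rule zspanE)
  have "c w = 0" if w: "w \<in> B\<^sub>0" for w
  proof -
    have "b y (\<xi> w) = b z (\<xi> w)" using \<xi>_pairs w by (simp add: y_eq)
    also have "\<dots> = (\<Sum>w'\<in>B\<^sub>0. if w' = w then of_int (c w) else 0)"
      unfolding z_eq form_sum
    proof (rule sum.cong)
      fix w' assume "w' \<in> B\<^sub>0"
      then have "b w' (\<xi> w) = (if w' = w then 1 else 0)"
        unfolding sym[of w' "\<xi> w"] using \<xi>[of w w'] w by auto
      then show "b (of_int (c w') *\<^sub>R w') (\<xi> w) = (if w' = w then of_int (c w) else 0)" by simp
    qed simp
    also have "\<dots> = of_int (c w)" using w B0 by simp
    finally show ?thesis using y(4)[OF w] by simp
  qed
  then have "z = 0" by (simp add: z_eq)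
  moreover have "i = 0" "j = 0"
    using y(2,3) pairs_L0[OF z] pairs pairs_sym by (simp_all add: y_eq)
  ultimately show ?thesis using y_eq by auto
qed

lemma anisotropic_pair: "b (e' - f') (e' - f') = - 2" "b (e' + f') (e' + f') = 2"
  using pairs pairs_sym by simp_all

lemma stable_reduction:
  assumes h: "h \<in> stable_isometries b L"
  shows "\<exists>g\<in>E {}. g \<circ> h \<in> reflection_word b ` {[], [e' - f'], [e' + f'], [e' - f', e' + f']}"
proof -
  define X where "X = \<xi> ` B\<^sub>0"
  have X: "\<And>y c. y \<in> X \<Longrightarrow> c \<in> C \<Longrightarrow> b c y = 0"
    using \<xi>_pairs by (auto simp: X_def)
  have mono: "E X \<subseteq> E {}" by (rule transvection_group_mono) simp
  obtain g\<^sub>1 where g1: "g\<^sub>1 \<in> E {}" "\<forall>l\<in>B\<^sub>0. g\<^sub>1 (h (\<xi> l)) = \<xi> l"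
    using stable_fix_dual_basis[OF h B0(1) subset_refl] by blast
  define h\<^sub>1 where "h\<^sub>1 = g\<^sub>1 \<circ> h"
  have h1: "h\<^sub>1 \<in> stable_isometries b L" "\<And>y. y \<in> X \<Longrightarrow> h\<^sub>1 y = y"
    using stable_comp[OF E_stable[OF g1(1)] h] g1(2) by (auto simp: h\<^sub>1_def X_def)
  have iso1: "b (h\<^sub>1 u) (h\<^sub>1 v) = b u v" for u v
    using h1(1) by (simp add: stable_isometries_def isometry_def)
  have h1_L: "h\<^sub>1 y \<in> L" if "y \<in> L" for y using that h1(1) by (auto simp: stable_isometries_def)
  \<comment> \<open>A lattice vector has the trivial discriminant class, so the normal form is taken
    with x = 0 and the isotropic vector is returned to \<open>e\<close> itself. The lattice vector
    pairing to 1 with it is the image of \<open>f\<close>.\<close>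
  have "\<exists>g\<in>E X. g (h\<^sub>1 e) = 0 + e"
  proof (rule orbit_normal_form[where w = "h\<^sub>1 f"])
    show "h\<^sub>1 e \<in> dual_lattice b L" by (intro L_dual_lattice h1_L C_L) simp
    show "h\<^sub>1 e - 0 \<in> L" "h\<^sub>1 f \<in> L" using h1_L C_L by simp_all
    show "b (h\<^sub>1 e - 0) y = 0" "b (h\<^sub>1 f) y = 0" if "y \<in> X" for y
      using iso1[of e y] iso1[of f y] h1(2)[OF that] X[OF that] by simp_all
    show "b c y = 0" if "y \<in> X" "c \<in> C" for y c using that by (rule X)
  qed (simp_all add: iso1 pairs pairs_sym)
  then obtain g\<^sub>2 where g2: "g\<^sub>2 \<in> E X" "g\<^sub>2 (h\<^sub>1 e) = e" by auto
  define h\<^sub>2 where "h\<^sub>2 = g\<^sub>2 \<circ> h\<^sub>1"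
  have h2: "h\<^sub>2 \<in> stable_isometries b L" "h\<^sub>2 e = e" "\<And>y. y \<in> X \<Longrightarrow> h\<^sub>2 y = y"
    using stable_comp[OF E_stable[OF g2(1)] h1(1)] g2(2) h1(2) E_fixes[OF g2(1) _ X]
    by (auto simp: h\<^sub>2_def)
  have iso2: "b (h\<^sub>2 u) (h\<^sub>2 v) = b u v" for u v
    using h2(1) by (simp add: stable_isometries_def isometry_def)
  have h2f: "h\<^sub>2 f \<in> L" using h2(1) C_L[of f] by (auto simp: stable_isometries_def)
  have ef: "b e (h\<^sub>2 f) = 1" "b (h\<^sub>2 f) (h\<^sub>2 f) = 0"
    using iso2[of e f] iso2[of f f] h2(2) pairs by simp_all
  \<comment> \<open>As \<open>h\<^sub>2 f\<close> pairs to 1 with \<open>e\<close>, the transvection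
    along \<open>e\<close> by this vector brings it to \<open>f\<close> up to a multiple of
    \<open>e\<close>, which the norm excludes. Orthogonality of \<open>a\<close> to \<open>e\<close>
    keeps \<open>e\<close> fixed.\<close>
  define a where "a = - (h\<^sub>2 f - f - b f (h\<^sub>2 f) *\<^sub>R e)"
  have a: "a \<in> L"
    unfolding a_def by (intro L_minus L_diff L_scale L_integral h2f C_L) simp_all
  have ea: "b e a = 0" using ef pairs by (simp add: a_def)
  have aX: "\<forall>y\<in>X. b a y = 0"
  proof
    fix y assume y: "y \<in> X"
    have "b (h\<^sub>2 f) y = 0" using iso2[of f y] h2(3)[OF y] X[OF y] by simp
    then show "b a y = 0" using X[OF y] by (simp add: a_def)
  qed
  define g\<^sub>3 where "g\<^sub>3 = transvection b e a"
  have g3: "g\<^sub>3 \<in> E X"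
    unfolding g\<^sub>3_def using a ea aX by (intro transvection_in_group) auto
  define h\<^sub>3 where "h\<^sub>3 = g\<^sub>3 \<circ> h\<^sub>2"
  have h3: "h\<^sub>3 \<in> stable_isometries b L" "\<And>y. y \<in> X \<Longrightarrow> h\<^sub>3 y = y"
    using stable_comp[OF E_stable[OF g3] h2(1)] h2(3) E_fixes[OF g3 _ X] by (auto simp: h\<^sub>3_def)
  have iso3: "b (h\<^sub>3 u) (h\<^sub>3 v) = b u v" and lin3: "linear h\<^sub>3" for u v
    using h3(1) by (simp_all add: stable_isometries_def isometry_def)
  have h3e: "h\<^sub>3 e = e" using h2(2) pairs sym[of a e] ea by (simp add: h\<^sub>3_def g\<^sub>3_def transvection_def)
  obtain r where r: "h\<^sub>3 f = f + r *\<^sub>R e"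
  proof
    show "h\<^sub>3 f = f + (b f (h\<^sub>2 f) - b a (h\<^sub>2 f) - b a a / 2) *\<^sub>R e"
      by (simp add: h\<^sub>3_def g\<^sub>3_def transvection_def ef) (simp add: a_def algebra_simps)
  qed
  have "b (f + r *\<^sub>R e) (f + r *\<^sub>R e) = 0" using iso3[of f f] pairs by (simp only: r)
  then have h3f: "h\<^sub>3 f = f" using r pairs pairs_sym by simp
  have coord: "\<exists>k l. h\<^sub>3 c = real_of_int k *\<^sub>R e' + real_of_int l *\<^sub>R f'" if c: "c \<in> {e', f'}" for c
  proof -
    have "h\<^sub>3 c \<in> L" using h3(1) C_L[of c] c by (auto simp: stable_isometries_def)
    moreover have "b e (h\<^sub>3 c) = 0" "b f (h\<^sub>3 c) = 0"
      using iso3[of e c] iso3[of f c] c pairs by (auto simp: h3e h3f)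
    moreover have "b (h\<^sub>3 c) (\<xi> l) = 0" if "l \<in> B\<^sub>0" for l
      using iso3[of c "\<xi> l"] h3(2)[of "\<xi> l"] that c \<xi>_pairs by (auto simp: X_def)
    ultimately show ?thesis by (rule L_coordinates)
  qed
  from coord[of e'] obtain k l :: int where he': "h\<^sub>3 e' = of_int k *\<^sub>R e' + of_int l *\<^sub>R f'"
    by auto
  from coord[of f'] obtain k' l' :: int where hf': "h\<^sub>3 f' = of_int k' *\<^sub>R e' + of_int l' *\<^sub>R f'"
    by auto
  have "real_of_int (k * l) = 0" "real_of_int (k' * l') = 0" "real_of_int (k * l' + l * k') = 1"
    using iso3[of e' e'] iso3[of f' f'] iso3[of e' f'] pairs pairs_sym
    by (simp_all add: he' hf' mult.commute)
  then have kl: "k * l = 0" "k' * l' = 0" "k * l' + l * k' = 1" by (simp_all only: of_int_eq_0_iff of_int_eq_1_iff)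
  \<comment> \<open>An isotropic image lies on one of the two axes of the plane, and the mixed
    pairing makes its coefficient a unit. The cases are the identity, minus the identity, the swap
    and its negative.\<close>
  have "(k = 1 \<and> l = 0 \<and> k' = 0 \<and> l' = 1) \<or> (k = - 1 \<and> l = 0 \<and> k' = 0 \<and> l' = - 1) \<or>
    (k = 0 \<and> l = 1 \<and> k' = 1 \<and> l' = 0) \<or> (k = 0 \<and> l = - 1 \<and> k' = - 1 \<and> l' = 0)"
  proof (cases "l = 0")
    case True
    then have "k * l' = 1" using kl(3) by simp
    then have "k = 1 \<and> l' = 1 \<or> k = - 1 \<and> l' = - 1" by (simp only: zmult_eq_1_iff)
    then show ?thesis using True kl(2) by auto
  next
    case False
    then have "k = 0" using kl(1) by simp
    then have "l * k' = 1" using kl(3) by simp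
    then have "l = 1 \<and> k' = 1 \<or> l = - 1 \<and> k' = - 1" by (simp only: zmult_eq_1_iff)
    then show ?thesis using \<open>k = 0\<close> kl(2) by auto
  qed
  then obtain vs where vs: "vs \<in> {[], [e' - f'], [e' + f'], [e' - f', e' + f']}"
    and vs_e: "h\<^sub>3 e' = reflection_word b vs e'" and vs_f: "h\<^sub>3 f' = reflection_word b vs f'"
  proof (elim disjE conjE)
    assume "k = 1" "l = 0" "k' = 0" "l' = 1"
    then show ?thesis using he' hf' by (intro that[of "[]"]) simp_all
  next
    assume "k = - 1" "l = 0" "k' = 0" "l' = - 1"
    then show ?thesis using he' hf' pairs pairs_sym
      by (intro that[of "[e' - f', e' + f']"]) (simp_all add: reflection_def algebra_simps)
  next
    assume "k = 0" "l = 1" "k' = 1" "l' = 0"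
    then show ?thesis using he' hf' pairs pairs_sym
      by (intro that[of "[e' - f']"]) (simp_all add: reflection_def algebra_simps)
  next
    assume "k = 0" "l = - 1" "k' = - 1" "l' = 0"
    then show ?thesis using he' hf' pairs pairs_sym
      by (intro that[of "[e' + f']"]) (simp_all add: reflection_def algebra_simps)
  qed
  have fix_perp: "reflection_word b vs x = x" if "b e' x = 0" "b f' x = 0" for x
    using vs that sym[of x e'] sym[of x f'] by (auto simp: reflection_def)
  have "isometry b (reflection_word b vs)"
    using vs anisotropic_pair by (intro isometry_reflection_word) (auto simp del: form_simps)
  then have "linear (reflection_word b vs)" by (simp add: isometry_def)
  with lin3 have "h\<^sub>3 = reflection_word b vs"
  proof (rule linear_eqI)
    show "h\<^sub>3 (\<xi> l) = reflection_word b vs (\<xi> l)" if "l \<in> B\<^sub>0" for l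
      using that h3(2)[of "\<xi> l"] fix_perp[of "\<xi> l"] \<xi>_pairs by (simp add: X_def)
    show "h\<^sub>3 c = reflection_word b vs c" if "c \<in> C" for c
      using that vs_e vs_f fix_perp[of e] fix_perp[of f] pairs_sym h3e h3f by auto
  qed
  moreover have "(g\<^sub>3 \<circ> g\<^sub>2 \<circ> g\<^sub>1) \<circ> h = h\<^sub>3" by (simp add: h\<^sub>3_def h\<^sub>2_def h\<^sub>1_def comp_assoc)
  moreover have "g\<^sub>3 \<circ> g\<^sub>2 \<circ> g\<^sub>1 \<in> E {}"
    using g1(1) g2(1) g3 mono by (intro transvection_group_comp) auto
  ultimately have "(g\<^sub>3 \<circ> g\<^sub>2 \<circ> g\<^sub>1) \<circ> h = reflection_word b vs" "g\<^sub>3 \<circ> g\<^sub>2 \<circ> g\<^sub>1 \<in> E {}"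
    by (simp_all only:)
  then show ?thesis using vs by (intro bexI[of _ "g\<^sub>3 \<circ> g\<^sub>2 \<circ> g\<^sub>1"]) (simp_all only: imageI)
qed

end

section \<open>The rank modulo a prime\<close>

lemma det_cong:
  fixes A B :: "int mat"
  assumes "A \<in> carrier_mat n n" "B \<in> carrier_mat n n"
    and "\<And>i j. i < n \<Longrightarrow> j < n \<Longrightarrow> [A $$ (i, j) = B $$ (i, j)] (mod m)"
  shows "[Determinant.det A = Determinant.det B] (mod m)"
  unfolding det_def'[OF assms(1)] det_def'[OF assms(2)]
proof (intro cong_sum cong_mult cong_prod cong_refl)
  fix \<pi> i
  assume "\<pi> \<in> {\<pi>. \<pi> permutes {0..<n}}" "i \<in> {0..<n}"
  then have "\<pi> i < n" using permutes_in_image[of \<pi> "{0..<n}" i] by auto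
  then show "[A $$ (i, \<pi> i) = B $$ (i, \<pi> i)] (mod m)"
    using assms(3) \<open>i \<in> {0..<n}\<close> by auto
qed

lemma p_rank_witness:
  fixes b :: "'a::euclidean_space \<Rightarrow> 'a \<Rightarrow> real"
  assumes "0 \<in> L"
  shows "\<exists>M vs. M \<subseteq> L \<and> lattice_basis vs M \<and> length vs = p_rank p b L \<and>
    (\<exists>d::int. gram_det b vs = of_int d \<and> coprime d (int p))"
proof -
  define S where "S = {r. \<exists>M vs. M \<subseteq> L \<and> lattice_basis vs M \<and> length vs = r \<and>
    (\<exists>d::int. gram_det b vs = of_int d \<and> coprime d (int p))}"
  have "S \<subseteq> {..DIM('a)}"
  proof
    fix r assume "r \<in> S"
    then obtain vs :: "'a list" where vs: "distinct vs" "independent (set vs)" "length vs = r"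
      by (auto simp: S_def lattice_basis_def)
    have "card (set vs) \<le> DIM('a)" using independent_bound[OF vs(2)] by simp
    then show "r \<in> {..DIM('a)}" using vs(1,3) by (simp add: distinct_card)
  qed
  then have fin: "finite S" by (rule finite_subset) simp
  have "lattice_basis [] {0::'a}"
    by (simp add: lattice_basis_def zspan_def independent_empty)
  moreover have "gram_det b [] = of_int 1"
    by (simp add: gram_det_def)
  ultimately have "0 \<in> S"
    unfolding S_def using assms by (intro CollectI exI[of _ "{0}"] exI[of _ "[]"] exI[of _ 1] conjI) auto
  then have "Max S \<in> S" using fin by (intro Max_in) auto
  then show ?thesis unfolding p_rank_def S_def[symmetric] by (simp add: S_def)
qed

context two_hyperbolic_pairs
begin

text \<open>
  If all values of \<open>b\<close> on \<open>L\<^sub>0\<close> were divisible by \<open>p\<close>, then modulo \<open>p\<close> every Gram matrix of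
  vectors of \<open>L\<close> would factor through the four coordinates of the hyperbolic planes.
\<close>

lemma p_rank_ge_5:
  assumes p: "p > 1" and rank: "p_rank p b L \<ge> 5"
  shows "\<exists>m\<in>L\<^sub>0. \<exists>n\<in>L\<^sub>0. \<exists>k::int. b m n = of_int k \<and> \<not> int p dvd k"
proof (rule ccontr)
  assume neg: "\<not> ?thesis"
  obtain M vs d where M: "M \<subseteq> L" "lattice_basis vs M" "length vs = p_rank p b L"
    and d: "gram_det b vs = of_int d" "coprime d (int p)"
    using p_rank_witness[OF L_0, of p b] by blast
  define r where "r = length vs"
  have r: "r \<ge> 5" using M(3) rank by (simp add: r_def)
  have vs_L: "vs ! i \<in> L" if "i < r" for i
    using that M zspan_superset[of "set vs" "vs ! i"] by (auto simp: r_def lattice_basis_def)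
  define G where "G = Matrix.mat r r (\<lambda>(i, j). \<lfloor>b (vs ! i) (vs ! j)\<rfloor>)"
  \<comment> \<open>Row \<open>i\<close> of \<open>X\<close> lists the coordinates of
    \<open>vs ! i\<close> along \<open>e, f, e', f'\<close>, and \<open>Y\<close> lists the
    coordinates of the partner vectors. So \<open>X * Y\<close> is the contribution of the planes to
    the Gram matrix, padded with zeros to size \<open>r\<close>.\<close>
  define X where "X = Matrix.mat r r (\<lambda>(i, j). if j < 4 then \<lfloor>b (vs ! i) ([f, e, f', e'] ! j)\<rfloor> else 0)"
  define Y where "Y = Matrix.mat r r (\<lambda>(j, i). if j < 4 then \<lfloor>b (vs ! i) ([e, f, e', f'] ! j)\<rfloor> else 0)"
  have carrier: "G \<in> carrier_mat r r" "X \<in> carrier_mat r r" "Y \<in> carrier_mat r r"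
    by (simp_all add: G_def X_def Y_def)
  have G_entry: "of_int (G $$ (i, j)) = b (vs ! i) (vs ! j)" if "i < r" "j < r" for i j
    using that L_integral[OF vs_L[OF that(1)] vs_L[OF that(2)]] by (auto simp: G_def elim: Ints_cases)
  have "gram_det b vs = Determinant.det (map_mat of_int G)"
    unfolding gram_det_def r_def[symmetric]
    by (rule arg_cong[of _ _ Determinant.det], rule eq_matI) (use carrier in \<open>auto simp: G_entry\<close>)
  then have det_G: "d = Determinant.det G" using d(1) by simp
  \<comment> \<open>Counting from 0, column 4 is the first padding column; it exists because r is at
    least 5.\<close>
  have "X *\<^sub>v unit_vec r 4 = 0\<^sub>v r"
    using carrier r by (intro eq_vecI) (auto simp: X_def)
  moreover have "unit_vec r 4 \<noteq> (0\<^sub>v r :: int Matrix.vec)"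
    using r by (auto simp: vec_eq_iff unit_vec_def intro!: exI[of _ 4])
  ultimately have "Determinant.det X = 0"
    using det_0_iff_vec_prod_zero[OF carrier(2)] by (metis unit_vec_carrier)
  then have det_XY: "Determinant.det (X * Y) = 0"
    using det_mult[OF carrier(2,3)] by simp
  have "[G $$ (i, j) = (X * Y) $$ (i, j)] (mod int p)" if ij: "i < r" "j < r" for i j
  proof -
    obtain i1 i2 i3 i4 z where v:
      "vs ! i = of_int i1 *\<^sub>R e + of_int i2 *\<^sub>R f + of_int i3 *\<^sub>R e' + of_int i4 *\<^sub>R f' + z" and z: "z \<in> L\<^sub>0"
      using vs_L[OF ij(1)] unfolding L_eq by blast
    obtain j1 j2 j3 j4 z' where v':
      "vs ! j = of_int j1 *\<^sub>R e + of_int j2 *\<^sub>R f + of_int j3 *\<^sub>R e' + of_int j4 *\<^sub>R f' + z'" and z': "z' \<in> L\<^sub>0"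
      using vs_L[OF ij(2)] unfolding L_eq by blast
    obtain k where k: "b z z' = of_int k"
      using L_integral[OF L0_L[OF z] L0_L[OF z']] by (auto elim: Ints_cases)
    then have "int p dvd k" using neg z z' by blast
    have perp: "b z e = 0" "b z f = 0" "b z e' = 0" "b z f' = 0" "b z' e = 0" "b z' f = 0" "b z' e' = 0" "b z' f' = 0"
      using pairs_L0[OF z] pairs_L0[OF z']
      by (simp_all only: sym[of z e] sym[of z f] sym[of z e'] sym[of z f']
          sym[of z' e] sym[of z' f] sym[of z' e'] sym[of z' f'])
    have "(X * Y) $$ (i, j) = (\<Sum>l\<in>{0..<r}. X $$ (i, l) * Y $$ (l, j))"
      using ij carrier by (simp add: scalar_prod_def)
    also have "\<dots> = (\<Sum>l\<in>{0..<4}. X $$ (i, l) * Y $$ (l, j))"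
      using r ij by (intro sum.mono_neutral_right) (auto simp: X_def)
    also have "\<dots> = i1 * j2 + i2 * j1 + i3 * j4 + i4 * j3"
      using r ij by (simp add: X_def Y_def v v' perp pairs pairs_sym numeral_eq_Suc)
    finally have XY: "(X * Y) $$ (i, j) = i1 * j2 + i2 * j1 + i3 * j4 + i4 * j3" .
    have "real_of_int (G $$ (i, j)) = of_int (i1 * j2 + i2 * j1 + i3 * j4 + i4 * j3 + k)"
      unfolding G_entry[OF ij] v v'
      by (simp add: perp pairs pairs_sym pairs_L0[OF z] pairs_L0[OF z'] k)
    then have "G $$ (i, j) = (X * Y) $$ (i, j) + k" unfolding XY by (simp only: of_int_eq_iff)
    then show ?thesis using \<open>int p dvd k\<close> by (simp add: cong_iff_dvd_diff)
  qed
  then have "[Determinant.det G = 0] (mod int p)"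
    using det_cong[OF carrier(1), of "X * Y" "int p"] carrier det_XY by auto
  then have "int p dvd d" by (simp add: det_G cong_0_iff)
  then have "is_unit (int p)" using d(2) by (metis coprime_common_divisor dvd_refl)
  then show False using p by simp
qed

end

section \<open>Perfectness\<close>

text \<open>\<open>I\<close> is closed under gcds by Bezout, and a divisor of 12 prime to 2 and to 3
  is 1.\<close>

lemma odd_and_not_3_dvd_generate:
  fixes I :: "int set"
  assumes comb: "\<And>i j u v. i \<in> I \<Longrightarrow> j \<in> I \<Longrightarrow> u * i + v * j \<in> I"
    and "12 \<in> I" "m \<in> I" "\<not> 2 dvd m" "n \<in> I" "\<not> 3 dvd n"
  shows "1 \<in> I"
proof -
  define d where "d = gcd (gcd 12 m) n"
  have gcd_I: "gcd i j \<in> I" if "i \<in> I" "j \<in> I" for i j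
    using bezout_int[of i j] comb[OF that] by metis
  have d: "d dvd 12" "d dvd m" "d dvd n"
    unfolding d_def by (metis dvd_trans gcd_dvd1 gcd_dvd2)+
  have "d \<le> 12" "d > 0" using d(1) zdvd_imp_le[of d 12] by (auto simp: d_def)
  moreover have "\<not> 2 dvd d" "\<not> 3 dvd d" using d assms(4,6) dvd_trans by blast+
  moreover from calculation(1,2) have "d = 1 \<or> d = 2 \<or> d = 3 \<or> d = 4 \<or> d = 5 \<or> d = 6 \<or> d = 7 \<or> d = 8 \<or>
    d = 9 \<or> d = 10 \<or> d = 11 \<or> d = 12" by presburger
  ultimately have "d = 1" using d(1) by (elim disjE) simp_all
  moreover have "d \<in> I" unfolding d_def using assms by (intro gcd_I) auto
  ultimately show ?thesis by simp
qed

context two_hyperbolic_pairs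
begin

text \<open>The eight relabellings obtained by swapping the members of a plane and exchanging the
  planes. An argument for one direction \<open>c\<close> thereby covers all of \<open>C\<close>, and
  either member of the other plane may take the role of \<open>c'\<close>.\<close>

definition quadruple :: "real^'n \<Rightarrow> real^'n \<Rightarrow> real^'n \<Rightarrow> real^'n \<Rightarrow> bool" where
  "quadruple c d c' d' \<longleftrightarrow> (c, d, c', d') \<in>
     {(e, f, e', f'), (f, e, e', f'), (e, f, f', e'), (f, e, f', e'),
      (e', f', e, f), (f', e', e, f), (e', f', f, e), (f', e', f, e)}"

lemma quadruple_cases:
  "quadruple c d c' d' \<Longrightarrow>
    c = e \<and> d = f \<and> c' = e' \<and> d' = f' \<or> c = f \<and> d = e \<and> c' = e' \<and> d' = f' \<or>
    c = e \<and> d = f \<and> c' = f' \<and> d' = e' \<or> c = f \<and> d = e \<and> c' = f' \<and> d' = e' \<or>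
    c = e' \<and> d = f' \<and> c' = e \<and> d' = f \<or> c = f' \<and> d = e' \<and> c' = e \<and> d' = f \<or>
    c = e' \<and> d = f' \<and> c' = f \<and> d' = e \<or> c = f' \<and> d = e' \<and> c' = f \<and> d' = e"
  unfolding quadruple_def by simp

lemma quadruple_pairings:
  assumes "quadruple c d c' d'"
  shows "b c c = 0" "b d d = 0" "b c' c' = 0" "b d' d' = 0" "b c d = 1" "b d c = 1" "b c' d' = 1" "b d' c' = 1"
    "b c c' = 0" "b c' c = 0" "b c d' = 0" "b d' c = 0" "b d c' = 0" "b c' d = 0" "b d d' = 0" "b d' d = 0"
  using quadruple_cases[OF assms] by (elim disjE conjE; simp only: pairs pairs_sym)+

lemma quadruple_perp:
  assumes "quadruple c d c' d'" "b e z = 0" "b f z = 0" "b e' z = 0" "b f' z = 0"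
  shows "b c z = 0" "b d z = 0" "b c' z = 0" "b d' z = 0"
  using quadruple_cases[OF assms(1)] by (elim disjE conjE; simp only: assms(2-))+

lemma quadruple_C: "quadruple c d c' d' \<Longrightarrow> {c, d, c', d'} = C"
  by (drule quadruple_cases) (elim disjE conjE; auto)

lemma quadruple_swap: "quadruple c d c' d' \<Longrightarrow> quadruple c d d' c'"
  by (drule quadruple_cases) (elim disjE conjE; simp add: quadruple_def)

lemma quadruple_L:
  assumes "quadruple c d c' d'" "a \<in> L"
  shows "\<exists>i j k l z. a = of_int i *\<^sub>R c + of_int j *\<^sub>R d + of_int k *\<^sub>R c' + of_int l *\<^sub>R d' + z \<and> z \<in> L\<^sub>0"
proof -
  define T where "T c d c' d' \<longleftrightarrow> (\<exists>i j k l z. a = of_int i *\<^sub>R c + of_int j *\<^sub>R d + of_int k *\<^sub>R c' + of_int l *\<^sub>R d' + z \<and> z \<in> L\<^sub>0)"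
    for c d c' d'
  have TI: "T c d c' d'" if "a = of_int i *\<^sub>R c + of_int j *\<^sub>R d + of_int k *\<^sub>R c' + of_int l *\<^sub>R d' + z" "z \<in> L\<^sub>0"
    for c d c' d' i j k l z unfolding T_def using that by blast
  have base: "T e f e' f'" using assms(2) unfolding T_def L_eq by blast
  have s1: "T d c c' d'" and s2: "T c d d' c'" and s3: "T c' d' c d" if T: "T c d c' d'" for c d c' d'
  proof -
    obtain i j k l z where z: "a = of_int i *\<^sub>R c + of_int j *\<^sub>R d + of_int k *\<^sub>R c' + of_int l *\<^sub>R d' + z" "z \<in> L\<^sub>0"
      using T unfolding T_def by blast
    show "T d c c' d'" by (rule TI[of j _ i _ k _ l _ z]) (simp_all add: z)
    show "T c d d' c'" by (rule TI[of i _ j _ l _ k _ z]) (simp_all add: z)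
    show "T c' d' c d" by (rule TI[of k _ l _ i _ j _ z]) (simp_all add: z)
  qed
  note t = base s1[OF base] s2[OF base] s1[OF s2[OF base]]
  show ?thesis
    unfolding T_def[symmetric]
    using quadruple_cases[OF assms(1)]
    by (elim disjE conjE; simp only: t s3[OF t(1)] s3[OF t(2)] s3[OF t(3)] s3[OF t(4)]
        s1[OF s3[OF t(1)]] s2[OF s3[OF t(1)]] s1[OF s2[OF s3[OF t(1)]]])
qed

lemma transvection_E: "c \<in> C \<Longrightarrow> a \<in> L \<Longrightarrow> b c a = 0 \<Longrightarrow> transvection b c a \<in> E {}"
  by (rule transvection_in_group) auto

text \<open>Here \<open>u\<close> and \<open>v\<close> are the images of elementary matrices of \<open>SL\<^sub>2(\<int>)\<close>.\<close>

lemma braid_relations: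
  assumes q: "quadruple c d c' d'"
  defines "u \<equiv> transvection b c c'" and "v \<equiv> transvection b d d'"
  shows "u \<circ> v \<circ> u = v \<circ> (u \<circ> v)"
    and "(u \<circ> v \<circ> u) \<circ> (u \<circ> v \<circ> u) \<circ> ((u \<circ> v \<circ> u) \<circ> (u \<circ> v \<circ> u)) = id"
proof -
  note p = quadruple_pairings[OF q]
  have iso: "isometry b u" "isometry b v"
    unfolding u_def v_def using p by (auto intro: isometry_transvection)
  have lin: "linear u" "linear v" using iso by (auto simp: isometry_def)
  have u: "u c = c" "u d = d + c'" "u c' = c'" "u d' = d' - c"
    and v: "v c = c + d'" "v d = d" "v c' = c' - d" "v d' = d'"
    by (simp_all add: u_def v_def transvection_def p)
  note lin_simps = linear_add[OF lin(1)] linear_add[OF lin(2)] linear_diff[OF lin(1)] linear_diff[OF lin(2)]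
    linear_neg[OF lin(1)] linear_neg[OF lin(2)]
  show "u \<circ> v \<circ> u = v \<circ> (u \<circ> v)"
  proof
    fix x
    \<comment> \<open>The braid relation is a conjugation: \<open>u \<circ> v\<close> carries the
      pair \<open>(c, c')\<close> to \<open>(d', - d)\<close>, and the transvection of the latter
      pair is \<open>v\<close>.\<close>
    have "(u \<circ> v) (transvection b c c' x) = transvection b ((u \<circ> v) c) ((u \<circ> v) c') ((u \<circ> v) x)"
      by (rule transvection_conjugate[OF isometry_comp[OF iso]])
    also have "(u \<circ> v) c = d'" by (simp add: u v lin_simps)
    also have "(u \<circ> v) c' = - d" by (simp add: u v lin_simps)
    also have "transvection b d' (- d) y = v y" for y
      by (simp add: v_def transvection_def p)
    finally show "(u \<circ> v \<circ> u) x = (v \<circ> (u \<circ> v)) x" by (simp add: u_def)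
  qed
  \<comment> \<open>A quarter turn: its square is -1 on the planes, and it is the identity on the
    vectors \<open>\<xi> l\<close>, so its fourth power is 1.\<close>
  define r where "r = u \<circ> v \<circ> u"
  have r: "r c = d'" "r d' = - c" "r d = c'" "r c' = - d"
    by (simp_all add: r_def u v lin_simps)
  have lin_r: "linear r" unfolding r_def using lin by (intro linear_compose)
  have r\<xi>: "r (\<xi> l) = \<xi> l" if "l \<in> B\<^sub>0" for l
  proof -
    have perp: "b c (\<xi> l) = 0" "b d (\<xi> l) = 0" "b c' (\<xi> l) = 0" "b d' (\<xi> l) = 0"
      by (intro quadruple_perp[OF q] \<xi>_pairs that)+
    then have "u (\<xi> l) = \<xi> l" "v (\<xi> l) = \<xi> l"
      by (simp_all add: u_def v_def transvection_def)
    then show ?thesis by (simp add: r_def)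
  qed
  have "r \<circ> r \<circ> (r \<circ> r) = id"
  proof (rule linear_eqI)
    show "linear (r \<circ> r \<circ> (r \<circ> r))" using lin_r by (intro linear_compose)
    show "(r \<circ> r \<circ> (r \<circ> r)) x = id x" if "x \<in> C" for x
      using that unfolding quadruple_C[OF q, symmetric] by (auto simp: r linear_neg[OF lin_r])
  qed (simp_all add: r\<xi> linear_id)
  then show "(u \<circ> v \<circ> u) \<circ> (u \<circ> v \<circ> u) \<circ> ((u \<circ> v \<circ> u) \<circ> (u \<circ> v \<circ> u)) = id"
    by (simp only: r_def)
qed

text \<open>
  Conjugating \<open>transvection b c a\<close> by an element of the group fixing \<open>c\<close> shows that a homomorphism
  to an abelian group kills \<open>transvection b c (g a - a)\<close>.
\<close>

lemma hom_to_comm_group_trivial: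
  assumes Q: "comm_group Q" and \<phi>: "\<phi> \<in> hom (maps_group (E {})) Q"
    and p2: "\<exists>m\<in>L\<^sub>0. \<exists>n\<in>L\<^sub>0. \<exists>k::int. b m n = of_int k \<and> \<not> 2 dvd k"
    and p3: "\<exists>m\<in>L\<^sub>0. \<exists>n\<in>L\<^sub>0. \<exists>k::int. b m n = of_int k \<and> \<not> 3 dvd k"
    and g: "g \<in> E {}"
  shows "\<phi> g = \<one>\<^bsub>Q\<^esub>"
proof -
  interpret Q: comm_group Q by (rule Q)
  have closed: "\<phi> g \<in> carrier Q" if "g \<in> E {}" for g
    using \<phi> that by (auto simp: hom_def maps_group_def)
  have mult: "\<phi> (g \<circ> h) = \<phi> g \<otimes>\<^bsub>Q\<^esub> \<phi> h" if "g \<in> E {}" "h \<in> E {}" for g h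
    using \<phi> that by (auto simp: hom_def maps_group_def)
  have \<phi>_id: "\<phi> id = \<one>\<^bsub>Q\<^esub>"
    using mult[OF transvection_group.id transvection_group.id] closed[OF transvection_group.id] by simp
  have conj: "\<phi> s = \<phi> t" if "g \<in> E {}" "s \<in> E {}" "t \<in> E {}" "g \<circ> t = s \<circ> g" for g s t
  proof -
    have "\<phi> s \<otimes>\<^bsub>Q\<^esub> \<phi> g = \<phi> g \<otimes>\<^bsub>Q\<^esub> \<phi> t"
      using mult[OF that(1,3)] mult[OF that(2,1)] that(4) by simp
    also have "\<dots> = \<phi> t \<otimes>\<^bsub>Q\<^esub> \<phi> g"
      using closed that by (intro Q.m_comm)
    finally show ?thesis
      using Q.right_cancel[OF closed[OF that(1)] closed[OF that(2)] closed[OF that(3)]] by simp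
  qed
  have generator: "\<phi> (transvection b c a) = \<one>\<^bsub>Q\<^esub>"
    if q: "quadruple c d c' d'" and a: "a \<in> L" "b c a = 0" for c d c' d' a
  proof -
    note p = quadruple_pairings[OF q]
    have mem: "c \<in> C" "d \<in> C" "c' \<in> C" "d' \<in> C" using quadruple_C[OF q] by auto
    have perp0: "b c z = 0" "b d z = 0" "b c' z = 0" "b d' z = 0" if "z \<in> L\<^sub>0" for z
      by (intro quadruple_perp[OF q] pairs_L0 that)+
    \<comment> \<open>The vectors whose transvections along \<open>c\<close> are killed. Additivity
      in \<open>a\<close> makes this an additive group, and the aim is to show that it contains
      every lattice vector orthogonal to \<open>c\<close>.\<close>
    define A where "A = {a \<in> L. b c a = 0 \<and> \<phi> (transvection b c a) = \<one>\<^bsub>Q\<^esub>}"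
    have add: "\<phi> (transvection b c (x + y)) = \<phi> (transvection b c x) \<otimes>\<^bsub>Q\<^esub> \<phi> (transvection b c y)"
      if "x \<in> L" "y \<in> L" "b c x = 0" "b c y = 0" for x y
    proof -
      have "transvection b c (x + y) = transvection b c x \<circ> transvection b c y"
        using that p(1) by (auto simp: transvection_add)
      then show ?thesis using that mem(1) by (simp only:) (intro mult transvection_E)
    qed
    have A_diff: "x - y \<in> A" if "x \<in> A" "y \<in> A" for x y
    proof -
      have xy: "x \<in> L" "y \<in> L" "b c x = 0" "b c y = 0" "x - y \<in> L" "b c (x - y) = 0"
        using that L_diff by (auto simp: A_def)
      have "\<phi> (transvection b c x) = \<phi> (transvection b c (x - y)) \<otimes>\<^bsub>Q\<^esub> \<phi> (transvection b c y)"
        using add[OF xy(5,2,6,4)] by simp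
      then show ?thesis
        using that xy closed[OF transvection_E[OF mem(1) xy(5,6)]] by (simp add: A_def)
    qed
    have A_0: "0 \<in> A" by (simp add: A_def L_0 transvection_0 \<phi>_id[unfolded id_def] id_def)
    have A_scale: "of_int k *\<^sub>R x \<in> A" if "x \<in> A" for x k
      by (rule int_scale_closed[OF A_0 _ that]) (rule A_diff)
    have A_add: "x + y \<in> A" if "x \<in> A" "y \<in> A" for x y
      using A_diff[OF that(1) A_diff[OF A_0 that(2)]] by simp
    have A_move: "g x - x \<in> A" if g: "g \<in> E {}" "g c = c" and x: "x \<in> L" "b c x = 0" for g x
    proof -
      have gx: "g x \<in> L" using E_stable[OF g(1)] x(1) by (auto simp: stable_isometries_def)
      have iso: "isometry b g" by (rule E_isometry[OF g(1)])
      have cgx: "b c (g x) = 0"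
        using iso x(2) g(2) unfolding isometry_def by metis
      have "g \<circ> transvection b c x = transvection b c (g x) \<circ> g"
        using transvection_conjugate[OF iso, of c x] g(2) by auto
      from conj[OF g(1) transvection_E[OF mem(1) gx cgx] transvection_E[OF mem(1) x] this]
      have eq: "\<phi> (transvection b c (g x)) = \<phi> (transvection b c x)" .
      have gxx: "g x - x \<in> L" "b c (g x - x) = 0" using gx x cgx by (auto intro: L_diff)
      have "\<phi> (transvection b c (g x)) = \<phi> (transvection b c (g x - x)) \<otimes>\<^bsub>Q\<^esub> \<phi> (transvection b c x)"
        using add[OF gxx(1) x(1) gxx(2) x(2)] by simp
      then show ?thesis
        using eq gxx closed[OF transvection_E[OF mem(1) gxx]] closed[OF transvection_E[OF mem(1) x]]
        by (simp add: A_def)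
    qed
    have pair_A: "w \<in> A \<and> (\<forall>m\<in>L\<^sub>0. m - (b m m / 2) *\<^sub>R w \<in> A)" if w: "quadruple c d w w'" for w w'
    proof -
      note pw = quadruple_pairings[OF w]
      have memw: "w \<in> C" "w' \<in> C" using quadruple_C[OF w] by auto
      have wL: "w \<in> L" by (rule C_L[OF memw(1)])
      have perpw: "b w z = 0" "b w' z = 0" if "z \<in> L\<^sub>0" for z
        by (intro quadruple_perp[OF w] pairs_L0 that)+
      have t: "transvection b w m \<in> E {}" "transvection b w m c = c" if m: "m \<in> L\<^sub>0" for m
      proof -
        show "transvection b w m \<in> E {}" using m by (intro transvection_E memw L0_L perpw)
        show "transvection b w m c = c" using perp0(1)[OF m] sym[of m c] by (simp add: transvection_def pw)
      qed
      \<comment> \<open>The transvection along \<open>w\<close> by \<open>m\<close> fixes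
        \<open>c\<close> and moves \<open>n\<close> by - b m n times \<open>w\<close>.\<close>
      have form_values: "of_int k *\<^sub>R w \<in> A" if mn: "m \<in> L\<^sub>0" "n \<in> L\<^sub>0" "b m n = of_int k" for m n k
      proof -
        have "transvection b w m n - n \<in> A"
          by (rule A_move[OF t[OF mn(1)] L0_L[OF mn(2)] perp0(1)[OF mn(2)]])
        then have "0 - (transvection b w m n - n) \<in> A" by (rule A_diff[OF A_0])
        moreover have "0 - (transvection b w m n - n) = of_int k *\<^sub>R w"
          using perpw(1)[OF mn(2)] mn(3) by (simp add: transvection_def)
        ultimately show ?thesis by simp
      qed
      \<comment> \<open>The same transvection applied to the partner \<open>w'\<close> moves it by
        \<open>m\<close> minus half its norm times \<open>w\<close>; this brings the vectors of
        \<open>L\<^sub>0\<close> into reach.\<close>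
      have "transvection b w m w' - w' \<in> A" if m: "m \<in> L\<^sub>0" for m
        by (rule A_move[OF t[OF m] C_L[OF memw(2)] pw(11)])
      moreover have "transvection b w m w' - w' = m - (b m m / 2) *\<^sub>R w" if m: "m \<in> L\<^sub>0" for m
        using perpw(2)[OF m] sym[of m w'] by (simp add: transvection_def pw)
      ultimately have unipotent: "\<forall>m\<in>L\<^sub>0. m - (b m m / 2) *\<^sub>R w \<in> A" by simp
      define u where "u = transvection b c w"
      define v where "v = transvection b d w'"
      have uv: "u \<in> E {}" "v \<in> E {}"
        unfolding u_def v_def
        by (rule transvection_E[OF mem(1) C_L[OF memw(1)] pw(9)] transvection_E[OF mem(2) C_L[OF memw(2)] pw(15)])+
      note braid = braid_relations[OF w, folded u_def v_def]
      have uv': "u \<circ> v \<in> E {}" "u \<circ> v \<circ> u \<in> E {}"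
        by (intro transvection_group_comp uv)+
      \<comment> \<open>By the braid relation \<open>u \<circ> v\<close> conjugates \<open>u\<close>
        into \<open>v\<close>, so the word \<open>u \<circ> v \<circ> u\<close> has image the cube
        of that of \<open>u\<close>; its fourth power gives exponent 12.\<close>
      have "\<phi> v = \<phi> u" by (rule conj[OF uv'(1) uv(2,1) braid(1)])
      then have r: "\<phi> (u \<circ> v \<circ> u) = \<phi> u [^]\<^bsub>Q\<^esub> (3::nat)"
        using closed[OF uv(1)] by (simp only: mult[OF uv'(1) uv(1)] mult[OF uv]) (simp add: numeral_3_eq_3)
      have rr: "(u \<circ> v \<circ> u) \<circ> (u \<circ> v \<circ> u) \<in> E {}"
        by (intro transvection_group_comp uv)
      have "\<one>\<^bsub>Q\<^esub> = (\<phi> u [^]\<^bsub>Q\<^esub> (3::nat) \<otimes>\<^bsub>Q\<^esub> \<phi> u [^]\<^bsub>Q\<^esub> (3::nat)) \<otimes>\<^bsub>Q\<^esub>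
          (\<phi> u [^]\<^bsub>Q\<^esub> (3::nat) \<otimes>\<^bsub>Q\<^esub> \<phi> u [^]\<^bsub>Q\<^esub> (3::nat))"
        using arg_cong[OF braid(2), of \<phi>] by (simp only: mult[OF rr rr] mult[OF uv'(2) uv'(2)] r \<phi>_id)
      then have pow12: "\<phi> u [^]\<^bsub>Q\<^esub> (12::nat) = \<one>\<^bsub>Q\<^esub>"
        using closed[OF uv(1)] by (simp add: Q.nat_pow_mult)
      have pow: "\<phi> (transvection b c (real n *\<^sub>R w)) = \<phi> u [^]\<^bsub>Q\<^esub> n" for n :: nat
      proof (induction n)
        case 0
        show ?case by (simp only: of_nat_0 scaleR_zero_left transvection_0 \<phi>_id Q.nat_pow_0)
      next
        case (Suc n)
        have "real n *\<^sub>R w \<in> L" by (intro L_scale wL) auto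
        from add[OF this wL] have "\<phi> (transvection b c (real n *\<^sub>R w + w)) = \<phi> u [^]\<^bsub>Q\<^esub> Suc n"
          using pw Suc by (simp add: u_def)
        then show ?case by (simp add: scaleR_add_left add.commute)
      qed
      have "of_int 12 *\<^sub>R w \<in> L" by (intro L_scale wL) auto
      then have twelve: "of_int 12 *\<^sub>R w \<in> A"
        using pow[of 12] pow12 pw by (simp add: A_def)
      obtain m n k where mnk: "m \<in> L\<^sub>0" "n \<in> L\<^sub>0" "b m n = of_int k" "\<not> 2 dvd k" using p2 by blast
      obtain m' n' k' where mnk': "m' \<in> L\<^sub>0" "n' \<in> L\<^sub>0" "b m' n' = of_int k'" "\<not> 3 dvd k'" using p3 by blast
      \<comment> \<open>The integers \<open>k\<close> with \<open>k w\<close> in \<open>A\<close>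
        form an ideal. It contains 12, an odd value of the form and a value prime to 3.\<close>
      have "1 \<in> {k::int. of_int k *\<^sub>R w \<in> A}"
      proof (rule odd_and_not_3_dvd_generate[of _ k k'])
        show "x * i + y * j \<in> {k. of_int k *\<^sub>R w \<in> A}"
          if "i \<in> {k. of_int k *\<^sub>R w \<in> A}" "j \<in> {k. of_int k *\<^sub>R w \<in> A}" for i j x y
          using A_add[OF A_scale[of "of_int i *\<^sub>R w" x] A_scale[of "of_int j *\<^sub>R w" y]] that
          by (simp add: scaleR_add_left)
      qed (use twelve form_values[OF mnk(1-3)] form_values[OF mnk'(1-3)] mnk(4) mnk'(4) in auto)
      then show ?thesis using unipotent by simp
    qed
    have c'A: "c' \<in> A" and d'A: "d' \<in> A" and mA: "\<And>m. m \<in> L\<^sub>0 \<Longrightarrow> m - (b m m / 2) *\<^sub>R c' \<in> A"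
      using pair_A[OF q] pair_A[OF quadruple_swap[OF q]] by auto
    \<comment> \<open>Half the norm of \<open>m\<close> is an integer by evenness, so the correction
      by a multiple of \<open>c'\<close> can be undone inside \<open>A\<close>.\<close>
    have L0A: "m \<in> A" if m: "m \<in> L\<^sub>0" for m
    proof -
      obtain k :: int where k: "b m m / 2 = of_int k" using L_even[OF L0_L[OF m]] by (rule Ints_cases)
      show ?thesis using A_add[OF mA[OF m] A_scale[OF c'A, of k]] unfolding k by simp
    qed
    have cA: "of_int i *\<^sub>R c \<in> A" for i
      using p(1) C_L[OF mem(1)]
      by (simp add: A_def L_scale transvection_multiple_self \<phi>_id)
    obtain i j k l z where az: "a = of_int i *\<^sub>R c + of_int j *\<^sub>R d + of_int k *\<^sub>R c' + of_int l *\<^sub>R d' + z" "z \<in> L\<^sub>0"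
      using quadruple_L[OF q a(1)] by (elim exE conjE) (rule that)
    have "b c a = of_int j" using perp0(1)[OF az(2)] unfolding az(1) by (simp add: p)
    then have "j = 0" using a(2) by simp
    have "of_int i *\<^sub>R c + of_int k *\<^sub>R c' + of_int l *\<^sub>R d' + z \<in> A"
      by (intro A_add cA A_scale c'A d'A L0A az(2))
    then have "a \<in> A" unfolding az(1) \<open>j = 0\<close> by simp
    then show ?thesis by (simp add: A_def)
  qed
  show ?thesis
    using g
  proof induction
    case (step g c a)
    have "quadruple e f e' f'" "quadruple f e e' f'" "quadruple e' f' e f" "quadruple f' e' e f"
      by (simp_all add: quadruple_def)
    note this[THEN generator, OF step(3)]
    then have "\<phi> (transvection b c a) = \<one>\<^bsub>Q\<^esub>"
      using step(2,4) by (elim insertE emptyE; simp only:)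
    then show ?case
      unfolding mult[OF transvection_E[OF step(2,3,4)] step(1)] step.IH by simp
  qed (rule \<phi>_id)
qed

end

section \<open>The stable orthogonal groups\<close>

lemma maps_group_simps [simp]:
  "carrier (maps_group S) = S" "x \<otimes>\<^bsub>maps_group S\<^esub> y = x \<circ> y" "\<one>\<^bsub>maps_group S\<^esub> = id"
  by (simp_all add: maps_group_def)

lemma group_maps_group:
  assumes "id \<in> S" "\<And>g h. g \<in> S \<Longrightarrow> h \<in> S \<Longrightarrow> g \<circ> h \<in> S"
    and "\<And>g. g \<in> S \<Longrightarrow> \<exists>h\<in>S. h \<circ> g = id"
  shows "group (maps_group S)"
proof (rule groupI)
  show "\<exists>y\<in>carrier (maps_group S). y \<otimes>\<^bsub>maps_group S\<^esub> x = \<one>\<^bsub>maps_group S\<^esub>"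
    if "x \<in> carrier (maps_group S)" for x
    using assms(3) that by simp
qed (use assms(1,2) in \<open>simp_all add: comp_assoc\<close>)

lemma (in group) r_coset_derived_hom:
  "(\<lambda>g. derived G (carrier G) #> g) \<in> hom G (G Mod derived G (carrier G))"
proof -
  have "carrier G \<lhd> G" by (rule normal_invI[OF subgroup_self]) auto
  then interpret normal "derived G (carrier G)" G by (rule derived_is_normal)
  show ?thesis by (rule r_coset_hom_Mod)
qed

lemma trivial_abelianisation:
  assumes G: "group G"
    and trivial: "\<And>g. g \<in> carrier G \<Longrightarrow> derived G (carrier G) #>\<^bsub>G\<^esub> g = derived G (carrier G)"
  shows "trivial_group (abelianisation G)"
proof -
  interpret group G by (rule G)
  interpret Q: comm_group "G Mod derived G (carrier G)" by (rule derived_quot_is_comm_group)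
  have "carrier (G Mod derived G (carrier G)) \<subseteq> {\<one>\<^bsub>G Mod derived G (carrier G)\<^esub>}"
    using trivial by (auto simp: FactGroup_def RCOSETS_def)
  then show ?thesis
    unfolding abelianisation_def Q.trivial_group_subset .
qed

text \<open>The derived subgroup lies in the kernel because \<open>H\<close> is commutative, so with
  the assumed inclusion the two coincide and the first isomorphism theorem applies.\<close>

lemma abelianisation_iso:
  assumes G: "group G" and H: "comm_group H" and h: "h \<in> hom G H" "h ` carrier G = carrier H"
    and kernel: "kernel G H h \<subseteq> derived G (carrier G)"
  shows "abelianisation G \<cong> H"
proof -
  interpret H: comm_group H by (rule H)
  interpret h: group_hom G H h
    using G h(1) H.is_group by (simp add: group_hom_def group_hom_axioms_def)
  have "h ` derived G (carrier G) = {\<one>\<^bsub>H\<^esub>}"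
    using h.derived_img[of "carrier G"] H.derived_eq_singleton[of "carrier H"] h(2) by simp
  moreover have "derived G (carrier G) \<subseteq> carrier G"
    using h.G.derived_in_carrier by simp
  ultimately have "derived G (carrier G) \<subseteq> kernel G H h"
    by (auto simp: kernel_def)
  then have "kernel G H h = derived G (carrier G)" using kernel by simp
  then show ?thesis
    using h.FactGroup_iso[OF h(2)] by (simp add: abelianisation_def)
qed

context two_hyperbolic_pairs
begin

section \<open>Identification of the stable groups by determinant and spinor norm\<close>

lemma stable_orth_eq: "stable_orth b L = stable_isometries b L"
proof -
  define D where "D = carrier (disc_group b L)"
  have D: "D = {(\<lambda>l. l + x) ` L | x. x \<in> dual_lattice b L}"
    by (auto simp: D_def disc_group_def FactGroup_def RCOSETS_def r_coset_def add_group_def)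
  have "(\<forall>X\<in>D. g ` X = X) \<longleftrightarrow> (\<forall>v\<in>dual_lattice b L. g v - v \<in> L)"
    if g: "linear g" "g ` L = L" for g
  proof (intro iffI ballI)
    fix v assume fix_D: "\<forall>X\<in>D. g ` X = X" and v: "v \<in> dual_lattice b L"
    have "v \<in> (\<lambda>l. l + v) ` L" using L_0 by (intro image_eqI[of _ _ 0]) auto
    then have "g v \<in> g ` (\<lambda>l. l + v) ` L" by (rule imageI)
    also have "\<dots> = (\<lambda>l. l + v) ` L" using fix_D v D by blast
    finally show "g v - v \<in> L" by auto
  next
    fix X assume stable: "\<forall>v\<in>dual_lattice b L. g v - v \<in> L" and "X \<in> D"
    then obtain v where v: "v \<in> dual_lattice b L" "X = (\<lambda>l. l + v) ` L" unfolding D by blast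
    have gv: "g v - v \<in> L" using stable v(1) by blast
    have "g ` X = (\<lambda>l. g l + g v) ` L" using v(2) by (simp add: image_image linear_add[OF g(1)])
    also have "\<dots> = (\<lambda>l. l + g v) ` g ` L" by (simp add: image_image)
    also have "\<dots> = (\<lambda>l. l + g v) ` L" by (simp only: g(2))
    also have "\<dots> = (\<lambda>l. l + v) ` L"
    proof (intro equalityI subsetI; elim imageE; simp only:)
      fix l assume "l \<in> L"
      show "l + g v \<in> (\<lambda>l. l + v) ` L"
        by (rule image_eqI[of _ _ "l + (g v - v)"]) (simp_all add: L_add \<open>l \<in> L\<close> gv)
      show "l + v \<in> (\<lambda>l. l + g v) ` L"
        by (rule image_eqI[of _ _ "l - (g v - v)"]) (simp_all only: L_diff \<open>l \<in> L\<close> gv, simp)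
    qed
    finally show "g ` X = X" by (simp only: v(2))
  qed
  \<comment> \<open>Both maps are restricted to the carrier with the same default value outside, so
    their equality says exactly that every coset is fixed.\<close>
  moreover have "(disc_action b L g = \<one>\<^bsub>disc_orth_group b L\<^esub>) \<longleftrightarrow> (\<forall>X\<in>D. g ` X = X)" for g
    by (auto simp: disc_action_def disc_orth_group_def AutoGroup_def BijGroup_def D_def
        restrict_def fun_eq_iff)
  ultimately show ?thesis
    by (auto simp: stable_orth_def kernel_def orth_def orth_real_iff stable_isometries_def isometry_def)
qed

text \<open>The swap of \<open>e'\<close> and \<open>f'\<close>. Its mirror vector has norm -2,
  hence spinor factor +1 in the sign convention used here, whereas \<open>e' + f'\<close> has norm 2
  and factor -1.\<close>

definition \<sigma> :: "real^'n \<Rightarrow> real^'n" where "\<sigma> = reflection_word b [e' - f']"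

lemma \<sigma>_word: "\<forall>v\<in>set [e' - f']. b v v \<noteq> 0" "(\<Prod>v\<leftarrow>[e' - f']. - (b v v / 2)) = 1"
  using pairs pairs_sym by simp_all

lemma \<sigma>_involution: "\<sigma> \<circ> \<sigma> = id"
  using reflection_involution[of "e' - f'"] anisotropic_pair(1)
  by (auto simp: \<sigma>_def simp del: form_simps)

lemma \<sigma>_stable: "\<sigma> \<in> stable_isometries b L"
proof -
  have v: "e' - f' \<in> L" using C_L by (intro L_diff) auto
  have \<sigma>: "\<sigma> x = x + b x (e' - f') *\<^sub>R (e' - f')" for x
    unfolding \<sigma>_def reflection_word_simps o_def id_def reflection_def anisotropic_pair(1) by simp
  have maps: "\<sigma> x \<in> L" if "x \<in> L" for x
    unfolding \<sigma> by (intro L_add L_scale L_integral v that)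
  have "\<sigma> (\<sigma> x) = x" for x using \<sigma>_involution by (metis comp_apply id_apply)
  then have "\<sigma> ` L = L" using maps by (metis image_subset_iff imageI subsetI subset_antisym)
  moreover have "\<sigma> x - x \<in> L" if "x \<in> dual_lattice b L" for x
  proof -
    have "b x (e' - f') \<in> \<int>" using that v by (simp only: dual_lattice_def mem_Collect_eq)
    then show ?thesis unfolding \<sigma> by (simp only: add_diff_cancel_left' L_scale v)
  qed
  moreover have "isometry b \<sigma>"
    unfolding \<sigma>_def by (rule isometry_reflection_word[OF \<sigma>_word(1)])
  ultimately show ?thesis by (simp add: stable_isometries_def)
qed

lemma stable_orth: "g \<in> stable_isometries b L \<Longrightarrow> g \<in> orth b L"
  by (simp add: stable_isometries_def orth_def orth_real_iff)

lemma det_E: "g \<in> E X \<Longrightarrow> Determinants.det (matrix g) = 1"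
  by (erule E_reflection_word) (simp only: det_reflection_word, simp)

lemma det_E_\<sigma>: "g \<in> E X \<Longrightarrow> Determinants.det (matrix (g \<circ> \<sigma>)) = - 1"
proof -
  assume g: "g \<in> E X"
  have l: "linear g" "linear \<sigma>"
    using E_isometry[OF g] \<sigma>_stable by (auto simp: isometry_def stable_isometries_def)
  have "Determinants.det (matrix \<sigma>) = - 1"
    unfolding \<sigma>_def using det_reflection_word[OF \<sigma>_word(1)] by simp
  then show ?thesis using det_comp[OF l] det_E[OF g] by (simp del: o_apply)
qed

text \<open>The factors +1 of \<open>e' - f'\<close> and -1 of \<open>e' + f'\<close> leave only the
  identity and \<open>\<sigma>\<close> among the four representatives; elements of
  \<open>E {}\<close> have positive product and do not affect the sign.\<close>

lemma stable_orth_plus_iff: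
  "g \<in> stable_orth_plus b L \<longleftrightarrow> g \<in> E {} \<or> (\<exists>h\<in>E {}. g = h \<circ> \<sigma>)"
proof -
  have E_word: "h \<circ> reflection_word b vs \<in> orth_plus b L \<longleftrightarrow>
      h \<circ> reflection_word b vs \<in> orth b L \<and> (\<Prod>v\<leftarrow>vs. - (b v v / 2)) > 0"
    if h: "h \<in> E {}" and vs: "\<forall>v\<in>set vs. b v v \<noteq> 0" for h vs
  proof -
    obtain us where us: "\<forall>v\<in>set us. b v v \<noteq> 0" "h = reflection_word b us"
      "(\<Prod>v\<leftarrow>us. - (b v v / 2)) > 0"
      by (rule E_reflection_word[OF h])
    have "\<forall>v\<in>set (us @ vs). b v v \<noteq> 0" using us(1) vs by auto
    from reflection_word_in_orth_plus_iff[OF this] show ?thesis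
      using us(3) by (simp only: us(2) reflection_word_append map_append prod_list.append zero_less_mult_iff) auto
  qed
  show ?thesis
  proof
    assume g: "g \<in> stable_orth_plus b L"
    then have g_stable: "g \<in> stable_isometries b L" and g_plus: "g \<in> orth_plus b L"
      by (simp_all add: stable_orth_plus_def stable_orth_eq)
    obtain k vs where k: "k \<in> E {}" "k \<circ> g = reflection_word b vs"
      and vs: "vs \<in> {[], [e' - f'], [e' + f'], [e' - f', e' + f']}"
      using stable_reduction[OF g_stable] by blast
    obtain h where h: "h \<in> E {}" "h \<circ> k = id" by (rule E_inverse[OF k(1)])
    have "h \<circ> reflection_word b vs = (h \<circ> k) \<circ> g" by (simp only: k(2)[symmetric] comp_assoc)
    then have g_eq: "g = h \<circ> reflection_word b vs" by (simp only: h(2) id_comp)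
    have nz: "\<forall>v\<in>set vs. b v v \<noteq> 0"
      using vs by (elim insertE emptyE; simp only: list.set ball_simps anisotropic_pair; simp)
    have "(\<Prod>v\<leftarrow>vs. - (b v v / 2)) > 0"
      using g_plus E_word[OF h(1) nz] unfolding g_eq by blast
    then have "vs = [] \<or> vs = [e' - f']"
      using vs by (elim insertE emptyE; simp only: list.map prod_list.Cons prod_list.Nil anisotropic_pair; simp)
    then show "g \<in> E {} \<or> (\<exists>h\<in>E {}. g = h \<circ> \<sigma>)"
    proof
      assume "vs = []"
      then have "g = h" using g_eq by (simp only: reflection_word_simps comp_id)
      then show ?thesis using h(1) by simp
    next
      assume "vs = [e' - f']"
      then have "g = h \<circ> \<sigma>" using g_eq by (simp only: \<sigma>_def)
      then show ?thesis using h(1) by blast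
    qed
  next
    assume "g \<in> E {} \<or> (\<exists>h\<in>E {}. g = h \<circ> \<sigma>)"
    then show "g \<in> stable_orth_plus b L"
    proof
      assume g: "g \<in> E {}"
      then have "g \<circ> reflection_word b [] \<in> orth_plus b L"
        by (subst E_word) (simp_all add: E_stable stable_orth)
      then show ?thesis using E_stable[OF g] by (simp add: stable_orth_plus_def stable_orth_eq)
    next
      assume "\<exists>h\<in>E {}. g = h \<circ> \<sigma>"
      then obtain h where h: "h \<in> E {}" "g = h \<circ> \<sigma>" by blast
      have stable: "g \<in> stable_isometries b L" unfolding h(2) by (rule stable_comp[OF E_stable[OF h(1)] \<sigma>_stable])
      have "g \<in> orth_plus b L"
        using E_word[OF h(1) \<sigma>_word(1)] stable_orth[OF stable] unfolding h(2) \<sigma>_word(2) \<sigma>_def[symmetric] by simp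
      then show ?thesis using stable by (simp add: stable_orth_plus_def stable_orth_eq)
    qed
  qed
qed

lemma E_stable_orth_plus: "g \<in> E {} \<Longrightarrow> g \<in> stable_orth_plus b L"
  unfolding stable_orth_plus_iff by (rule disjI1)

lemma E_\<sigma>_stable_orth_plus: "h \<in> E {} \<Longrightarrow> g = h \<circ> \<sigma> \<Longrightarrow> g \<in> stable_orth_plus b L"
  unfolding stable_orth_plus_iff by (intro disjI2 bexI)

lemma stable_special_orth_plus_eq: "stable_special_orth_plus b L = E {}"
proof (intro equalityI subsetI)
  fix g assume "g \<in> stable_special_orth_plus b L"
  then have g: "g \<in> stable_orth_plus b L" "Determinants.det (matrix g) = 1"
    by (auto simp: stable_special_orth_plus_def special_orth_def)
  then show "g \<in> E {}" unfolding stable_orth_plus_iff using det_E_\<sigma> by fastforce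
next
  fix g assume g: "g \<in> E {}"
  then have "g \<in> stable_orth_plus b L" by (simp add: stable_orth_plus_iff)
  then show "g \<in> stable_special_orth_plus b L"
    using stable_orth[OF E_stable[OF g]] det_E[OF g]
    by (simp add: stable_special_orth_plus_def special_orth_def)
qed

lemma group_E: "group (maps_group (E {}))"
proof (rule group_maps_group)
  show "\<exists>h\<in>E {}. h \<circ> g = id" if "g \<in> E {}" for g using E_inverse[OF that] by metis
qed (rule transvection_group.id, rule transvection_group_comp)

text \<open>Normality of \<open>E {}\<close> is read off from invariants: the product is stable with
  positive spinor norm, and its determinant -1 places it in the coset of
  \<open>\<sigma>\<close>.\<close>

lemma \<sigma>_conjugate_E:
  assumes "g \<in> E {}"
  shows "\<exists>h\<in>E {}. \<sigma> \<circ> g = h \<circ> \<sigma>"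
proof -
  have g: "g \<in> stable_isometries b L" by (rule E_stable[OF assms])
  obtain us where us: "\<forall>v\<in>set us. b v v \<noteq> 0" "g = reflection_word b us"
    "(\<Prod>v\<leftarrow>us. - (b v v / 2)) > 0"
    by (rule E_reflection_word[OF assms])
  have word: "\<sigma> \<circ> g = reflection_word b ([e' - f'] @ us)"
    by (simp only: reflection_word_append \<sigma>_def us(2))
  have nz: "\<forall>v\<in>set ([e' - f'] @ us). b v v \<noteq> 0"
    unfolding set_append using \<sigma>_word(1) us(1) by blast
  have stable: "\<sigma> \<circ> g \<in> stable_isometries b L" by (rule stable_comp[OF \<sigma>_stable g])
  have "\<sigma> \<circ> g \<in> orth_plus b L"
    unfolding word reflection_word_in_orth_plus_iff[OF nz] map_append prod_list.append \<sigma>_word(2)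
    unfolding word[symmetric] using stable_orth[OF stable] us(3) by simp
  then have "\<sigma> \<circ> g \<in> stable_orth_plus b L" using stable by (simp add: stable_orth_plus_def stable_orth_eq)
  moreover have "\<sigma> \<circ> g \<notin> E {}"
  proof
    assume "\<sigma> \<circ> g \<in> E {}"
    then have "Determinants.det (matrix (\<sigma> \<circ> g)) = 1" by (rule det_E)
    moreover have "Determinants.det (matrix (\<sigma> \<circ> g)) = Determinants.det (matrix (g \<circ> \<sigma>))"
    proof -
      have l: "linear g" "linear \<sigma>"
        using g \<sigma>_stable by (auto simp: isometry_def stable_isometries_def)
      show ?thesis unfolding det_comp[OF l] det_comp[OF l(2,1)] by (rule mult.commute)
    qed
    ultimately show False using det_E_\<sigma>[OF assms] by simp
  qed
  ultimately show ?thesis unfolding stable_orth_plus_iff by blast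
qed

lemma group_stable_orth_plus: "group (maps_group (stable_orth_plus b L))"
proof (rule group_maps_group)
  show "id \<in> stable_orth_plus b L"
    unfolding stable_orth_plus_iff by (rule disjI1) (rule transvection_group.id)
  note E_comp = transvection_group_comp[of _ b L C "{}"]
  have \<sigma>_E: "\<sigma> \<circ> g \<in> stable_orth_plus b L" if "g \<in> stable_orth_plus b L" for g
  proof -
    consider "g \<in> E {}" | h where "h \<in> E {}" "g = h \<circ> \<sigma>"
      using \<open>g \<in> stable_orth_plus b L\<close> unfolding stable_orth_plus_iff by blast
    then show ?thesis
    proof cases
      case 1
      from \<sigma>_conjugate_E[OF this] obtain k where "k \<in> E {}" "\<sigma> \<circ> g = k \<circ> \<sigma>" ..
      then show ?thesis by (rule E_\<sigma>_stable_orth_plus)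
    next
      case 2
      obtain k where k: "k \<in> E {}" "\<sigma> \<circ> h = k \<circ> \<sigma>" using \<sigma>_conjugate_E[OF 2(1)] by blast
      have "\<sigma> \<circ> g = (\<sigma> \<circ> h) \<circ> \<sigma>" by (simp only: 2(2) comp_assoc)
      also have "\<dots> = k" by (simp only: k(2) comp_assoc \<sigma>_involution comp_id)
      finally show ?thesis using E_stable_orth_plus[OF k(1)] by (simp only:)
    qed
  qed
  have E_O: "h \<circ> g \<in> stable_orth_plus b L" if "h \<in> E {}" "g \<in> stable_orth_plus b L" for g h
  proof -
    consider "g \<in> E {}" | k where "k \<in> E {}" "g = k \<circ> \<sigma>"
      using \<open>g \<in> stable_orth_plus b L\<close> unfolding stable_orth_plus_iff by blast
    then show ?thesis
    proof cases
      case 1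
      then show ?thesis by (intro E_stable_orth_plus E_comp that(1))
    next
      case 2
      have "h \<circ> g = (h \<circ> k) \<circ> \<sigma>" by (simp only: 2(2) comp_assoc)
      with E_comp[OF that(1) 2(1)] show ?thesis by (rule E_\<sigma>_stable_orth_plus)
    qed
  qed
  show "g \<circ> h \<in> stable_orth_plus b L" if gh: "g \<in> stable_orth_plus b L" "h \<in> stable_orth_plus b L" for g h
  proof -
    consider "g \<in> E {}" | k where "k \<in> E {}" "g = k \<circ> \<sigma>"
      using gh(1) unfolding stable_orth_plus_iff by blast
    then show ?thesis
    proof cases
      case 1
      then show ?thesis using gh(2) by (rule E_O)
    next
      case 2
      have "g \<circ> h = k \<circ> (\<sigma> \<circ> h)" by (simp only: 2(2) comp_assoc)
      then show ?thesis using E_O[OF 2(1) \<sigma>_E[OF gh(2)]] by (simp only:)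
    qed
  qed
  show "\<exists>h\<in>stable_orth_plus b L. h \<circ> g = id" if g: "g \<in> stable_orth_plus b L" for g
  proof -
    consider "g \<in> E {}" | k where "k \<in> E {}" "g = k \<circ> \<sigma>"
      using g unfolding stable_orth_plus_iff by blast
    then show ?thesis
    proof cases
      case 1
      then obtain h where h: "h \<in> E {}" "h \<circ> g = id" by (rule E_inverse)
      show ?thesis by (intro bexI[of _ h] h(2) E_stable_orth_plus h(1))
    next
      case 2
      obtain h where h: "h \<in> E {}" "h \<circ> k = id" by (rule E_inverse[OF 2(1)])
      have "(\<sigma> \<circ> h) \<circ> g = \<sigma> \<circ> ((h \<circ> k) \<circ> \<sigma>)" by (simp only: 2(2) comp_assoc)
      also have "\<dots> = id" by (simp only: h(2) id_comp \<sigma>_involution)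
      finally have inverse: "(\<sigma> \<circ> h) \<circ> g = id" .
      show ?thesis by (intro bexI[of _ "\<sigma> \<circ> h"] inverse \<sigma>_E E_stable_orth_plus h(1))
    qed
  qed
qed

lemma abelianisation_stable_groups:
  assumes p2: "\<exists>m\<in>L\<^sub>0. \<exists>n\<in>L\<^sub>0. \<exists>k::int. b m n = of_int k \<and> \<not> 2 dvd k"
    and p3: "\<exists>m\<in>L\<^sub>0. \<exists>n\<in>L\<^sub>0. \<exists>k::int. b m n = of_int k \<and> \<not> 3 dvd k"
  shows "trivial_group (abelianisation (maps_group (stable_special_orth_plus b L)))"
    and "abelianisation (maps_group (stable_orth_plus b L)) \<cong> integer_mod_group 2"
proof -
  note perfect = hom_to_comm_group_trivial[OF _ _ p2 p3]
  show "trivial_group (abelianisation (maps_group (stable_special_orth_plus b L)))"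
    unfolding stable_special_orth_plus_eq
  proof (rule trivial_abelianisation[OF group_E])
    fix g assume "g \<in> carrier (maps_group (E {}))"
    then have "g \<in> E {}" by simp
    from perfect[OF group.derived_quot_is_comm_group[OF group_E] group.r_coset_derived_hom[OF group_E] this]
    show "derived (maps_group (E {})) (carrier (maps_group (E {}))) #>\<^bsub>maps_group (E {})\<^esub> g =
      derived (maps_group (E {})) (carrier (maps_group (E {})))"
      by (simp add: FactGroup_def)
  qed
  let ?O = "maps_group (stable_orth_plus b L)"
  interpret O: group ?O by (rule group_stable_orth_plus)
  \<comment> \<open>The determinant, written additively with values in the integers modulo
    2.\<close>
  define h where "h g = (if Determinants.det (matrix g) = 1 then 0 else 1 :: int)" for g :: "real^'n \<Rightarrow> real^'n"
  have det: "Determinants.det (matrix g) = 1 \<or> Determinants.det (matrix g) = - 1" and lin: "linear g"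
    if "g \<in> stable_orth_plus b L" for g
  proof -
    show "Determinants.det (matrix g) = 1 \<or> Determinants.det (matrix g) = - 1"
      using that det_E det_E_\<sigma> unfolding stable_orth_plus_iff by blast
    show "linear g"
      using that by (simp add: stable_orth_plus_def stable_orth_eq stable_isometries_def isometry_def)
  qed
  have h_E: "h g = 0 \<longleftrightarrow> g \<in> E {}" if "g \<in> stable_orth_plus b L" for g
    using that det_E[of g "{}"] det_E_\<sigma> unfolding stable_orth_plus_iff h_def by fastforce
  show "abelianisation ?O \<cong> integer_mod_group 2"
  proof (rule abelianisation_iso[OF group_stable_orth_plus, where h = h])
    show "h \<in> hom ?O (integer_mod_group 2)"
    proof (rule homI)
      show "h x \<in> carrier (integer_mod_group 2)" for x
        by (simp add: h_def carrier_integer_mod_group)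
      fix x y assume "x \<in> carrier ?O" "y \<in> carrier ?O"
      then have xy: "x \<in> stable_orth_plus b L" "y \<in> stable_orth_plus b L" by simp_all
      have "Determinants.det (matrix (x \<circ> y)) = Determinants.det (matrix x) * Determinants.det (matrix y)"
        by (rule det_comp[OF lin[OF xy(1)] lin[OF xy(2)]])
      then have "h (x \<circ> y) = (h x + h y) mod 2"
        using det[OF xy(1)] det[OF xy(2)] by (auto simp: h_def simp del: o_apply)
      then show "h (x \<otimes>\<^bsub>?O\<^esub> y) = h x \<otimes>\<^bsub>integer_mod_group 2\<^esub> h y" by (simp del: o_apply)
    qed
    have "id \<in> stable_orth_plus b L" "\<sigma> \<in> stable_orth_plus b L"
      unfolding stable_orth_plus_iff using transvection_group.id[of b L C "{}"] id_comp[of \<sigma>, symmetric] by blast+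
    moreover have "h id = 0" "h \<sigma> = 1"
      using det_E[OF transvection_group.id[of b L C "{}"]] det_E_\<sigma>[OF transvection_group.id[of b L C "{}"]]
      by (simp_all only: h_def id_comp) simp_all
    ultimately have "{0, 1} \<subseteq> h ` stable_orth_plus b L" by (metis empty_subsetI imageI insert_subset)
    moreover have "h ` stable_orth_plus b L \<subseteq> {0, 1}" by (auto simp: h_def)
    ultimately have "h ` stable_orth_plus b L = {0, 1}" by (rule subset_antisym[rotated])
    moreover have "{0..<int 2} = {0, 1}" by auto
    ultimately show "h ` carrier ?O = carrier (integer_mod_group 2)"
      by (simp add: carrier_integer_mod_group)
    show "kernel ?O (integer_mod_group 2) h \<subseteq> derived ?O (carrier ?O)"
    proof
      fix g assume "g \<in> kernel ?O (integer_mod_group 2) h"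
      then have g: "g \<in> stable_orth_plus b L" "g \<in> E {}" using h_E by (auto simp: kernel_def)
      have E_O: "E {} \<subseteq> stable_orth_plus b L" by (auto simp: stable_orth_plus_iff)
      \<comment> \<open>The projection of the larger group onto its abelianisation is restricted to
        \<open>E {}\<close>. Perfectness makes it trivial there, so the kernel of \<open>h\<close>
        lies in the derived subgroup.\<close>
      have "(\<lambda>g. derived ?O (carrier ?O) #>\<^bsub>?O\<^esub> g) \<in> hom (maps_group (E {})) (?O Mod derived ?O (carrier ?O))"
        using O.r_coset_derived_hom E_O by (simp add: hom_def Pi_def subset_iff del: o_apply)
      from perfect[OF O.derived_quot_is_comm_group this g(2)]
      have "derived ?O (carrier ?O) #>\<^bsub>?O\<^esub> g = derived ?O (carrier ?O)"
        by (simp add: FactGroup_def)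
      then show "g \<in> derived ?O (carrier ?O)"
        by (rule O.coset_join1) (simp_all add: g(1) O.derived_is_subgroup)
    qed
  qed simp
qed

end

section \<open>From the hypotheses of the theorem to the two hyperbolic pairs\<close>

lemma zspan_pair: "e \<noteq> f \<Longrightarrow> zspan {e, f} = {of_int i *\<^sub>R e + of_int j *\<^sub>R f | i j. True}"
proof (intro equalityI subsetI)
  fix x assume "e \<noteq> f" "x \<in> {of_int i *\<^sub>R e + of_int j *\<^sub>R f | i j. True}"
  then obtain i j where "x = of_int i *\<^sub>R e + of_int j *\<^sub>R f" by blast
  then have "x = (\<Sum>v\<in>{e, f}. of_int (if v = e then i else j) *\<^sub>R v)" using \<open>e \<noteq> f\<close> by simp
  then show "x \<in> zspan {e, f}" using zspanI[of "\<lambda>v. if v = e then i else j" "{e, f}"] by simp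
next
  fix x assume "e \<noteq> f" "x \<in> zspan {e, f}"
  then obtain c where "x = (\<Sum>v\<in>{e, f}. of_int (c v) *\<^sub>R v)" by (elim zspanE)
  then have "x = of_int (c e) *\<^sub>R e + of_int (c f) *\<^sub>R f" using \<open>e \<noteq> f\<close> by simp
  then show "x \<in> {of_int i *\<^sub>R e + of_int j *\<^sub>R f | i j. True}" by (intro CollectI exI conjI TrueI)
qed

lemma two_hyperbolic_pairs_exist:
  fixes b :: "real^'n \<Rightarrow> real^'n \<Rightarrow> real"
  assumes "bilinear b" "\<And>x y. b x y = b y x" and even: "even_integral_lattice b L"
    and span: "span L = UNIV" and planes: "two_hyperbolic_planes b L"
  shows "\<exists>L\<^sub>0 B\<^sub>0 \<xi> e f e' f'. two_hyperbolic_pairs b L L\<^sub>0 B\<^sub>0 \<xi> e f e' f'"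
proof -
  interpret symmetric_form b by (rule symmetric_form.intro[OF assms(1,2)])
  have L: "integral_lattice b L" using even by (simp add: even_integral_lattice_def)
  obtain P\<^sub>1 P\<^sub>2 L\<^sub>0 where P1: "hyperbolic_plane b P\<^sub>1" and P2: "hyperbolic_plane b P\<^sub>2"
    and L0: "integral_lattice b L\<^sub>0"
    and orth: "orthogonal_sets b P\<^sub>1 P\<^sub>2" "orthogonal_sets b P\<^sub>1 L\<^sub>0" "orthogonal_sets b P\<^sub>2 L\<^sub>0"
    and L_sum: "L = {x + y + z | x y z. x \<in> P\<^sub>1 \<and> y \<in> P\<^sub>2 \<and> z \<in> L\<^sub>0}"
    using planes unfolding two_hyperbolic_planes_def by (elim exE conjE) (rule that)
  obtain e f where ef: "lattice_basis [e, f] P\<^sub>1" "b e e = 0" "b f f = 0" "b e f = 1"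
    using P1 unfolding hyperbolic_plane_def by (elim exE conjE) (rule that)
  obtain e' f' where ef': "lattice_basis [e', f'] P\<^sub>2" "b e' e' = 0" "b f' f' = 0" "b e' f' = 1"
    using P2 unfolding hyperbolic_plane_def by (elim exE conjE) (rule that)
  have P1_eq: "P\<^sub>1 = {of_int i *\<^sub>R e + of_int j *\<^sub>R f | i j. True}"
    and P2_eq: "P\<^sub>2 = {of_int i *\<^sub>R e' + of_int j *\<^sub>R f' | i j. True}"
  proof -
    have "e \<noteq> f" "P\<^sub>1 = zspan {e, f}" "e' \<noteq> f'" "P\<^sub>2 = zspan {e', f'}"
      using ef(1) ef'(1) by (simp_all add: lattice_basis_def)
    then show "P\<^sub>1 = {of_int i *\<^sub>R e + of_int j *\<^sub>R f | i j. True}"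
      "P\<^sub>2 = {of_int i *\<^sub>R e' + of_int j *\<^sub>R f' | i j. True}"
      by (simp_all only: zspan_pair not_False_eq_True)
  qed
  have mem: "e \<in> P\<^sub>1" "f \<in> P\<^sub>1" "e' \<in> P\<^sub>2" "f' \<in> P\<^sub>2"
  proof -
    have "P\<^sub>1 = zspan {e, f}" "P\<^sub>2 = zspan {e', f'}"
      using ef(1) ef'(1) by (simp_all add: lattice_basis_def)
    then show "e \<in> P\<^sub>1" "f \<in> P\<^sub>1" "e' \<in> P\<^sub>2" "f' \<in> P\<^sub>2"
      by (simp_all only:) (rule zspan_superset; simp)+
  qed
  obtain ws where ws: "lattice_basis ws L\<^sub>0" using L0 by (auto simp: integral_lattice_def)
  define B\<^sub>0 where "B\<^sub>0 = set ws"
  have B0: "finite B\<^sub>0" "L\<^sub>0 = zspan B\<^sub>0" using ws by (simp_all add: B\<^sub>0_def lattice_basis_def)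
  obtain N :: int where N: "N \<noteq> 0"
    and dual: "\<forall>w\<in>B\<^sub>0. \<exists>d\<in>L\<^sub>0. \<forall>w'\<in>B\<^sub>0. b d w' = (if w' = w then of_int N else 0)"
    using integral_lattice_scaled_dual_basis[OF L0 ws] unfolding B\<^sub>0_def by blast
  from bchoice[OF dual[unfolded Bex_def]] obtain d where
    d: "\<forall>w\<in>B\<^sub>0. d w \<in> L\<^sub>0 \<and> (\<forall>w'\<in>B\<^sub>0. b (d w) w' = (if w' = w then of_int N else 0))" ..
  \<comment> \<open>The scalar is written as a rational so that membership in
    \<open>rational_span\<close> is immediate; \<open>\<xi>_scale\<close> gives the real form used
    for pairings.\<close>
  define \<xi> where "\<xi> w = of_rat (1 / of_int N) *\<^sub>R d w" for w
  have \<xi>_scale: "\<xi> w = (1 / of_int N) *\<^sub>R d w" for w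
    unfolding \<xi>_def of_rat_divide of_rat_of_int_eq of_rat_1 ..
  have L_eq: "L = {of_int i *\<^sub>R e + of_int j *\<^sub>R f + of_int k *\<^sub>R e' + of_int l *\<^sub>R f' + z | i j k l z. z \<in> L\<^sub>0}"
    (is "L = ?R")
  proof (intro equalityI subsetI)
    fix x assume "x \<in> L"
    then obtain y y' z where x: "x = y + y' + z" "y \<in> P\<^sub>1" "y' \<in> P\<^sub>2" "z \<in> L\<^sub>0" unfolding L_sum by blast
    obtain i j where y: "y = of_int i *\<^sub>R e + of_int j *\<^sub>R f" using x(2) unfolding P1_eq by blast
    obtain k l where y': "y' = of_int k *\<^sub>R e' + of_int l *\<^sub>R f'" using x(3) unfolding P2_eq by blast
    have "x = of_int i *\<^sub>R e + of_int j *\<^sub>R f + of_int k *\<^sub>R e' + of_int l *\<^sub>R f' + z"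
      unfolding x(1) y y' by (simp add: add.assoc)
    then show "x \<in> ?R" using x(4) by (intro CollectI exI conjI)
  next
    fix x assume "x \<in> ?R"
    then obtain i j k l z where z: "z \<in> L\<^sub>0"
      and x: "x = of_int i *\<^sub>R e + of_int j *\<^sub>R f + of_int k *\<^sub>R e' + of_int l *\<^sub>R f' + z" by blast
    have "of_int i *\<^sub>R e + of_int j *\<^sub>R f \<in> P\<^sub>1" "of_int k *\<^sub>R e' + of_int l *\<^sub>R f' \<in> P\<^sub>2"
      unfolding P1_eq P2_eq by blast+
    moreover have "x = (of_int i *\<^sub>R e + of_int j *\<^sub>R f) + (of_int k *\<^sub>R e' + of_int l *\<^sub>R f') + z"
      unfolding x by (simp add: add.assoc)
    ultimately show "x \<in> L" unfolding L_sum using z by (intro CollectI exI conjI)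
  qed
  have pairs_L0: "b e z = 0" "b f z = 0" "b e' z = 0" "b f' z = 0" if "z \<in> L\<^sub>0" for z
    using orth(2,3) mem that by (auto simp: orthogonal_sets_def)
  have d_L0: "d w \<in> L\<^sub>0" if "w \<in> B\<^sub>0" for w using d that by blast
  have \<xi>_basis: "b (\<xi> w) w' = (if w' = w then 1 else 0)" if "w \<in> B\<^sub>0" "w' \<in> B\<^sub>0" for w w'
  proof -
    have "b (d w) w' = (if w' = w then of_int N else 0)" using d that by blast
    then show ?thesis using N by (simp add: \<xi>_scale)
  qed
  have L0_L: "z \<in> L" if "z \<in> L\<^sub>0" for z
  proof -
    have "z = of_int 0 *\<^sub>R e + of_int 0 *\<^sub>R f + of_int 0 *\<^sub>R e' + of_int 0 *\<^sub>R f' + z" by simp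
    then show ?thesis unfolding L_eq using that by blast
  qed
  have \<xi>_pairs: "b e (\<xi> w) = 0" "b f (\<xi> w) = 0" "b e' (\<xi> w) = 0" "b f' (\<xi> w) = 0" if "w \<in> B\<^sub>0" for w
    using pairs_L0[OF d_L0[OF that]] by (simp_all add: \<xi>_scale)
  have \<xi>_dual: "\<xi> w \<in> dual_lattice b L" if w: "w \<in> B\<^sub>0" for w
  proof -
    have "\<xi> w \<in> rational_span L"
      unfolding rational_span_def \<xi>_def using L0_L[OF d_L0[OF w]] by blast
    moreover have "b (\<xi> w) y \<in> \<int>" if "y \<in> L" for y
    proof -
      obtain i j k l z where z: "z \<in> L\<^sub>0"
        and y: "y = of_int i *\<^sub>R e + of_int j *\<^sub>R f + of_int k *\<^sub>R e' + of_int l *\<^sub>R f' + z"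
        using \<open>y \<in> L\<close> unfolding L_eq by blast
      obtain c where c: "z = (\<Sum>v\<in>B\<^sub>0. of_int (c v) *\<^sub>R v)"
        using z unfolding B0(2) by (rule zspanE)
      have "b (\<xi> w) y = b (\<xi> w) z"
        unfolding y using \<xi>_pairs[OF w]
        by (simp add: sym[of "\<xi> w" e] sym[of "\<xi> w" f] sym[of "\<xi> w" e'] sym[of "\<xi> w" f'])
      also have "\<dots> = (\<Sum>v\<in>B\<^sub>0. of_int (c v) * b (\<xi> w) v)" unfolding c form_sum by simp
      also have "\<dots> \<in> \<int>"
        using \<xi>_basis[OF w] by (intro Ints_sum Ints_mult) auto
      finally show ?thesis .
    qed
    ultimately show ?thesis by (simp add: dual_lattice_def)
  qed
  have L_even: "b x x / 2 \<in> \<int>" if x: "x \<in> L" for x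
  proof -
    obtain k :: int where "b x x = of_int (2 * k)"
      using even x by (auto simp: even_integral_lattice_def)
    then have "b x x / 2 = of_int k" by simp
    then show ?thesis by simp
  qed
  have pairs: "b e e' = 0" "b e f' = 0" "b f e' = 0" "b f f' = 0"
    using orth(1) mem by (auto simp: orthogonal_sets_def)
  have L_integral: "b x y \<in> \<int>" if "x \<in> L" "y \<in> L" for x y
    using L that unfolding integral_lattice_def by blast
  have perp: "x = 0" if "\<And>y. y \<in> L \<Longrightarrow> b x y = 0" for x
    by (rule integral_lattice_perp_eq_0[OF L span that])
  have "nondegenerate_form b"
    by unfold_locales (rule perp)
  moreover have "two_hyperbolic_pairs_axioms b L L\<^sub>0 B\<^sub>0 \<xi> e f e' f'"
    by (rule two_hyperbolic_pairs_axioms.intro[OF ef(2-4) ef'(2-4) pairs pairs_L0 L_eq L_integral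
          L_even perp B0 \<xi>_dual \<xi>_pairs \<xi>_basis])
  ultimately have "two_hyperbolic_pairs b L L\<^sub>0 B\<^sub>0 \<xi> e f e' f'"
    by (rule two_hyperbolic_pairs.intro)
  then show ?thesis by blast
qed

theorem theorem1p7:
  fixes b :: "real^'n \<Rightarrow> real^'n \<Rightarrow> real" and L :: "(real^'n) set"
  assumes "bilinear b"
    and "\<And>x y. b x y = b y x"
    and "even_integral_lattice b L"
    and "span L = UNIV"
    and "two_hyperbolic_planes b L"
    and "p_rank 2 b L \<ge> 6"
    and "p_rank 3 b L \<ge> 5"
  shows "trivial_group (abelianisation (maps_group (stable_special_orth_plus b L))) \<and>
         abelianisation (maps_group (stable_orth_plus b L)) \<cong> integer_mod_group 2"
proof -
  obtain L\<^sub>0 B\<^sub>0 \<xi> e f e' f' where "two_hyperbolic_pairs b L L\<^sub>0 B\<^sub>0 \<xi> e f e' f'"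
    using two_hyperbolic_pairs_exist[OF assms(1-5)] by (elim exE) (rule that)
  then interpret two_hyperbolic_pairs b L L\<^sub>0 B\<^sub>0 \<xi> e f e' f' .
  show ?thesis
    using abelianisation_stable_groups p_rank_ge_5[of 2] p_rank_ge_5[of 3] assms(6,7) by simp
qed

end
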